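(* Let $K\ge0$ be a fixed integer. Then, as $n\to\infty$, $$d_{1,2;2}^{[K]}(n)-d_{2,1;2}^{[K]}(n)=\frac{(-1)^Ke^{\pi\sqrt{n/3}}}{2^{K+3}\sqrt6\,n}\left(1+O\!\left(n^{-1/4}\right)\right).$$ In particular, as $n\to\infty$, $$\frac{d_{1,2;2}^{[K]}(n)}{d_{2,1;2}^{[K]}(n)}\to1.$$
   Context: $d_{1,2;2}^{[K]}(n)$ (respectively $d_{2,1;2}^{[K]}(n)$) denotes the number of partitions of $n$ into distinct parts, all of whose parts are greater than $K$, having strictly more odd parts than even parts (respectively strictly more even parts than odd parts). Implied constants may depend on $K$. *)

theory Defs
  imports Complex_Main "HOL-Library.Multiset" "HOL-Library.Landau_Symbols"
begin

text \<open>A partition of \<open>n\<close> is encoded as the multiset of its parts. The condition \<open>count P p \<le> 1\<close>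
  says that the parts are distinct, and \<open>K < p\<close> (with \<open>K :: nat\<close>) includes positivity of the parts.\<close>

definition distinct_partitions_gt :: "nat \<Rightarrow> nat \<Rightarrow> nat multiset set" where
  "distinct_partitions_gt K n =
     {P. sum_mset P = n \<and> (\<forall>p. count P p \<le> 1) \<and> (\<forall>p\<in>#P. K < p)}"

definition odd_parts :: "nat multiset \<Rightarrow> nat" where
  "odd_parts P = size (filter_mset odd P)"

definition even_parts :: "nat multiset \<Rightarrow> nat" where
  "even_parts P = size (filter_mset even P)"

text \<open>The quantities written $d_{1,2;2}^{[K]}(n)$ and $d_{2,1;2}^{[K]}(n)$.\<close>

definition d12 :: "nat \<Rightarrow> nat \<Rightarrow> nat" where
  "d12 K n = card {P \<in> distinct_partitions_gt K n. even_parts P < odd_parts P}"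

definition d21 :: "nat \<Rightarrow> nat \<Rightarrow> nat" where
  "d21 K n = card {P \<in> distinct_partitions_gt K n. odd_parts P < even_parts P}"

text \<open>The sets counted above are finite, so \<open>card\<close> is a genuine count.\<close>

lemma finite_distinct_partitions_gt: "finite (distinct_partitions_gt K n)"
proof (rule finite_subset)
  show "distinct_partitions_gt K n \<subseteq> mset_set ` Pow {..n}"
  proof
    fix P assume P: "P \<in> distinct_partitions_gt K n"
    have "P = mset_set (set_mset P)"
    proof (rule multiset_eqI)
      fix p
      have "count P p = 0 \<or> count P p = 1"
        using P by (auto simp: distinct_partitions_gt_def le_Suc_eq)
      then show "count P p = count (mset_set (set_mset P)) p"
        by (auto simp: count_mset_set' count_eq_zero_iff)
    qed
    moreover have "set_mset P \<subseteq> {..n}"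
    proof
      fix p assume "p \<in># P"
      then obtain Q where "P = add_mset p Q" by (auto dest: multi_member_split)
      then show "p \<in> {..n}" using P by (auto simp: distinct_partitions_gt_def)
    qed
    ultimately show "P \<in> mset_set ` Pow {..n}" by blast
  qed
qed simp

end

theory Submission
  imports Defs "HOL-Probability.Distributions"
begin

text \<open>The argument is a two-dimensional local limit theorem. With \<open>t = pi / (2 * sqrt (3 * n))\<close>, make the parts
  independent random variables with weights \<open>exp (- t * p)\<close>, and mark odd parts by \<open>cis \<alpha>\<close> and even parts by
  \<open>cis (- \<alpha>)\<close>. Both counting functions are double Fourier integrals of the product
  \<open>\<Phi>(\<theta>, \<alpha>) = (\<Prod>p. 1 + exp (- t * p + \<i> * (\<theta> * p \<plusminus> \<alpha>)))\<close>: the difference against \<open>cot (\<alpha> / 2)\<close>, whose Fourier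
  coefficients are signs, and the number of partitions with a fixed excess of odd parts against \<open>cis (- d * \<alpha>)\<close>.
  The part of \<open>ln \<Phi>\<close> even in \<open>\<alpha>\<close> is Gaussian up to cubic terms. The part odd in \<open>\<alpha>\<close> is an alternating sum,
  so second differences give \<open>(- 1) ^ K * \<i> * \<alpha> / 4\<close> to leading order: half the first term, by Abel summation.
  Away from the origin \<open>\<Phi>\<close> is smaller by a factor \<open>exp (- c / t)\<close>. For the quotient, the partitions with excess
  \<open>- 1, - 2, \<dots>, - J\<close> each contribute a multiple of the same order as the difference, with \<open>J\<close> arbitrary.\<close>

section \<open>Complex logarithms of the factors\<close>

text \<open>The size of the relative error comes from the natural scales. The quadratic form of
  \<open>gauss_exp\<close> gives \<alpha> the width \<open>sqrt t\<close> and \<theta> the width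
  \<open>t * sqrt t\<close>; there the cubic Taylor terms, of order \<open>\<alpha> ^ 3 / t\<close>
  and \<open>\<theta> ^ 3 / t ^ 4\<close>, are both of order \<open>sqrt t\<close>, that is, of
  order \<open>n powr (-1/4)\<close>. The value of \<open>t\<close> is the saddle point: the
  expected sum of the parts is \<open>pi\<^sup>2 / (12 * t\<^sup>2)\<close> to leading order, and
  this is set equal to \<open>n\<close>. The obstacle in the difference is the pole of the cotangent
  at \<open>\<alpha> = 0\<close>. A bound on the product alone does not suffice near it: on both
  arcs the difference of the values at \<alpha> and \<open>- \<alpha>\<close> has to be bounded with
  an extra factor \<alpha>. This is why \<open>log_Phi\<close> is split into parts even and odd in
  \<alpha>, and why the error for the odd part carries a factor \<alpha>. Only parts up to
  \<open>n\<close> enter, so all products and sums are finite. Since \<open>t * n\<close> has the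
  order of \<open>1 / t\<close>, this cut-off costs less than any power of \<open>t\<close>.\<close>

definition ell :: "complex \<Rightarrow> complex" where "ell w = Ln (1 + exp (- w))"
text \<open>On the real axis \<open>mu\<close>, \<open>nu\<close> and \<open>ka\<close> are the
  first three cumulants of a Bernoulli variable with odds \<open>exp (- w)\<close>. Each is minus
  the derivative of its predecessor, starting from \<open>ell\<close>.\<close>

definition mu :: "complex \<Rightarrow> complex" where "mu w = exp (- w) / (1 + exp (- w))"
definition nu :: "complex \<Rightarrow> complex" where "nu w = exp (- w) / (1 + exp (- w))\<^sup>2"
definition ka :: "complex \<Rightarrow> complex" where "ka w = exp (- w) * (1 - exp (- w)) / (1 + exp (- w)) ^ 3"

text \<open>A truncated wedge around the positive axis. It is convex, so mean value estimates apply
  inside it; it contains every argument \<open>wpt\<close> of the major arc; and where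
  \<open>0 \<le> Re w\<close> the value \<open>1 + exp (- w)\<close> keeps away from the branch cut
  of \<open>Ln\<close>. The parameter \<open>x\<close> records the decay
  \<open>exp (- x)\<close>.\<close>

definition sector :: "real \<Rightarrow> complex set" where
  "sector x = {w. x \<le> Re w \<and> 2 * \<bar>Im w\<bar> \<le> 1 + Re w}"

lemma convex_sector: "convex (sector x)"
proof -
  have eq: "sector x = {w. 1 * Re w \<ge> x} \<inter> {w. (-1) * Re w + 2 * Im w \<le> 1} \<inter> {w. (-1) * Re w + (-2) * Im w \<le> 1}"
    by (auto simp: sector_def abs_if)
  have c1: "convex {w. 1 * Re w \<ge> x}"
    using convex_halfspace_Re_ge[of x] by simp
  have "{w. a * Re w + b * Im w \<le> c} = {w. inner (Complex a b) w \<le> c}" for a b c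
    by (auto simp: inner_complex_def)
  then have c2: "convex {w. a * Re w + b * Im w \<le> c}" for a b c
    using convex_halfspace_le by metis
  show ?thesis unfolding eq by (intro convex_Int c1 c2)
qed

text \<open>The cosine is nonnegative while \<open>\<bar>Im w\<bar> \<le> pi / 2\<close>; beyond
  that the slope of the wedge forces \<open>1 \<le> Re w\<close>, where \<open>exp (- w)\<close> has
  modulus at most 1/2.\<close>

lemma Re_one_plus_exp_sector:
  assumes "w \<in> sector x" "0 \<le> x"
  shows "Re (1 + exp (- w)) \<ge> 1 / 2"
proof (cases "\<bar>Im w\<bar> \<le> pi / 2")
  case True
  then have "cos (Im w) \<ge> 0" by (intro cos_ge_zero) auto
  then show ?thesis by (simp add: Re_exp add_increasing2)
next
  case False
  then have "Re w \<ge> 1" using assms pi_gt3 by (auto simp: sector_def)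
  have "exp (Re w) \<ge> 2" using exp_ge_add_one_self[of "Re w"] \<open>Re w \<ge> 1\<close> by linarith
  then have "exp (- Re w) \<le> 1 / 2" by (simp add: exp_minus divide_simps)
  moreover have "\<bar>exp (- Re w) * cos (Im w)\<bar> \<le> exp (- Re w) * 1"
    unfolding abs_mult by (intro mult_mono) auto
  ultimately show ?thesis by (simp add: Re_exp abs_if split: if_splits)
qed

lemma norm_one_plus_exp_sector:
  assumes "w \<in> sector x" "0 \<le> x"
  shows "norm (1 + exp (- w)) \<ge> 1 / 2" "1 + exp (- w) \<noteq> 0"
proof -
  show "norm (1 + exp (- w)) \<ge> 1 / 2"
    using Re_one_plus_exp_sector[OF assms] complex_Re_le_cmod order_trans by blast
  then show "1 + exp (- w) \<noteq> 0" by auto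
qed

lemma exp_ell: "1 + exp (- w) \<noteq> 0 \<Longrightarrow> exp (ell w) = 1 + exp (- w)"
  by (simp add: ell_def)

lemma has_field_derivative_ell:
  assumes "w \<in> sector x" "0 \<le> x"
  shows "(ell has_field_derivative - mu w) (at w within S)"
proof -
  have "1 + exp (- w) \<notin> \<real>\<^sub>\<le>\<^sub>0"
    using Re_one_plus_exp_sector[OF assms] by (auto simp: complex_nonpos_Reals_iff)
  then show ?thesis unfolding ell_def[abs_def]
    by (auto intro!: derivative_eq_intros simp: mu_def divide_inverse mult.commute)
qed

lemma has_field_derivative_mu:
  assumes "w \<in> sector x" "0 \<le> x"
  shows "(mu has_field_derivative - nu w) (at w within S)"
  unfolding mu_def[abs_def] using norm_one_plus_exp_sector(2)[OF assms]
  by (auto intro!: derivative_eq_intros simp: nu_def power2_eq_square field_simps)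

lemma has_field_derivative_nu:
  assumes "w \<in> sector x" "0 \<le> x"
  shows "(nu has_field_derivative - ka w) (at w within S)"
proof -
  define z where "z = exp (- w)"
  have nz: "1 + z \<noteq> 0" using norm_one_plus_exp_sector(2)[OF assms] by (simp add: z_def)
  have "(nu has_field_derivative
      ((- z) * (1 + z)\<^sup>2 - z * (2 * (1 + z) * (- z))) / ((1 + z)\<^sup>2 * (1 + z)\<^sup>2)) (at w within S)"
    unfolding nu_def[abs_def] using nz
    by (auto intro!: derivative_eq_intros simp: z_def power2_eq_square)
  moreover have "((- z) * (1 + z)\<^sup>2 - z * (2 * (1 + z) * (- z))) / ((1 + z)\<^sup>2 * (1 + z)\<^sup>2)
      = - (z * (1 - z) / (1 + z) ^ 3)"
  proof -
    have "((- z) * (1 + z)\<^sup>2 - z * (2 * (1 + z) * (- z))) = (1 + z) * (- (z * (1 - z)))"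
      by (simp add: algebra_simps power2_eq_square)
    moreover have "(1 + z)\<^sup>2 * (1 + z)\<^sup>2 = (1 + z) * (1 + z) ^ 3"
      by (simp add: power2_eq_square power3_eq_cube)
    ultimately show ?thesis using nz by (metis minus_divide_left mult_divide_mult_cancel_left)
  qed
  ultimately show ?thesis by (simp add: ka_def z_def)
qed

lemma norm_exp_sector_le:
  assumes "w \<in> sector x" "0 \<le> x"
  shows "norm (exp (- w)) \<le> exp (- x)" "norm (exp (- w)) \<le> 1"
  using assms by (auto simp: sector_def)

lemma norm_mu_le:
  assumes "w \<in> sector x" "0 \<le> x"
  shows "norm (mu w) \<le> 2 * exp (- x)"
proof -
  have "norm (mu w) \<le> exp (- x) / (1 / 2)"
    unfolding mu_def norm_divide
    using norm_exp_sector_le(1)[OF assms] norm_one_plus_exp_sector(1)[OF assms]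
    by (intro frac_le) auto
  then show ?thesis by simp
qed

lemma norm_nu_le:
  assumes "w \<in> sector x" "0 \<le> x"
  shows "norm (nu w) \<le> 4 * exp (- x)"
proof -
  have "norm (nu w) \<le> exp (- x) / (1 / 2)\<^sup>2"
    unfolding nu_def norm_divide norm_power
    using norm_exp_sector_le(1)[OF assms] norm_one_plus_exp_sector(1)[OF assms]
    by (intro frac_le power_mono) auto
  then show ?thesis by (simp add: power2_eq_square)
qed

lemma norm_ka_le:
  assumes "w \<in> sector x" "0 \<le> x"
  shows "norm (ka w) \<le> 16 * exp (- x)"
proof -
  have "norm (1 - exp (- w)) \<le> 2"
    using norm_exp_sector_le(2)[OF assms] norm_triangle_ineq4[of 1 "exp (- w)"]
    unfolding norm_one by linarith
  then have "norm (ka w) \<le> (exp (- x) * 2) / (1 / 2) ^ 3"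
    unfolding ka_def norm_divide norm_power norm_mult
    using norm_exp_sector_le(1)[OF assms] norm_one_plus_exp_sector(1)[OF assms]
    by (intro frac_le power_mono mult_mono) auto
  then show ?thesis by (simp add: power3_eq_cube)
qed

lemma ell_diff_le:
  assumes "w \<in> sector x" "z \<in> sector x" "0 \<le> x"
  shows "norm (ell w - ell z) \<le> 2 * exp (- x) * norm (w - z)"
  by (rule field_differentiable_bound[OF convex_sector[of x], where f' = "\<lambda>w. - mu w"])
     (use assms norm_mu_le has_field_derivative_ell in auto)

lemma mu_diff_le:
  assumes "w \<in> sector x" "z \<in> sector x" "0 \<le> x"
  shows "norm (mu w - mu z) \<le> 4 * exp (- x) * norm (w - z)"
  by (rule field_differentiable_bound[OF convex_sector[of x], where f' = "\<lambda>w. - nu w"])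
     (use assms norm_nu_le has_field_derivative_mu in auto)

lemma nu_diff_le:
  assumes "w \<in> sector x" "z \<in> sector x" "0 \<le> x"
  shows "norm (nu w - nu z) \<le> 16 * exp (- x) * norm (w - z)"
  by (rule field_differentiable_bound[OF convex_sector[of x], where f' = "\<lambda>w. - ka w"])
     (use assms norm_ka_le has_field_derivative_nu in auto)

text \<open>The third derivative of \<open>ell\<close> is \<open>- ka\<close>, of size at most
  \<open>16 * exp (- x)\<close>; the remainder estimate divides it by \<open>fact 2\<close>, which
  gives the 8.\<close>

lemma ell_taylor:
  assumes "w \<in> sector x" "z \<in> sector x" "0 \<le> x"
  shows "norm (ell z - (ell w - mu w * (z - w) + nu w * (z - w)\<^sup>2 / 2))
    \<le> 8 * exp (- x) * norm (z - w) ^ 3"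
proof -
  define f where "f = (\<lambda>i::nat. if i = 0 then ell else if i = 1 then (\<lambda>w. - mu w) else if i = 2 then nu else (\<lambda>w. - ka w))"
  have "norm (f 0 z - (\<Sum>i\<le>2. f i w * (z - w) ^ i / fact i)) \<le> (16 * exp (- x)) * norm (z - w) ^ Suc 2 / fact 2"
  proof (rule complex_Taylor[OF convex_sector[of x]])
    fix i :: nat and u assume u: "u \<in> sector x" and "i \<le> 2"
    then consider "i = 0" | "i = 1" | "i = 2" by linarith
    then show "(f i has_field_derivative f (Suc i) u) (at u within sector x)"
      by cases (use has_field_derivative_ell[OF u] has_field_derivative_nu[OF u]
          has_field_derivative_mu[OF u, THEN DERIV_minus] assms(3) in \<open>auto simp: f_def\<close>)
  qed (use assms norm_ka_le in \<open>auto simp: f_def\<close>)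
  moreover have "(\<Sum>i\<le>2. f i w * (z - w) ^ i / fact i) = ell w - mu w * (z - w) + nu w * (z - w)\<^sup>2 / 2"
    by (simp add: f_def eval_nat_numeral)
  ultimately show ?thesis by (simp add: f_def eval_nat_numeral)
qed

text \<open>The increment \<open>mu (u + s) - mu u\<close> is itself moved by a step
  \<open>s\<close>, so this is a mean value estimate whose derivative is a difference of two values
  of \<open>nu\<close>.\<close>

lemma mu_second_difference_le:
  assumes "w \<in> sector x" "w + s \<in> sector x" "w + 2 * s \<in> sector x" "0 \<le> x"
  shows "norm (mu w - 2 * mu (w + s) + mu (w + 2 * s)) \<le> 16 * exp (- x) * (norm s)\<^sup>2"
proof -
  \<comment> \<open>Convexity is used on the segments from \<open>w\<close> to \<open>w + s\<close>
    and from \<open>w + s\<close> to \<open>w + 2 * s\<close>, traversed in parallel.\<close>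
  have seg: "w + of_real r * s \<in> sector x \<and> w + of_real r * s + s \<in> sector x" if "r \<in> {0..1}" for r
  proof -
    have "(1 - r) *\<^sub>R w + r *\<^sub>R (w + s) \<in> sector x" "(1 - r) *\<^sub>R (w + s) + r *\<^sub>R (w + 2 * s) \<in> sector x"
      using that assms by (auto intro!: convexD[OF convex_sector])
    moreover have "(1 - r) *\<^sub>R w + r *\<^sub>R (w + s) = w + of_real r * s"
      "(1 - r) *\<^sub>R (w + s) + r *\<^sub>R (w + 2 * s) = w + of_real r * s + s"
      by (simp_all add: scaleR_conv_of_real algebra_simps)
    ultimately show ?thesis by simp
  qed
  define m where "m = (\<lambda>u. mu (u + s) - mu u)"
  have "norm (m (w + s) - m w) \<le> (16 * exp (- x) * norm s) * norm ((w + s) - w)"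
  proof (rule field_differentiable_bound[where S = "closed_segment w (w + s)"
         and f' = "\<lambda>u. - nu (u + s) + nu u"])
    fix u assume "u \<in> closed_segment w (w + s)"
    then obtain r where r: "r \<in> {0..1}" "u = (1 - r) *\<^sub>R w + r *\<^sub>R (w + s)"
      by (auto simp: closed_segment_def)
    then have r2: "u = w + of_real r * s"
      by (simp add: scaleR_conv_of_real algebra_simps)
    have S: "u \<in> sector x" "u + s \<in> sector x" using seg[OF r(1)] r2 by simp_all
    have "((\<lambda>u. mu (u + s)) has_field_derivative - nu (u + s) * 1) (at u within closed_segment w (w + s))"
    proof (rule DERIV_chain2[where f = mu and g = "\<lambda>u. u + s" and x = u])
      show "(mu has_field_derivative - nu (u + s)) (at (u + s))"
        by (rule has_field_derivative_mu[OF S(2) assms(4)])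
      show "((\<lambda>u. u + s) has_field_derivative 1) (at u within closed_segment w (w + s))"
        by (auto intro!: derivative_eq_intros)
    qed
    note d = DERIV_diff[OF this has_field_derivative_mu[OF S(1) assms(4)]]
    show "(m has_field_derivative - nu (u + s) + nu u) (at u within closed_segment w (w + s))"
      unfolding m_def by (rule DERIV_cong[OF d]) simp
    show "norm (- nu (u + s) + nu u) \<le> 16 * exp (- x) * norm s"
    proof -
      have "- nu (u + s) + nu u = nu u - nu (u + s)" by (rule uminus_add_conv_diff)
      moreover have "norm (u - (u + s)) = norm s" by (metis add_diff_cancel_left' norm_minus_commute)
      ultimately show ?thesis using nu_diff_le[OF S(1) S(2) assms(4)] by metis
    qed
  qed auto
  moreover have "m (w + s) - m w = mu w - 2 * mu (w + s) + mu (w + 2 * s)"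
  proof -
    have "w + 2 * s = w + s + s" by simp
    then show ?thesis unfolding m_def by (simp add: add.commute)
  qed
  ultimately show ?thesis by (simp add: power2_eq_square mult.assoc)
qed

lemma of_real_ell: "ell (of_real x) = of_real (ln (1 + exp (- x)))"
proof -
  have "ell (of_real x) = Ln (of_real (1 + exp (- x)))"
    unfolding ell_def of_real_minus[symmetric] exp_of_real by simp
  also have "\<dots> = of_real (ln (1 + exp (- x)))"
    using add_pos_pos[OF zero_less_one exp_gt_zero[of "-x"]] by (rule Ln_of_real)
  finally show ?thesis .
qed

lemma norm_exp_minus_one_le: "norm (exp z - 1 :: complex) \<le> norm z * exp (norm z)"
proof -
  have "norm (exp z - exp 0) \<le> exp (norm z) * norm (z - 0)"
  proof (rule field_differentiable_bound[where S = "cball 0 (norm z)" and f' = exp])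
    fix u :: complex assume "u \<in> cball 0 (norm z)"
    then show "norm (exp u) \<le> exp (norm z)"
      using norm_exp[of u] by (auto intro: order_trans)
  qed (auto intro!: derivative_eq_intros)
  then show ?thesis by (simp add: mult.commute)
qed

lemma norm_exp_minus_one_minus_le: "norm (exp z - 1 - z :: complex) \<le> (norm z)\<^sup>2 * exp (norm z)"
proof -
  have "norm ((exp z - z) - (exp 0 - 0)) \<le> (norm z * exp (norm z)) * norm (z - 0)"
  proof (rule field_differentiable_bound[where S = "cball 0 (norm z)" and f' = "\<lambda>u. exp u - 1"])
    fix u :: complex assume "u \<in> cball 0 (norm z)"
    then have "norm u * exp (norm u) \<le> norm z * exp (norm z)" by (intro mult_mono) auto
    then show "norm (exp u - 1) \<le> norm z * exp (norm z)"
      using norm_exp_minus_one_le[of u] by linarith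
  qed (auto intro!: derivative_eq_intros)
  then show ?thesis by (simp add: power2_eq_square algebra_simps)
qed

section \<open>Alternating sums by repeated summation by parts\<close>

lemma alternating_sum_eq:
  fixes g :: "nat \<Rightarrow> complex"
  shows "(\<Sum>j<M. (-1) ^ j * g j) = (g 0 - (-1) ^ M * g M) / 2 + (\<Sum>j<M. (-1) ^ j * (g j - g (Suc j))) / 2"
  by (induction M) (auto simp: field_simps)

text \<open>\<open>alternating_sum_eq\<close> is used twice, on \<open>g\<close> and on its first
  differences. For slowly varying \<open>g\<close> half of the first term remains; the rest involves
  second differences, so that about \<open>1 / t\<close> terms of size \<open>t\<^sup>2\<close> add
  up to order \<open>t\<close> only.\<close>

lemma alternating_sum_le:
  fixes g :: "nat \<Rightarrow> complex"
  shows "norm ((\<Sum>j<M. (-1) ^ j * g j) - g 0 / 2) \<le> norm (g M) / 2 + norm (g 0 - g 1) / 4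
     + norm (g M - g (Suc M)) / 4 + (\<Sum>j<M. norm (g j - 2 * g (Suc j) + g (Suc (Suc j)))) / 4"
proof -
  define h where "h = (\<lambda>j. g j - g (Suc j))"
  define S where "S = (\<Sum>j<M. (-1) ^ j * (h j - h (Suc j)))"
  obtain B where B: "B = (\<Sum>j<M. (-1) ^ j * h j)" by blast
  have "(\<Sum>j<M. (-1) ^ j * g j) = (g 0 - (-1) ^ M * g M) / 2 + B / 2"
    unfolding B h_def by (rule alternating_sum_eq)
  moreover have "B = (h 0 - (-1) ^ M * h M) / 2 + S / 2"
    unfolding B S_def by (rule alternating_sum_eq)
  moreover have "A - x / 2 = - y / 2 + z / 4 - v / 4 + S / 4"
    if "A = (x - y) / 2 + B / 2" "B = (z - v) / 2 + S / 2" for A B S x y z v :: complex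
    using that by (simp add: diff_divide_distrib add_divide_distrib)
  ultimately have "(\<Sum>j<M. (-1) ^ j * g j) - g 0 / 2 = - ((-1) ^ M * g M) / 2 + h 0 / 4 - (-1) ^ M * h M / 4 + S / 4"
    by blast
  also have "norm \<dots> \<le> norm (g M) / 2 + norm (h 0) / 4 + norm (h M) / 4 + norm S / 4"
  proof -
    have "norm (a + b - c + d) \<le> norm a + norm b + norm c + norm d" for a b c d :: complex
      using norm_triangle_ineq[of "a + b - c" d] norm_triangle_ineq4[of "a + b" c] norm_triangle_ineq[of a b]
      by linarith
    from this[of "- ((-1) ^ M * g M) / 2" "h 0 / 4" "(-1) ^ M * h M / 4" "S / 4"]
    show ?thesis by (simp add: norm_divide norm_mult norm_power)
  qed
  also have "norm S \<le> (\<Sum>j<M. norm (g j - 2 * g (Suc j) + g (Suc (Suc j))))"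
    unfolding S_def
  proof (rule order_trans[OF norm_sum], rule sum_mono)
    fix j
    have "h j - h (Suc j) = g j - 2 * g (Suc j) + g (Suc (Suc j))" by (simp add: h_def)
    then show "norm ((-1) ^ j * (h j - h (Suc j))) \<le> norm (g j - 2 * g (Suc j) + g (Suc (Suc j)))"
      by (simp add: norm_mult norm_power)
  qed
  finally show ?thesis by (simp add: h_def)
qed

section \<open>Asymptotics of the cumulant sums\<close>

text \<open>This is \<open>- Li_2 (- exp (- y))\<close> with the dilogarithm \<open>Li_2\<close>,
  equivalently the integral of \<open>ln (1 + exp (- u))\<close> over \<open>u\<close> from
  \<open>y\<close> to infinity. It is, up to sign, an explicit antiderivative of the summand of
  \<open>ln (Zt A t)\<close>.\<close>

definition dilog_exp :: "real \<Rightarrow> real" where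
  "dilog_exp y = (\<Sum>m. (-1) ^ m * exp (- y) ^ Suc m / (real (Suc m))\<^sup>2)"

lemma summable_inverse_Suc_squares: "summable (\<lambda>m. 1 / (real (Suc m))\<^sup>2)"
  using inverse_squares_sums by (simp add: sums_iff add.commute)

lemma sum_inverse_Suc_squares: "(\<Sum>m. 1 / (real (Suc m))\<^sup>2) = pi\<^sup>2 / 6"
  using inverse_squares_sums by (simp add: sums_iff add.commute)

lemma norm_dilog_term_le:
  assumes "0 \<le> y"
  shows "norm ((-1) ^ m * exp (- y) ^ Suc m / (real (Suc m))\<^sup>2 :: real) \<le> exp (- y) * (1 / (real (Suc m))\<^sup>2)"
proof -
  have "exp (- y) ^ Suc m \<le> exp (- y) * 1"
    unfolding power_Suc using assms by (intro mult_left_mono power_le_one) auto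
  then have "exp (- y) ^ Suc m / (real (Suc m))\<^sup>2 \<le> exp (- y) / (real (Suc m))\<^sup>2"
    by (intro divide_right_mono) auto
  then show ?thesis
    by (simp add: norm_mult norm_divide norm_power abs_mult power_abs del: power_Suc of_nat_Suc)
qed

lemma summable_dilog:
  assumes "0 \<le> y"
  shows "summable (\<lambda>m. norm ((-1) ^ m * exp (- y) ^ Suc m / (real (Suc m))\<^sup>2 :: real))"
  by (rule summable_comparison_test'[where N = 0, OF summable_mult[OF summable_inverse_Suc_squares, of "exp (- y)"]])
     (use norm_dilog_term_le[OF assms] in auto)

lemma abs_dilog_exp_le:
  assumes "0 \<le> y"
  shows "\<bar>dilog_exp y\<bar> \<le> 3 * exp (- y)"
proof -
  have "\<bar>dilog_exp y\<bar> \<le> (\<Sum>m. norm ((-1) ^ m * exp (- y) ^ Suc m / (real (Suc m))\<^sup>2 :: real))"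
    unfolding dilog_exp_def using summable_norm[OF summable_dilog[OF assms]] by simp
  also have "\<dots> \<le> (\<Sum>m. exp (- y) * (1 / (real (Suc m))\<^sup>2))"
    by (intro suminf_le norm_dilog_term_le summable_dilog summable_mult summable_inverse_Suc_squares assms)
  also have "\<dots> = exp (- y) * (pi\<^sup>2 / 6)"
    by (simp only: suminf_mult[OF summable_inverse_Suc_squares] sum_inverse_Suc_squares)
  also have "\<dots> \<le> exp (- y) * 3"
    using mult_mono[of pi 4 pi 4] pi_less_4 by (intro mult_left_mono) (auto simp: power2_eq_square)
  finally show ?thesis by simp
qed

text \<open>Subtracting from the series of \<open>pi\<^sup>2 / 6\<close> in blocks of two, the terms
  with odd denominator cancel and the other one doubles: \<open>2 / (2 * (n + 1))\<^sup>2\<close> is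
  half of \<open>f n\<close>. So half of the full series remains.\<close>

lemma dilog_exp_0: "dilog_exp 0 = pi\<^sup>2 / 12"
proof -
  define f where "f = (\<lambda>m. 1 / (real (Suc m))\<^sup>2)"
  define g where "g = (\<lambda>m. (-1) ^ m / (real (Suc m))\<^sup>2)"
  have f: "f sums (pi\<^sup>2 / 6)" using inverse_squares_sums by (simp add: f_def add.commute)
  have "summable g" using summable_dilog[of 0] summable_norm_cancel unfolding g_def by fastforce
  then have g: "g sums dilog_exp 0" by (simp add: dilog_exp_def g_def summable_sums)
  have "(\<lambda>n. sum f {n * 2..<n * 2 + 2} - sum g {n * 2..<n * 2 + 2}) sums (pi\<^sup>2 / 6 - dilog_exp 0)"
    by (intro sums_diff sums_group f g) auto
  moreover have eq: "sum f {n * 2..<n * 2 + 2} - sum g {n * 2..<n * 2 + 2} = f n / 2" for n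
  proof -
    have "{n * 2..<n * 2 + 2} = {n * 2, Suc (n * 2)}" by auto
    moreover have "real (Suc (Suc (n * 2))) = 2 * real (Suc n)" by simp
    ultimately show ?thesis
      by (simp add: f_def g_def power_mult_distrib power_mult mult.commute[of n 2] del: of_nat_Suc)
  qed
  moreover have "(\<lambda>n. f n / 2) sums (pi\<^sup>2 / 6 / 2)" by (intro sums_divide f)
  ultimately have "pi\<^sup>2 / 6 - dilog_exp 0 = pi\<^sup>2 / 6 / 2"
    unfolding eq by (metis sums_unique2)
  then show ?thesis by simp
qed

lemma continuous_on_dilog_exp: "continuous_on {0..} dilog_exp"
proof -
  have "uniform_limit {0..} (\<lambda>n y. \<Sum>m<n. (-1) ^ m * exp (- y) ^ Suc m / (real (Suc m))\<^sup>2)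
      dilog_exp sequentially"
    unfolding dilog_exp_def[abs_def]
  proof (rule Weierstrass_m_test[OF _ summable_inverse_Suc_squares])
    fix m and y :: real assume "y \<in> {0..}"
    then have "exp (- y) * (1 / (real (Suc m))\<^sup>2) \<le> 1 * (1 / (real (Suc m))\<^sup>2)"
      by (intro mult_right_mono) auto
    then show "norm ((-1) ^ m * exp (- y) ^ Suc m / (real (Suc m))\<^sup>2 :: real) \<le> 1 / (real (Suc m))\<^sup>2"
      using norm_dilog_term_le[of y m] \<open>y \<in> {0..}\<close> by simp
  qed
  then show ?thesis
    by (rule uniform_limit_theorem[rotated]) (auto intro!: always_eventually continuous_intros simp del: power_Suc of_nat_Suc)
qed

lemma DERIV_dilog_exp:
  assumes "0 < y"
  shows "(dilog_exp has_field_derivative - ln (1 + exp (- y))) (at y)"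
proof -
  \<comment> \<open>\<open>P\<close> is the power series with
    \<open>P (exp (- y)) = dilog_exp y\<close>. Its derivative at \<open>z = exp (- y)\<close> is
    \<open>ln (1 + z) / z\<close>, and the chain rule factor \<open>- z\<close> cancels the
    denominator.\<close>
  define c where "c = (\<lambda>n. if n = 0 then 0 else (-1) ^ (n - 1) / (real n)\<^sup>2)"
  define P where "P = (\<lambda>z. \<Sum>n. c n * z ^ n)"
  have sm: "summable (\<lambda>n. c n * z ^ n)" if "norm z < 1" for z :: real
  proof (rule summable_comparison_test'[where N = 0])
    show "summable (\<lambda>n. norm z ^ n)" using that by (simp add: summable_geometric)
    fix n
    have "norm (c n) \<le> 1"
    proof (cases n)
      case (Suc m)
      have "1 \<le> (1 + real m)\<^sup>2" by (rule one_le_power) auto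
      then show ?thesis using Suc by (simp add: c_def norm_divide norm_power divide_simps)
    qed (simp add: c_def)
    then have "norm (c n) * norm z ^ n \<le> 1 * norm z ^ n" by (intro mult_right_mono) auto
    then show "norm (c n * z ^ n) \<le> norm z ^ n" by (simp add: abs_mult power_abs)
  qed
  define z where "z = exp (- y)"
  have z: "0 < z" "z < 1" using assms by (auto simp: z_def)
  have "DERIV P z :> (\<Sum>n. diffs c n * z ^ n)"
    unfolding P_def by (rule termdiffs_strong'[where K = 1]) (use sm z in auto)
  moreover have zP: "z * (\<Sum>n. diffs c n * z ^ n) = ln (1 + z)"
  proof -
    have "summable (\<lambda>n. diffs c n * z ^ n)"
      by (rule termdiff_converges[of _ 1]) (use sm z in auto)
    then have "z * (\<Sum>n. diffs c n * z ^ n) = (\<Sum>n. z * (diffs c n * z ^ n))"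
      by (rule suminf_mult[symmetric])
    also have "\<dots> = (\<Sum>n. (-1) ^ n * (1 / real (n + 1)) * (1 + z - 1) ^ Suc n)"
      by (intro suminf_cong) (simp add: diffs_def c_def power2_eq_square)
    also have "\<dots> = ln (1 + z)"
      using z by (intro ln_series[symmetric]) auto
    finally show ?thesis .
  qed
  moreover have "(\<Sum>n. diffs c n * z ^ n) = ln (1 + z) / z" using z zP by (simp add: eq_divide_eq mult.commute)
  ultimately have "DERIV P z :> ln (1 + z) / z" by simp
  then have "((\<lambda>y. P (exp (- y))) has_field_derivative - ln (1 + exp (- y))) (at y)"
    unfolding z_def
    by (intro DERIV_cong[OF DERIV_chain2[where f = P and g = "\<lambda>y. exp (- y)" and Db = "- exp (- y)"]])
      (auto intro!: derivative_eq_intros)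
  moreover have "P (exp (- u)) = dilog_exp u" if "u \<in> {0<..}" for u
  proof -
    have "summable (\<lambda>n. c n * exp (- u) ^ n)" using that by (intro sm) auto
    from suminf_split_head[OF this]
    have "P (exp (- u)) = (\<Sum>n. c (Suc n) * exp (- u) ^ Suc n)"
      by (simp add: P_def c_def)
    then show ?thesis by (simp add: dilog_exp_def c_def)
  qed
  ultimately show ?thesis
    using assms by (subst (asm) has_field_derivative_cong_ev[where g = dilog_exp])
      (auto intro!: eventually_mono[OF eventually_nhds_in_open[of "{0<..}" y]])
qed

section \<open>Sums compared with integrals\<close>

lemma sum_exp_le:
  assumes "0 < a"
  shows "(\<Sum>p = 1..N. exp (- (a * real p))) \<le> 1 / a"
proof -
  \<comment> \<open>The induction carries the integral of \<open>exp (- (a * x))\<close> over the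
    interval from 0 to \<open>N\<close>; a step amounts to
    \<open>(1 + a) * exp (- a) \<le> 1\<close>.\<close>
  have "(\<Sum>p = 1..N. exp (- (a * real p))) \<le> (1 - exp (- (a * real N))) / a"
  proof (induction N)
    case (Suc N)
    define u where "u = exp (- (a * real N))"
    have eq: "exp (- (a * real (Suc N))) = u * exp (- a)"
      by (simp add: u_def algebra_simps exp_diff exp_minus divide_simps)
    have "(1 + a) * exp (- a) \<le> exp a * exp (- a)"
      using exp_ge_add_one_self[of a] by (intro mult_right_mono) auto
    then have "u * ((1 + a) * exp (- a)) \<le> u * 1"
      by (intro mult_left_mono) (auto simp: u_def exp_minus)
    then have "(1 - u) + a * (u * exp (- a)) \<le> 1 - u * exp (- a)"
      by (simp add: algebra_simps)
    then have "((1 - u) + a * (u * exp (- a))) / a \<le> (1 - u * exp (- a)) / a"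
      using assms by (intro divide_right_mono) auto
    then have "(1 - u) / a + u * exp (- a) \<le> (1 - u * exp (- a)) / a"
      using assms by (simp add: add_divide_distrib)
    have "(\<Sum>p = 1..Suc N. exp (- (a * real p))) = (\<Sum>p = 1..N. exp (- (a * real p))) + u * exp (- a)"
      using eq by simp
    with Suc show ?case unfolding eq u_def[symmetric]
      using \<open>(1 - u) / a + u * exp (- a) \<le> (1 - u * exp (- a)) / a\<close> by linarith
  qed simp
  also have "\<dots> \<le> 1 / a" using assms by (intro divide_right_mono) auto
  finally show ?thesis .
qed

lemma sum_exp_le0:
  assumes "0 < a"
  shows "(\<Sum>p = 1..N. exp (- (a * (real p - 1)))) \<le> 1 + 1 / a"
proof (cases N)
  case (Suc M)
  have "(\<Sum>p = 1..Suc M. exp (- (a * (real p - 1)))) = 1 + (\<Sum>p = 1..M. exp (- (a * real p)))"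
    by (induction M) auto
  then show ?thesis using sum_exp_le[OF assms, of M] Suc by simp
qed (use assms in auto)

text \<open>The mean value theorem on each unit interval replaces an increment of \<open>G\<close>
  by one value of \<open>f\<close>. At 0 only continuity is available for \<open>dilog_exp\<close>,
  which is differentiated through a series convergent for \<open>exp (- y) < 1\<close>.\<close>

lemma sum_antiderivative_le:
  fixes G f :: "real \<Rightarrow> real" and B :: "nat \<Rightarrow> real"
  assumes "continuous_on {0..} G"
    and "\<And>x. 0 < x \<Longrightarrow> (G has_field_derivative f x) (at x)"
    and "\<And>p x. 1 \<le> p \<Longrightarrow> real p - 1 < x \<Longrightarrow> x < real p \<Longrightarrow> \<bar>f x - f (real p)\<bar> \<le> B p"
  shows "\<bar>G (real N) - G 0 - (\<Sum>p = 1..N. f (real p))\<bar> \<le> (\<Sum>p = 1..N. B p)"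
proof (induction N)
  case (Suc N)
  obtain l z where z: "real N < z" "z < real (Suc N)" "(G has_real_derivative l) (at z)"
    "G (real (Suc N)) - G (real N) = (real (Suc N) - real N) * l"
  proof (rule exE[OF MVT[of "real N" "real (Suc N)" G]])
    show "continuous_on {real N..real (Suc N)} G"
      using assms(1) by (rule continuous_on_subset) auto
    show "G differentiable at x" if "real N < x" for x
      using assms(2)[of x] that real_differentiable_def by (smt (verit) of_nat_0_le_iff)
  qed auto
  have "l = f z" using z assms(2)[of z] DERIV_unique by (metis le_less_trans of_nat_0_le_iff)
  then have "\<bar>G (real (Suc N)) - G (real N) - f (real (Suc N))\<bar> \<le> B (Suc N)"
    using z assms(3)[of "Suc N" z] by simp
  then show ?case using Suc by simp
qed simp

text \<open>Second-order companion of \<open>sum_antiderivative_le\<close>. For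
  \<open>ln (Zt A t)\<close> an error of constant size would spoil the leading constant of the
  theorem; the boundary correction at 0 is what produces a factor
  \<open>2 powr (- 1 / 2)\<close>.\<close>

lemma trapezoid_le:
  fixes G f f' :: "real \<Rightarrow> real" and B :: "nat \<Rightarrow> real"
  assumes "continuous_on {0..} G"
    and "\<And>x. 0 < x \<Longrightarrow> (G has_field_derivative f x) (at x)"
    and "\<And>x. 0 \<le> x \<Longrightarrow> (f has_field_derivative f' x) (at x)"
    and "\<And>p x y. 1 \<le> p \<Longrightarrow> x \<in> {real p - 1..real p} \<Longrightarrow> y \<in> {real p - 1..real p} \<Longrightarrow> \<bar>f' x - f' y\<bar> \<le> B p"
  shows "\<bar>G (real N) - G 0 - (\<Sum>p = 1..N. f (real p)) + (f (real N) - f 0) / 2\<bar> \<le> (\<Sum>p = 1..N. B p)"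
proof (induction N)
  case (Suc N)
  define a where "a = real N"
  \<comment> \<open>\<open>h\<close> is the trapezoid defect over the interval from \<open>a\<close>
    to \<open>x\<close>. A second use of the mean value theorem turns its derivative into
    \<open>(x - a) / 2\<close> times a difference of two values of \<open>f'\<close>.\<close>
  define h where "h = (\<lambda>x. G x - G a - (x - a) * (f x + f a) / 2)"
  have h': "(h has_field_derivative ((f x - f a) / 2 - (x - a) * f' x / 2)) (at x)" if "a < x" for x
    using that assms(2)[of x] assms(3)[of x] unfolding h_def a_def
    by (auto intro!: derivative_eq_intros simp: field_simps)
  have cf: "continuous_on {0..} f"
    using assms(3) by (meson DERIV_isCont atLeast_iff continuous_at_imp_continuous_on)
  obtain l z where z: "a < z" "z < a + 1" "(h has_real_derivative l) (at z)"
    "h (a + 1) - h a = (a + 1 - a) * l"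
  proof (rule exE[OF MVT[of a "a + 1" h]])
    have "continuous_on {0..} h"
      unfolding h_def by (intro continuous_intros assms(1) cf) auto
    then show "continuous_on {a..a + 1} h" by (rule continuous_on_subset) (auto simp: a_def)
    show "h differentiable at x" if "a < x" for x
      using h'[OF that] real_differentiable_def by blast
  qed auto
  obtain y where y: "a < y" "y < z" "f z - f a = (z - a) * f' y"
    using MVT2[of a z f f'] z(1) assms(3) by (auto simp: a_def)
  have "l = (f z - f a) / 2 - (z - a) * f' z / 2" using z(3) h'[OF z(1)] DERIV_unique by blast
  also have "\<dots> = (z - a) / 2 * (f' y - f' z)" using y(3) by (simp add: algebra_simps diff_divide_distrib)
  finally have "\<bar>l\<bar> = \<bar>(z - a) / 2 * (f' y - f' z)\<bar>" by simp
  also have "\<dots> = (z - a) / 2 * \<bar>f' y - f' z\<bar>" using z(1) by (simp only: abs_mult) simp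
  also have "\<dots> \<le> 1 * B (Suc N)"
    using z y assms(4)[of "Suc N" y z] by (intro mult_mono) (auto simp: a_def)
  finally have "\<bar>h (a + 1) - h a\<bar> \<le> B (Suc N)" using z(4) by simp
  then have "\<bar>G (a + 1) - G a - (f (a + 1) + f a) / 2\<bar> \<le> B (Suc N)" by (simp add: h_def)
  moreover have "G (real (Suc N)) - G 0 - (\<Sum>p = 1..Suc N. f (real p)) + (f (real (Suc N)) - f 0) / 2
    = (G (real N) - G 0 - (\<Sum>p = 1..N. f (real p)) + (f (real N) - f 0) / 2)
      + (G (a + 1) - G a - (f (a + 1) + f a) / 2)"
    by (simp add: a_def add.commute diff_divide_distrib add_divide_distrib)
  moreover have "sum B {1..Suc N} = sum B {1..N} + B (Suc N)" by simp
  ultimately show ?case using Suc by linarith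
qed simp

section \<open>Cumulants on the real axis and exponential bounds\<close>

definition rmu :: "real \<Rightarrow> real" where "rmu y = exp (- y) / (1 + exp (- y))"
definition rnu :: "real \<Rightarrow> real" where "rnu y = exp (- y) / (1 + exp (- y))\<^sup>2"
definition rka :: "real \<Rightarrow> real" where "rka y = exp (- y) * (1 - exp (- y)) / (1 + exp (- y)) ^ 3"

lemma one_plus_exp_pos [simp]: "0 < 1 + exp (x :: real)" "1 + exp (x :: real) \<noteq> 0"
  using exp_gt_zero[of x] by linarith+

lemma of_real_mu: "mu (of_real y) = of_real (rmu y)"
  unfolding mu_def rmu_def of_real_minus[symmetric] exp_of_real by simp

lemma of_real_nu: "nu (of_real y) = of_real (rnu y)"
  unfolding nu_def rnu_def of_real_minus[symmetric] exp_of_real by simp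

lemma DERIV_ln_one_plus_exp:
  "((\<lambda>y. ln (1 + exp (- y))) has_field_derivative - rmu y) (at y)"
  by (auto intro!: derivative_eq_intros simp: rmu_def)

lemma DERIV_rmu: "(rmu has_field_derivative - rnu y) (at y)"
  unfolding rmu_def[abs_def]
  by (auto intro!: derivative_eq_intros simp: rnu_def power2_eq_square field_simps)

lemma DERIV_rnu: "(rnu has_field_derivative - rka y) (at y)"
proof -
  define z where "z = exp (- y)"
  have nz: "1 + z \<noteq> 0" by (simp add: z_def)
  have "(rnu has_field_derivative
      ((- z) * (1 + z)\<^sup>2 - z * (2 * (1 + z) * (- z))) / ((1 + z)\<^sup>2 * (1 + z)\<^sup>2)) (at y)"
    unfolding rnu_def[abs_def] using nz
    by (auto intro!: derivative_eq_intros simp: z_def power2_eq_square)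
  moreover have "((- z) * (1 + z)\<^sup>2 - z * (2 * (1 + z) * (- z))) / ((1 + z)\<^sup>2 * (1 + z)\<^sup>2)
      = - (z * (1 - z) / (1 + z) ^ 3)"
  proof -
    have "((- z) * (1 + z)\<^sup>2 - z * (2 * (1 + z) * (- z))) = (1 + z) * (- (z * (1 - z)))"
      by (simp add: algebra_simps power2_eq_square)
    moreover have "(1 + z)\<^sup>2 * (1 + z)\<^sup>2 = (1 + z) * (1 + z) ^ 3"
      by (simp add: power2_eq_square power3_eq_cube)
    ultimately show ?thesis using nz by (metis minus_divide_left mult_divide_mult_cancel_left)
  qed
  ultimately show ?thesis by (simp add: rka_def z_def)
qed

lemma rmu_bounds: "0 \<le> rmu y" "rmu y \<le> exp (- y)"
  and rnu_bounds: "0 \<le> rnu y" "rnu y \<le> exp (- y)"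
proof -
  have "exp (- y) / (1 + exp (- y)) \<le> exp (- y) / 1" by (intro divide_left_mono) auto
  then show "0 \<le> rmu y" "rmu y \<le> exp (- y)"
    using less_imp_le[OF one_plus_exp_pos(1)] by (auto simp: rmu_def)
  have "exp (- y) / (1 + exp (- y))\<^sup>2 \<le> exp (- y) / 1"
    by (intro divide_left_mono one_le_power) auto
  then show "0 \<le> rnu y" "rnu y \<le> exp (- y)" by (auto simp: rnu_def)
qed

lemma abs_rka_le:
  assumes "0 \<le> y"
  shows "\<bar>rka y\<bar> \<le> exp (- y)"
proof -
  have "0 \<le> exp (- y) * (1 - exp (- y))" "exp (- y) * (1 - exp (- y)) \<le> exp (- y)"
    using assms by (auto simp: algebra_simps)
  then have "\<bar>rka y\<bar> \<le> exp (- y) / 1"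
    unfolding rka_def abs_divide by (intro frac_le) (auto simp: power_abs intro!: one_le_power)
  then show ?thesis by simp
qed

lemma power_le_fact_exp:
  fixes x :: real assumes "0 \<le> x"
  shows "x ^ k \<le> fact k * exp x"
proof -
  have "(\<Sum>n\<in>{k}. x ^ n /\<^sub>R fact n) \<le> (\<Sum>n. x ^ n /\<^sub>R fact n)"
    by (rule sum_le_suminf[OF summable_exp_generic]) (use assms in auto)
  then have "x ^ k / fact k \<le> exp x" by (simp add: exp_def divide_inverse mult.commute)
  then show ?thesis by (simp add: divide_le_eq mult.commute)
qed

lemma power_exp_le:
  fixes y :: real assumes "0 \<le> y"
  shows "y * exp (- y) \<le> 2 * exp (- y / 2)" "y\<^sup>2 * exp (- y) \<le> 8 * exp (- y / 2)"
    "y ^ 3 * exp (- y) \<le> 48 * exp (- y / 2)"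
proof -
  have "y ^ k * exp (- y) \<le> (2 ^ k * fact k) * exp (- y / 2)" for k
  proof -
    have "y ^ k \<le> (2 ^ k * fact k) * exp (y / 2)"
      using power_le_fact_exp[of "y / 2" k] assms by (simp add: field_simps power_divide)
    then have "y ^ k * exp (- y) \<le> (2 ^ k * fact k) * exp (y / 2) * exp (- y)"
      by (intro mult_right_mono) auto
    also have "\<dots> = (2 ^ k * fact k) * exp (- y / 2)" by (simp add: mult.assoc flip: exp_add)
    finally show ?thesis .
  qed
  from this[of 1] this[of 2] this[of 3]
  show "y * exp (- y) \<le> 2 * exp (- y / 2)" "y\<^sup>2 * exp (- y) \<le> 8 * exp (- y / 2)"
    "y ^ 3 * exp (- y) \<le> 48 * exp (- y / 2)" by (simp_all add: eval_nat_numeral)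
qed

lemma exp_neg_le:
  fixes x :: real assumes "0 < x" shows "exp (- x) \<le> fact k / x ^ k"
  using power_le_fact_exp[of x k] assms by (simp add: exp_minus field_simps)

text \<open>Because \<open>N\<close> has at least the order of \<open>1 / t\<^sup>2\<close>, the
  product \<open>t * N\<close> is at least \<open>1 / (2 * t)\<close>. Exponentials at the cut-off
  are therefore smaller than every power of \<open>t\<close>.\<close>

lemma tail_le:
  assumes t: "0 < t" and N: "1 / 2 \<le> real N * t\<^sup>2"
  shows "exp (- (t * real N)) \<le> (2 * t) ^ k * fact k"
    and "exp (- (t * real N) / 2) \<le> (4 * t) ^ k * fact k"
proof -
  have *: "1 / (2 * t) \<le> t * real N" using N t by (simp add: field_simps power2_eq_square)
  have "exp (- (t * real N)) \<le> exp (- (1 / (2 * t)))" using * by simp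
  also have "\<dots> \<le> fact k / (1 / (2 * t)) ^ k" using t by (intro exp_neg_le) auto
  finally show "exp (- (t * real N)) \<le> (2 * t) ^ k * fact k" by (simp add: power_one_over field_simps)
  have "exp (- (t * real N) / 2) \<le> exp (- (1 / (4 * t)))" using * by simp
  also have "\<dots> \<le> fact k / (1 / (4 * t)) ^ k" using t by (intro exp_neg_le) auto
  finally show "exp (- (t * real N) / 2) \<le> (4 * t) ^ k * fact k" by (simp add: power_one_over field_simps)
qed

lemma abs_le_divideI:
  fixes B :: real
  assumes "\<bar>a\<bar> \<le> c" "a = s * B" "0 < s"
  shows "\<bar>B\<bar> \<le> c / s"
  using assms by (simp add: abs_mult pos_le_divide_eq mult.commute)

text \<open>\<open>H\<close> is an antiderivative vanishing at infinity, so \<open>- H 0\<close> is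
  the integral of \<open>F\<close> over the half-line, and the substitution \<open>y = t * x\<close>
  gives the \<open>1 / t\<close>. The bound is uniform in \<open>t\<close>: 36 from the Riemann sum,
  96 from the cut-off at \<open>N\<close>, and 12 for each of the \<open>K\<close> missing
  terms.\<close>

lemma riemann_sum_le:
  fixes F F' H :: "real \<Rightarrow> real"
  assumes F: "\<And>y. 0 \<le> y \<Longrightarrow> (F has_field_derivative F' y) (at y)"
    and F': "\<And>y. 0 \<le> y \<Longrightarrow> \<bar>F' y\<bar> \<le> 12 * exp (- y / 2)"
    and F_bd: "\<And>y. 0 \<le> y \<Longrightarrow> \<bar>F y\<bar> \<le> 12"
    and contH: "continuous_on {0..} H"
    and H: "\<And>y. 0 < y \<Longrightarrow> (H has_field_derivative F y) (at y)"
    and H_bd: "\<And>y. 0 \<le> y \<Longrightarrow> \<bar>H y\<bar> \<le> 24 * exp (- y / 2)"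
    and t: "0 < t" "t \<le> 1" and N: "1 / 2 \<le> real N * t\<^sup>2" and KN: "K \<le> N"
  shows "\<bar>(\<Sum>p\<in>{K<..N}. F (t * real p)) + H 0 / t\<bar> \<le> 132 + 12 * real K"
proof -
  define f where "f = (\<lambda>x. F (t * x))"
  define G where "G = (\<lambda>x. H (t * x) / t)"
  define B where "B = (\<lambda>p. 12 * t * exp (- (t / 2 * (real p - 1))))"
  have "\<bar>G (real N) - G 0 - (\<Sum>p = 1..N. f (real p))\<bar> \<le> (\<Sum>p = 1..N. B p)"
  proof (rule sum_antiderivative_le)
    show "continuous_on {0..} G" unfolding G_def
      by (intro continuous_intros continuous_on_compose2[OF contH]) (use t in auto)
    show "(G has_field_derivative f x) (at x)" if "0 < x" for x
    proof -
      have "((\<lambda>x. H (t * x)) has_field_derivative F (t * x) * t) (at x)"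
        by (rule DERIV_chain2[where f = H]) (use that t H in \<open>auto intro!: derivative_eq_intros\<close>)
      from DERIV_cdivide[OF this, of t] show ?thesis using t by (simp add: G_def f_def)
    qed
    fix p :: nat and x assume p: "1 \<le> p" "real p - 1 < x" "x < real p"
    define y0 where "y0 = t * (real p - 1)"
    have y0: "0 \<le> y0" "y0 \<le> t * x" "y0 \<le> t * real p" using p t by (auto simp: y0_def)
    have "norm (F (t * x) - F (t * real p)) \<le> 12 * exp (- y0 / 2) * norm (t * x - t * real p)"
    proof (rule field_differentiable_bound[where S = "{y0..}" and f' = F'])
      fix z assume z: "z \<in> {y0..}"
      then show "(F has_field_derivative F' z) (at z within {y0..})"
        using F[of z] y0 has_field_derivative_at_within by force
      have "exp (- z / 2) \<le> exp (- y0 / 2)" using z by simp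
      then have "12 * exp (- z / 2) \<le> 12 * exp (- y0 / 2)" by (rule mult_left_mono) simp
      moreover have "\<bar>F' z\<bar> \<le> 12 * exp (- z / 2)" using F'[of z] z y0 by auto
      ultimately show "norm (F' z) \<le> 12 * exp (- y0 / 2)" unfolding real_norm_def by linarith
    qed (use y0 in auto)
    also have "norm (t * x - t * real p) = t * (real p - x)"
      using p t by (simp add: abs_mult flip: right_diff_distrib)
    also have "12 * exp (- y0 / 2) * (t * (real p - x)) \<le> 12 * exp (- y0 / 2) * (t * 1)"
      using p t by (intro mult_left_mono) auto
    finally show "\<bar>f x - f (real p)\<bar> \<le> B p"
      by (simp add: f_def B_def y0_def mult_ac)
  qed
  also have "(\<Sum>p = 1..N. B p) = 12 * t * (\<Sum>p = 1..N. exp (- (t / 2 * (real p - 1))))"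
    by (simp add: B_def sum_distrib_left)
  also have "\<dots> \<le> 12 * t * (1 + 1 / (t / 2))"
    using t by (intro mult_left_mono sum_exp_le0) auto
  also have "\<dots> \<le> 36" using t by (simp add: field_simps)
  finally have 1: "\<bar>G (real N) - G 0 - (\<Sum>p = 1..N. f (real p))\<bar> \<le> 36" .
  have "\<bar>G (real N)\<bar> = \<bar>H (t * real N)\<bar> / t" using t by (simp add: G_def)
  also have "\<dots> \<le> 24 * exp (- (t * real N) / 2) / t"
    using H_bd[of "t * real N"] t by (intro divide_right_mono) auto
  also have "\<dots> \<le> 24 * ((4 * t) ^ 1 * fact 1) / t"
    using tail_le(2)[OF t(1) N, of 1] t by (intro divide_right_mono mult_left_mono) auto
  also have "\<dots> = 96" using t by simp
  finally have 2: "\<bar>G (real N)\<bar> \<le> 96" .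
  have "{1..N} = {1..K} \<union> {K<..N}" "{1..K} \<inter> {K<..N} = {}" using KN by auto
  then have "(\<Sum>p = 1..N. f (real p)) = (\<Sum>p = 1..K. f (real p)) + (\<Sum>p\<in>{K<..N}. f (real p))"
    by (metis finite_atLeastAtMost finite_greaterThanAtMost sum.union_disjoint)
  moreover have "\<bar>\<Sum>p = 1..K. f (real p)\<bar> \<le> (\<Sum>p = 1..K. 12)"
    by (rule order_trans[OF sum_abs], rule sum_mono) (use F_bd t in \<open>auto simp: f_def\<close>)
  moreover have "G 0 = H 0 / t" by (simp add: G_def)
  ultimately show ?thesis using 1 2 by (simp add: f_def)
qed

section \<open>The sums for the two variances, the mean and the logarithm\<close>

lemma ln_one_plus_exp_bounds: "0 \<le> ln (1 + exp (- y))" "ln (1 + exp (- y)) \<le> exp (- y :: real)"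
  using ln_add_one_self_le_self[of "exp (- y)"] by (auto intro!: ln_ge_zero)

text \<open>Variance of the excess of odd over even parts; the antiderivative \<open>- rmu\<close>
  has the value -1/2 at 0.\<close>

lemma sum_rnu:
  assumes t: "0 < t" "t \<le> 1" and N: "1 / 2 \<le> real N * t\<^sup>2" and KN: "K \<le> N"
  shows "\<bar>(\<Sum>p\<in>{K<..N}. rnu (t * real p)) - 1 / (2 * t)\<bar> \<le> 132 + 12 * real K"
proof -
  have e: "exp (- y) \<le> exp (- y / 2)" "exp (- y) \<le> 1" if "0 \<le> y" for y :: real using that by auto
  have "\<bar>(\<Sum>p\<in>{K<..N}. rnu (t * real p)) + (- rmu 0) / t\<bar> \<le> 132 + 12 * real K"
  proof (rule riemann_sum_le[where H = "\<lambda>y. - rmu y", OF _ _ _ _ _ _ t N KN])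
    show "(rnu has_field_derivative - rka y) (at y)" for y by (rule DERIV_rnu)
    show "\<bar>- rka y\<bar> \<le> 12 * exp (- y / 2)" if "0 \<le> y" for y
      using abs_rka_le[OF that] e(1)[OF that] exp_gt_zero[of "- y / 2"] by linarith
    show "\<bar>rnu y\<bar> \<le> 12" if "0 \<le> y" for y
      using rnu_bounds[of y] e[OF that] by linarith
    show "\<bar>- rmu y\<bar> \<le> 24 * exp (- y / 2)" if "0 \<le> y" for y
      using rmu_bounds[of y] e[OF that] exp_gt_zero[of "- y / 2"] by linarith
    show "((\<lambda>y. - rmu y) has_field_derivative rnu y) (at y)" for y
      using DERIV_minus[OF DERIV_rmu[of y]] by simp
    then show "continuous_on {0..} (\<lambda>y. - rmu y)"
      using DERIV_isCont continuous_at_imp_continuous_on by blast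
  qed
  then show ?thesis by (simp add: rmu_def)
qed

text \<open>Expected sum of the parts. Integration by parts leads from \<open>y * rmu y\<close>
  through \<open>y * ln (1 + exp (- y))\<close> to \<open>dilog_exp\<close>, whose value at 0 is
  \<open>pi\<^sup>2 / 12\<close>.\<close>

lemma sum_rmu:
  assumes t: "0 < t" "t \<le> 1" and N: "1 / 2 \<le> real N * t\<^sup>2" and KN: "K \<le> N"
  shows "\<bar>(\<Sum>p\<in>{K<..N}. real p * rmu (t * real p)) - pi\<^sup>2 / (12 * t\<^sup>2)\<bar> \<le> (132 + 12 * real K) / t"
proof -
  have e: "exp (- y) \<le> exp (- y / 2)" "exp (- y) \<le> 1" "exp (- y / 2) \<le> 1" if "0 \<le> y" for y :: real
    using that by auto
  define H where "H = (\<lambda>y. - (y * ln (1 + exp (- y))) - dilog_exp y)"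
  have "\<bar>(\<Sum>p\<in>{K<..N}. (t * real p) * rmu (t * real p)) + H 0 / t\<bar> \<le> 132 + 12 * real K"
  proof (rule riemann_sum_le[where F = "\<lambda>y. y * rmu y", OF _ _ _ _ _ _ t N KN])
    show "((\<lambda>y. y * rmu y) has_field_derivative rmu y - y * rnu y) (at y)" for y
      using DERIV_rmu[of y] by (auto intro!: derivative_eq_intros)
    fix y :: real assume y: "0 \<le> y"
    have y1: "\<bar>y * rnu y\<bar> \<le> 2 * exp (- y / 2)" "\<bar>y * rmu y\<bar> \<le> 2 * exp (- y / 2)"
      "\<bar>y * ln (1 + exp (- y))\<bar> \<le> 2 * exp (- y / 2)"
      using rnu_bounds[of y] rmu_bounds[of y] power_exp_le(1)[OF y] y ln_one_plus_exp_bounds[of y]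
        mult_left_mono[of "rnu y" "exp (- y)" y] mult_left_mono[of "rmu y" "exp (- y)" y]
        mult_left_mono[of "ln (1 + exp (- y))" "exp (- y)" y] by (auto simp: abs_mult)
    show "\<bar>rmu y - y * rnu y\<bar> \<le> 12 * exp (- y / 2)"
      using y1 rmu_bounds[of y] e[OF y] exp_gt_zero[of "- y / 2"] by linarith
    show "\<bar>y * rmu y\<bar> \<le> 12" using y1 e[OF y] by linarith
    show "\<bar>H y\<bar> \<le> 24 * exp (- y / 2)"
      using y1 abs_dilog_exp_le[OF y] e[OF y] exp_gt_zero[of "- y / 2"] unfolding H_def by linarith
  next
    show "continuous_on {0..} H" unfolding H_def
      by (intro continuous_intros continuous_on_dilog_exp) auto
    show "(H has_field_derivative y * rmu y) (at y)" if "0 < y" for y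
      unfolding H_def using DERIV_dilog_exp[OF that]
      by (auto intro!: derivative_eq_intros DERIV_ln_one_plus_exp simp: rmu_def divide_inverse)
  qed
  then show ?thesis
  proof (rule abs_le_divideI)
    show "(\<Sum>p\<in>{K<..N}. (t * real p) * rmu (t * real p)) + H 0 / t
      = t * ((\<Sum>p\<in>{K<..N}. real p * rmu (t * real p)) - pi\<^sup>2 / (12 * t\<^sup>2))"
      using t by (simp add: H_def dilog_exp_0 sum_distrib_left power2_eq_square field_simps)
  qed (fact t)
qed

text \<open>Variance of the sum of the parts. One more integration by parts reduces it to twice the
  integral for the mean.\<close>

lemma sum_square_rnu:
  assumes t: "0 < t" "t \<le> 1" and N: "1 / 2 \<le> real N * t\<^sup>2" and KN: "K \<le> N"
  shows "\<bar>(\<Sum>p\<in>{K<..N}. (real p)\<^sup>2 * rnu (t * real p)) - pi\<^sup>2 / (6 * t ^ 3)\<bar> \<le> (132 + 12 * real K) / t\<^sup>2"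
proof -
  have e: "exp (- y) \<le> exp (- y / 2)" "exp (- y) \<le> 1" "exp (- y / 2) \<le> 1" if "0 \<le> y" for y :: real
    using that by auto
  define H where "H = (\<lambda>y. - (y\<^sup>2 * rmu y) - 2 * (y * ln (1 + exp (- y))) - 2 * dilog_exp y)"
  have "\<bar>(\<Sum>p\<in>{K<..N}. (t * real p)\<^sup>2 * rnu (t * real p)) + H 0 / t\<bar> \<le> 132 + 12 * real K"
  proof (rule riemann_sum_le[where F = "\<lambda>y. y\<^sup>2 * rnu y", OF _ _ _ _ _ _ t N KN])
    show "((\<lambda>y. y\<^sup>2 * rnu y) has_field_derivative 2 * (y * rnu y) - y\<^sup>2 * rka y) (at y)" for y
      using DERIV_rnu[of y] by (auto intro!: derivative_eq_intros)
    fix y :: real assume y: "0 \<le> y"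
    have y1: "\<bar>y * rnu y\<bar> \<le> 2 * exp (- y / 2)" 
      "\<bar>y * ln (1 + exp (- y))\<bar> \<le> 2 * exp (- y / 2)"
      using rnu_bounds[of y] power_exp_le(1)[OF y] y ln_one_plus_exp_bounds[of y]
        mult_left_mono[of "rnu y" "exp (- y)" y]
        mult_left_mono[of "ln (1 + exp (- y))" "exp (- y)" y] by (auto simp: abs_mult)
    have y2: "\<bar>y\<^sup>2 * rmu y\<bar> \<le> 8 * exp (- y / 2)" "\<bar>y\<^sup>2 * rnu y\<bar> \<le> 8 * exp (- y / 2)"
      "\<bar>y\<^sup>2 * rka y\<bar> \<le> 8 * exp (- y / 2)"
      using rnu_bounds[of y] rmu_bounds[of y] power_exp_le(2)[OF y] y abs_rka_le[OF y]
        mult_left_mono[of "rnu y" "exp (- y)" "y\<^sup>2"] mult_left_mono[of "rmu y" "exp (- y)" "y\<^sup>2"]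
        mult_left_mono[of "\<bar>rka y\<bar>" "exp (- y)" "y\<^sup>2"] by (auto simp: abs_mult)
    show "\<bar>2 * (y * rnu y) - y\<^sup>2 * rka y\<bar> \<le> 12 * exp (- y / 2)"
      using y1 y2 by linarith
    show "\<bar>y\<^sup>2 * rnu y\<bar> \<le> 12" using y2 e[OF y] by linarith
    show "\<bar>H y\<bar> \<le> 24 * exp (- y / 2)"
      using y1 y2 abs_dilog_exp_le[OF y] e[OF y] exp_gt_zero[of "- y / 2"] unfolding H_def by linarith
  next
    have "continuous_on {0..} rmu"
      using DERIV_isCont[OF DERIV_rmu] continuous_at_imp_continuous_on by blast
    then show "continuous_on {0..} H" unfolding H_def
      by (intro continuous_intros continuous_on_dilog_exp) auto
    show "(H has_field_derivative y\<^sup>2 * rnu y) (at y)" if "0 < y" for y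
      unfolding H_def
      by (rule DERIV_cong, (rule derivative_intros DERIV_dilog_exp[OF that] DERIV_ln_one_plus_exp DERIV_rmu)+) (simp add: algebra_simps)
  qed
  then show ?thesis
  proof (rule abs_le_divideI)
    show "(\<Sum>p\<in>{K<..N}. (t * real p)\<^sup>2 * rnu (t * real p)) + H 0 / t
      = t\<^sup>2 * ((\<Sum>p\<in>{K<..N}. (real p)\<^sup>2 * rnu (t * real p)) - pi\<^sup>2 / (6 * t ^ 3))"
      using t by (simp add: H_def dilog_exp_0 sum_distrib_left power2_eq_square power3_eq_cube field_simps)
  qed (use t in auto)
qed

text \<open>Each deleted part \<open>p \<le> K\<close> removes a factor close to 2 from the product,
  and the trapezoid correction at 0 removes another \<open>sqrt 2\<close>; together they make up
  \<open>(K + 1 / 2) * ln 2\<close>. The error has to vanish with \<open>t\<close>, since this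
  quantity is exponentiated later.\<close>

lemma sum_ln_one_plus_exp:
  assumes t: "0 < t" "t \<le> 1" and N: "1 / 2 \<le> real N * t\<^sup>2" and KN: "K \<le> N"
  shows "\<bar>(\<Sum>p\<in>{K<..N}. ln (1 + exp (- (t * real p)))) - (pi\<^sup>2 / (12 * t) - (real K + 1 / 2) * ln 2)\<bar>
    \<le> (200 + real K ^ 2) * t"
proof -
  define f where "f = (\<lambda>x. ln (1 + exp (- (t * x))))"
  define G where "G = (\<lambda>x. - dilog_exp (t * x) / t)"
  define B where "B = (\<lambda>p. t\<^sup>2 * exp (- (t * (real p - 1))))"
  have Df: "(f has_field_derivative - t * rmu (t * x)) (at x)" for x
    using DERIV_chain2[OF DERIV_ln_one_plus_exp DERIV_cmult_Id, of t x]
    by (simp add: f_def mult.commute)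
  have "\<bar>G (real N) - G 0 - (\<Sum>p = 1..N. f (real p)) + (f (real N) - f 0) / 2\<bar> \<le> (\<Sum>p = 1..N. B p)"
  proof (rule trapezoid_le)
    show "continuous_on {0..} G" unfolding G_def
      by (intro continuous_intros continuous_on_compose2[OF continuous_on_dilog_exp]) (use t in auto)
    show "(G has_field_derivative f x) (at x)" if "0 < x" for x
    proof -
      have "((\<lambda>x. dilog_exp (t * x)) has_field_derivative - ln (1 + exp (- (t * x))) * t) (at x)"
        by (rule DERIV_chain2[where f = dilog_exp])
          (use that t DERIV_dilog_exp in \<open>auto intro!: derivative_eq_intros\<close>)
      from DERIV_cdivide[OF DERIV_minus[OF this], of t] show ?thesis using t by (simp add: G_def f_def)
    qed
    show "(f has_field_derivative - t * rmu (t * x)) (at x)" for x by (rule Df)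
    fix p :: nat and x y assume p: "1 \<le> p" "x \<in> {real p - 1..real p}" "y \<in> {real p - 1..real p}"
    define y0 where "y0 = t * (real p - 1)"
    have y0: "0 \<le> y0" "y0 \<le> t * x" "y0 \<le> t * y" using p t by (auto simp: y0_def)
    have "norm (rmu (t * x) - rmu (t * y)) \<le> exp (- y0) * norm (t * x - t * y)"
    proof (rule field_differentiable_bound[where S = "{y0..}" and f' = "\<lambda>y. - rnu y"])
      fix z assume z: "z \<in> {y0..}"
      then show "(rmu has_field_derivative - rnu z) (at z within {y0..})"
        using DERIV_rmu has_field_derivative_at_within by blast
      have "exp (- z) \<le> exp (- y0)" using z by simp
      then show "norm (- rnu z) \<le> exp (- y0)" using rnu_bounds[of z] unfolding norm_minus_cancel real_norm_def by linarith
    qed (use y0 in auto)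
    also have "norm (t * x - t * y) \<le> t"
    proof -
      have "norm (t * x - t * y) = t * \<bar>x - y\<bar>" using t by (simp add: abs_mult flip: right_diff_distrib)
      also have "\<dots> \<le> t * 1" using p t by (intro mult_left_mono) auto
      finally show ?thesis by simp
    qed
    finally have "\<bar>rmu (t * x) - rmu (t * y)\<bar> \<le> exp (- y0) * t" by simp
    then have "t * \<bar>rmu (t * x) - rmu (t * y)\<bar> \<le> t * (exp (- y0) * t)" using t by (intro mult_left_mono) auto
    moreover have "\<bar>- t * rmu (t * x) - - t * rmu (t * y)\<bar> = t * \<bar>rmu (t * x) - rmu (t * y)\<bar>"
      using t by (simp add: abs_mult abs_minus_commute flip: right_diff_distrib)
    ultimately show "\<bar>- t * rmu (t * x) - - t * rmu (t * y)\<bar> \<le> B p"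
      by (simp add: B_def y0_def power2_eq_square mult_ac)
  qed
  also have "(\<Sum>p = 1..N. B p) = t\<^sup>2 * (\<Sum>p = 1..N. exp (- (t * (real p - 1))))"
    by (simp add: B_def sum_distrib_left)
  also have "\<dots> \<le> t\<^sup>2 * (1 + 1 / t)" using t by (intro mult_left_mono sum_exp_le0) auto
  also have "\<dots> \<le> 2 * t" using t by (simp add: field_simps power2_eq_square)
  finally have 1: "\<bar>G (real N) - G 0 - (\<Sum>p = 1..N. f (real p)) + (f (real N) - f 0) / 2\<bar> \<le> 2 * t" .
  have "\<bar>G (real N)\<bar> = \<bar>dilog_exp (t * real N)\<bar> / t" using t by (simp add: G_def)
  also have "\<dots> \<le> 3 * exp (- (t * real N)) / t"
    using abs_dilog_exp_le[of "t * real N"] t by (intro divide_right_mono) auto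
  also have "\<dots> \<le> 3 * ((2 * t) ^ 2 * fact 2) / t"
    using tail_le(1)[OF t(1) N, of 2] t by (intro divide_right_mono mult_left_mono) auto
  also have "\<dots> = 24 * t" using t by (simp add: power2_eq_square)
  finally have 2: "\<bar>G (real N)\<bar> \<le> 24 * t" .
  have 3: "0 \<le> f (real N)" "f (real N) \<le> 2 * t"
    using ln_one_plus_exp_bounds[of "t * real N"] tail_le(1)[OF t(1) N, of 1] by (auto simp: f_def)
  have "{1..N} = {1..K} \<union> {K<..N}" "{1..K} \<inter> {K<..N} = {}" using KN by auto
  then have 4: "(\<Sum>p = 1..N. f (real p)) = (\<Sum>p = 1..K. f (real p)) + (\<Sum>p\<in>{K<..N}. f (real p))"
    by (metis finite_atLeastAtMost finite_greaterThanAtMost sum.union_disjoint)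
  have "\<bar>f (real p) - ln 2\<bar> \<le> t * real p" for p
  proof -
    have "norm (f (real p) - f 0) \<le> t * norm (real p - 0)"
    proof (rule field_differentiable_bound[where S = "{0..}" and f' = "\<lambda>x. - t * rmu (t * x)"])
      fix z :: real assume z: "z \<in> {0..}"
      then have "rmu (t * z) \<le> 1" using rmu_bounds(2)[of "t * z"] t
        by (meson atLeast_iff exp_le_one_iff mult_nonneg_nonneg less_imp_le neg_le_0_iff_le order_trans)
      then show "norm (- t * rmu (t * z)) \<le> t"
        using rmu_bounds(1)[of "t * z"] t by (simp add: abs_mult mult_left_le)
    qed (use has_field_derivative_at_within[OF Df] in auto)
    then show ?thesis by (simp add: f_def)
  qed
  then have "\<bar>f (real p) - ln 2\<bar> \<le> t * real K" if "p \<in> {1..K}" for p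
    using that t by (smt (verit) atLeastAtMost_iff mult_left_mono of_nat_mono)
  then have "\<bar>\<Sum>p = 1..K. (f (real p) - ln 2)\<bar> \<le> (\<Sum>p = 1..K. t * real K)"
    by (intro order_trans[OF sum_abs] sum_mono)
  then have 5: "\<bar>(\<Sum>p = 1..K. f (real p)) - real K * ln 2\<bar> \<le> real K ^ 2 * t"
    by (simp add: sum_subtractf power2_eq_square mult_ac)
  obtain g where g: "g = pi\<^sup>2 / (12 * t)" by blast
  have "G 0 = - g" "f 0 = ln 2" by (auto simp: G_def f_def dilog_exp_0 g)
  moreover obtain L where L: "L = real K * ln 2" by blast
  moreover obtain q where q: "q = real K ^ 2 * t" by blast
  moreover have LK: "(real K + 1 / 2) * ln 2 = L + ln 2 / 2" by (simp add: L algebra_simps)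
  ultimately have "\<bar>(\<Sum>p\<in>{K<..N}. f (real p)) - (pi\<^sup>2 / (12 * t) - (real K + 1 / 2) * ln 2)\<bar> \<le> 2 * t + 24 * t + t + real K ^ 2 * t"
    using abs_le_D1[OF 1] abs_le_D2[OF 1] abs_le_D1[OF 2] abs_le_D2[OF 2] 3 4 abs_le_D1[OF 5] abs_le_D2[OF 5]
    unfolding g[symmetric] LK L[symmetric] q[symmetric]
    by (intro abs_leI) argo+
  also have "\<dots> \<le> (200 + real K ^ 2) * t" using t by (simp add: algebra_simps)
  finally show ?thesis by (simp add: f_def)
qed

section \<open>Major arc\<close>

definition parity_sign :: "nat \<Rightarrow> real" where "parity_sign p = (if odd p then 1 else - 1)"

definition wpt :: "real \<Rightarrow> real \<Rightarrow> real \<Rightarrow> nat \<Rightarrow> complex" where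
  "wpt t \<theta> \<alpha> p = Complex (t * real p) (- (\<theta> * real p + parity_sign p * \<alpha>))"

text \<open>A sum of principal logarithms of the factors, not the principal logarithm of the
  product: the arguments may accumulate beyond \<open>pi\<close>, yet the exponential of the sum is
  still \<open>Phi\<close>.\<close>

definition log_Phi :: "nat set \<Rightarrow> real \<Rightarrow> real \<Rightarrow> real \<Rightarrow> complex" where
  "log_Phi A t \<theta> \<alpha> = (\<Sum>p\<in>A. ell (wpt t \<theta> \<alpha> p))"

definition Phi :: "nat set \<Rightarrow> real \<Rightarrow> real \<Rightarrow> real \<Rightarrow> complex" where
  "Phi A t \<theta> \<alpha> = (\<Prod>p\<in>A. 1 + exp (- wpt t \<theta> \<alpha> p))"

text \<open>\<open>Phi\<close> at the origin: the normalizing constant of the independent random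
  parts.\<close>

definition Zt :: "nat set \<Rightarrow> real \<Rightarrow> real" where
  "Zt A t = (\<Prod>p\<in>A. 1 + exp (- (t * real p)))"

lemma Zt_pos: "0 < Zt A t"
  unfolding Zt_def by (intro prod_pos) auto

lemma ln_Zt: "finite A \<Longrightarrow> ln (Zt A t) = (\<Sum>p\<in>A. ln (1 + exp (- (t * real p))))"
  unfolding Zt_def by (intro ln_prod) auto

lemma Complex_in_sector:
  assumes "0 < t" "4 * \<bar>\<theta>\<bar> \<le> t" "4 * \<bar>\<alpha>\<bar> \<le> 1" "x \<le> t * real p" "\<bar>y\<bar> \<le> \<bar>\<theta>\<bar> * real p + \<bar>\<alpha>\<bar>"
  shows "Complex (t * real p) y \<in> sector x"
proof -
  have "4 * \<bar>\<theta>\<bar> * real p \<le> t * real p" using assms by (intro mult_right_mono) auto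
  then have "4 * \<bar>y\<bar> \<le> t * real p + 1" using assms by linarith
  moreover have "0 \<le> t * real p" using assms by simp
  ultimately show ?thesis using assms by (simp add: sector_def)
qed

lemma wpt_in_sector:
  assumes "0 < t" "4 * \<bar>\<theta>\<bar> \<le> t" "4 * \<bar>\<alpha>\<bar> \<le> 1" "x \<le> t * real p"
  shows "wpt t \<theta> \<alpha> p \<in> sector x"
  unfolding wpt_def
proof (rule Complex_in_sector[OF assms])
  have "\<bar>\<theta> * real p + parity_sign p * \<alpha>\<bar> \<le> \<bar>\<theta> * real p\<bar> + \<bar>parity_sign p * \<alpha>\<bar>"
    by (rule abs_triangle_ineq)
  then show "\<bar>- (\<theta> * real p + parity_sign p * \<alpha>)\<bar> \<le> \<bar>\<theta>\<bar> * real p + \<bar>\<alpha>\<bar>"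
    by (simp add: abs_mult parity_sign_def split: if_splits)
qed

lemma Phi_eq_exp:
  assumes "0 < t" "4 * \<bar>\<theta>\<bar> \<le> t" "4 * \<bar>\<alpha>\<bar> \<le> 1"
  shows "Phi A t \<theta> \<alpha> = exp (log_Phi A t \<theta> \<alpha>)"
proof (cases "finite A")
  case True
  have "1 + exp (- wpt t \<theta> \<alpha> p) = exp (ell (wpt t \<theta> \<alpha> p))" for p
    using norm_one_plus_exp_sector(2)[OF wpt_in_sector[OF assms, of 0 p]] assms
    by (simp add: exp_ell)
  then show ?thesis using True by (simp add: Phi_def log_Phi_def exp_sum)
qed (simp add: Phi_def log_Phi_def)

lemma cube_sum_le:
  fixes a b :: real assumes "0 \<le> a" "0 \<le> b" shows "(a + b) ^ 3 \<le> 4 * (a ^ 3 + b ^ 3)"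
proof -
  have "4 * (a ^ 3 + b ^ 3) - (a + b) ^ 3 = 3 * ((a + b) * (a - b)\<^sup>2)"
    by (simp add: power3_eq_cube power2_eq_square algebra_simps)
  moreover have "0 \<le> 3 * ((a + b) * (a - b)\<^sup>2)" using assms by simp
  ultimately show ?thesis by linarith
qed

lemma sum_subset_exp_le:
  assumes "0 < a" shows "(\<Sum>p\<in>{K<..N}. exp (- (a * real p))) \<le> 1 / a"
  by (rule order_trans[OF sum_mono2 sum_exp_le[OF assms]]) auto

text \<open>Averaging over \<alpha> and \<open>- \<alpha>\<close> removes the term linear in
  \<alpha> and the mixed term in \<open>\<theta> * \<alpha>\<close>, so no covariance between sum
  and excess has to be evaluated. The mean and two variances remain;
  \<open>(a + b) ^ 3 \<le> 4 * (a ^ 3 + b ^ 3)\<close> separates the two angles in the cubic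
  remainder.\<close>

lemma log_Phi_even_le:
  fixes K N :: nat
  assumes t: "0 < t" "4 * \<bar>\<theta>\<bar> \<le> t" "4 * \<bar>\<alpha>\<bar> \<le> 1"
  defines "A \<equiv> {K<..N}"
  shows "norm ((log_Phi A t \<theta> \<alpha> + log_Phi A t \<theta> (- \<alpha>)) / 2
    - (of_real (ln (Zt A t)) + \<i> * of_real (\<theta> * (\<Sum>p\<in>A. real p * rmu (t * real p)))
       - of_real ((\<theta>\<^sup>2 * (\<Sum>p\<in>A. (real p)\<^sup>2 * rnu (t * real p)) + \<alpha>\<^sup>2 * (\<Sum>p\<in>A. rnu (t * real p))) / 2)))
    \<le> 32 * (96 * \<bar>\<theta>\<bar> ^ 3 / t ^ 4 + \<bar>\<alpha>\<bar> ^ 3 / t)"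
proof -
  have finA: "finite A" by (simp add: A_def)
  define T where "T = (\<lambda>p. of_real (ln (1 + exp (- (t * real p)))) + \<i> * of_real (\<theta> * (real p * rmu (t * real p)))
    - of_real ((\<theta>\<^sup>2 * ((real p)\<^sup>2 * rnu (t * real p)) + \<alpha>\<^sup>2 * rnu (t * real p)) / 2) :: complex)"
  have one: "norm (ell (wpt t \<theta> \<beta> p) - (of_real (ln (1 + exp (- (t * real p)))) + \<i> * of_real (rmu (t * real p) * (\<theta> * real p + parity_sign p * \<beta>))
      - of_real (rnu (t * real p) * (\<theta> * real p + parity_sign p * \<beta>)\<^sup>2 / 2)))
      \<le> 32 * (\<bar>\<theta>\<bar> ^ 3 * (real p ^ 3 * exp (- (t * real p))) + \<bar>\<alpha>\<bar> ^ 3 * exp (- (t * real p)))"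
    if \<beta>: "\<bar>\<beta>\<bar> = \<bar>\<alpha>\<bar>" for \<beta> p
  proof -
    define b where "b = \<theta> * real p + parity_sign p * \<beta>"
    define x where "x = t * real p"
    have tb: "4 * \<bar>\<beta>\<bar> \<le> 1" using t \<beta> by simp
    have x: "0 \<le> x" "of_real x \<in> sector x" using t by (auto simp: x_def sector_def)
    have zw: "wpt t \<theta> \<beta> p - of_real x = - \<i> * of_real b"
      by (simp add: wpt_def b_def x_def complex_eq_iff)
    have tay: "norm (ell (wpt t \<theta> \<beta> p) - (ell (of_real x) - mu (of_real x) * (wpt t \<theta> \<beta> p - of_real x)
        + nu (of_real x) * (wpt t \<theta> \<beta> p - of_real x)\<^sup>2 / 2))
      \<le> 8 * exp (- x) * norm (wpt t \<theta> \<beta> p - of_real x) ^ 3"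
      by (rule ell_taylor[OF x(2) wpt_in_sector[OF t(1,2) tb] x(1)]) (simp add: x_def)
    have eq: "ell (of_real x) - mu (of_real x) * (wpt t \<theta> \<beta> p - of_real x)
        + nu (of_real x) * (wpt t \<theta> \<beta> p - of_real x)\<^sup>2 / 2
      = of_real (ln (1 + exp (- x))) + \<i> * of_real (rmu x * b) - of_real (rnu x * b\<^sup>2 / 2)"
      unfolding zw of_real_ell of_real_mu of_real_nu by (simp add: power_mult_distrib)
    have "norm (wpt t \<theta> \<beta> p - of_real x) ^ 3 \<le> 4 * ((\<bar>\<theta>\<bar> * real p) ^ 3 + \<bar>\<alpha>\<bar> ^ 3)"
    proof -
      have "\<bar>b\<bar> \<le> \<bar>\<theta> * real p\<bar> + \<bar>parity_sign p * \<beta>\<bar>" unfolding b_def by (rule abs_triangle_ineq)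
      also have "\<dots> = \<bar>\<theta>\<bar> * real p + \<bar>\<alpha>\<bar>" using \<beta> by (simp add: abs_mult parity_sign_def)
      finally have "\<bar>b\<bar> ^ 3 \<le> (\<bar>\<theta>\<bar> * real p + \<bar>\<alpha>\<bar>) ^ 3" by (intro power_mono) auto
      also have "\<dots> \<le> 4 * ((\<bar>\<theta>\<bar> * real p) ^ 3 + \<bar>\<alpha>\<bar> ^ 3)" by (rule cube_sum_le) auto
      finally show ?thesis unfolding zw by (simp add: norm_mult)
    qed
    then have le: "8 * exp (- x) * norm (wpt t \<theta> \<beta> p - of_real x) ^ 3
      \<le> 8 * exp (- x) * (4 * ((\<bar>\<theta>\<bar> * real p) ^ 3 + \<bar>\<alpha>\<bar> ^ 3))" by (intro mult_left_mono) auto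
    have "8 * exp (- x) * (4 * ((\<bar>\<theta>\<bar> * real p) ^ 3 + \<bar>\<alpha>\<bar> ^ 3))
      = 32 * (\<bar>\<theta>\<bar> ^ 3 * (real p ^ 3 * exp (- x)) + \<bar>\<alpha>\<bar> ^ 3 * exp (- x))"
      by (simp add: power_mult_distrib algebra_simps)
    then show ?thesis using order_trans[OF tay[unfolded eq] le]
      unfolding b_def[symmetric] x_def[symmetric] by simp
  qed
  have "norm ((ell (wpt t \<theta> \<alpha> p) + ell (wpt t \<theta> (- \<alpha>) p)) / 2 - T p)
      \<le> 32 * (\<bar>\<theta>\<bar> ^ 3 * (real p ^ 3 * exp (- (t * real p))) + \<bar>\<alpha>\<bar> ^ 3 * exp (- (t * real p)))" for p
  proof -
    define L where "L = (\<lambda>\<beta>. of_real (ln (1 + exp (- (t * real p)))) + \<i> * of_real (rmu (t * real p) * (\<theta> * real p + parity_sign p * \<beta>))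
      - of_real (rnu (t * real p) * (\<theta> * real p + parity_sign p * \<beta>)\<^sup>2 / 2) :: complex)"
    have ps: "(parity_sign p)\<^sup>2 = 1" by (simp add: parity_sign_def)
    have "((\<theta> * real p + parity_sign p * \<alpha>)\<^sup>2 + (\<theta> * real p + parity_sign p * - \<alpha>)\<^sup>2)
      = 2 * (\<theta>\<^sup>2 * (real p)\<^sup>2 + (parity_sign p)\<^sup>2 * \<alpha>\<^sup>2)"
      by (simp add: power2_eq_square algebra_simps)
    then have sq: "((\<theta> * real p + parity_sign p * \<alpha>)\<^sup>2 + (\<theta> * real p + parity_sign p * - \<alpha>)\<^sup>2)
      = 2 * (\<theta>\<^sup>2 * (real p)\<^sup>2 + \<alpha>\<^sup>2)" unfolding ps by simp
    have "L \<alpha> + L (- \<alpha>) = 2 * of_real (ln (1 + exp (- (t * real p)))) + 2 * \<i> * of_real (rmu (t * real p) * (\<theta> * real p))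
      - of_real (rnu (t * real p) * ((\<theta> * real p + parity_sign p * \<alpha>)\<^sup>2 + (\<theta> * real p + parity_sign p * - \<alpha>)\<^sup>2) / 2)"
      by (simp add: L_def algebra_simps add_divide_distrib)
    then have "L \<alpha> + L (- \<alpha>) = 2 * T p"
      unfolding sq by (simp add: T_def algebra_simps add_divide_distrib)
    then have "(L \<alpha> + L (- \<alpha>)) / 2 = T p" by simp
    then have "(ell (wpt t \<theta> \<alpha> p) + ell (wpt t \<theta> (- \<alpha>) p)) / 2 - T p
      = (ell (wpt t \<theta> \<alpha> p) - L \<alpha>) / 2 + (ell (wpt t \<theta> (- \<alpha>) p) - L (- \<alpha>)) / 2"
      unfolding \<open>(L \<alpha> + L (- \<alpha>)) / 2 = T p\<close>[symmetric]
      by (simp add: add_divide_distrib diff_divide_distrib)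
    also have "norm \<dots> \<le> norm (ell (wpt t \<theta> \<alpha> p) - L \<alpha>) / 2 + norm (ell (wpt t \<theta> (- \<alpha>) p) - L (- \<alpha>)) / 2"
      by (rule order_trans[OF norm_triangle_ineq]) (simp add: norm_divide)
    finally show ?thesis using one[of \<alpha> p] one[of "- \<alpha>" p] unfolding L_def by simp
  qed
  then have "norm (\<Sum>p\<in>A. (ell (wpt t \<theta> \<alpha> p) + ell (wpt t \<theta> (- \<alpha>) p)) / 2 - T p)
      \<le> (\<Sum>p\<in>A. 32 * (\<bar>\<theta>\<bar> ^ 3 * (real p ^ 3 * exp (- (t * real p))) + \<bar>\<alpha>\<bar> ^ 3 * exp (- (t * real p))))"
    by (intro sum_norm_le)
  also have "\<dots> = 32 * (\<bar>\<theta>\<bar> ^ 3 * (\<Sum>p\<in>A. real p ^ 3 * exp (- (t * real p))) + \<bar>\<alpha>\<bar> ^ 3 * (\<Sum>p\<in>A. exp (- (t * real p))))"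
    by (simp add: sum.distrib sum_distrib_left)
  also have "\<dots> \<le> 32 * (\<bar>\<theta>\<bar> ^ 3 * (96 / t ^ 4) + \<bar>\<alpha>\<bar> ^ 3 * (1 / t))"
  proof (intro mult_left_mono add_mono)
    show "(\<Sum>p\<in>A. exp (- (t * real p))) \<le> 1 / t" unfolding A_def by (rule sum_subset_exp_le[OF t(1)])
    have "real p ^ 3 * exp (- (t * real p)) \<le> 48 / t ^ 3 * exp (- (t / 2 * real p))" for p
      using power_exp_le(3)[of "t * real p"] t by (simp add: power_mult_distrib field_simps)
    then have "(\<Sum>p\<in>A. real p ^ 3 * exp (- (t * real p))) \<le> (\<Sum>p\<in>A. 48 / t ^ 3 * exp (- (t / 2 * real p)))"
      by (rule sum_mono)
    also have "\<dots> = 48 / t ^ 3 * (\<Sum>p\<in>A. exp (- (t / 2 * real p)))" by (simp add: sum_distrib_left)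
    also have "\<dots> \<le> 48 / t ^ 3 * (1 / (t / 2))" unfolding A_def
      using t by (intro mult_left_mono sum_subset_exp_le) auto
    also have "\<dots> = 96 / t ^ 4" by (simp add: eval_nat_numeral)
    finally show "(\<Sum>p\<in>A. real p ^ 3 * exp (- (t * real p))) \<le> 96 / t ^ 4" .
  qed auto
  also have "(\<Sum>p\<in>A. (ell (wpt t \<theta> \<alpha> p) + ell (wpt t \<theta> (- \<alpha>) p)) / 2 - T p)
    = (log_Phi A t \<theta> \<alpha> + log_Phi A t \<theta> (- \<alpha>)) / 2 - (\<Sum>p\<in>A. T p)"
    unfolding log_Phi_def sum_subtractf sum_divide_distrib[symmetric] sum.distrib ..
  also have "(\<Sum>p\<in>A. T p) = of_real (ln (Zt A t)) + \<i> * of_real (\<theta> * (\<Sum>p\<in>A. real p * rmu (t * real p)))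
       - of_real ((\<theta>\<^sup>2 * (\<Sum>p\<in>A. (real p)\<^sup>2 * rnu (t * real p)) + \<alpha>\<^sup>2 * (\<Sum>p\<in>A. rnu (t * real p))) / 2)"
    unfolding T_def ln_Zt[OF finA]
    by (simp only: sum_subtractf sum.distrib of_real_sum sum_distrib_left sum_divide_distrib add_divide_distrib of_real_add)
  finally show ?thesis by simp
qed

section \<open>The part odd in \<alpha> as an alternating sum over consecutive parts\<close>

lemma DERIV_shift_sector:
  assumes "w + s \<in> sector x" "0 \<le> x"
  shows "((\<lambda>z. ell (z + s)) has_field_derivative - mu (w + s)) (at w within S)"
proof -
  have "((\<lambda>z. ell (z + s)) has_field_derivative - mu (w + s) * 1) (at w within S)"
    by (rule DERIV_chain2[where f = ell and g = "\<lambda>z. z + s", OF has_field_derivative_ell[OF assms]])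
      (auto intro!: derivative_eq_intros)
  then show ?thesis by simp
qed

text \<open>Differentiating along the segment turns the shift by \<open>s\<close> into a difference
  of two values of \<open>mu\<close>, so the bound gains both factors \<open>norm s\<close> and
  \<open>norm (a - b)\<close>.\<close>

lemma ell_mixed_difference_le:
  assumes "\<And>z. z \<in> closed_segment a b \<Longrightarrow> z \<in> sector x \<and> z + s \<in> sector x" "0 \<le> x"
  shows "norm ((ell a - ell (a + s)) - (ell b - ell (b + s))) \<le> 4 * exp (- x) * norm s * norm (a - b)"
proof (rule field_differentiable_bound[where S = "closed_segment a b" and f' = "\<lambda>z. - mu z - - mu (z + s)"
      and f = "\<lambda>z. ell z - ell (z + s)"])
  fix z assume z: "z \<in> closed_segment a b"
  show "((\<lambda>z. ell z - ell (z + s)) has_field_derivative - mu z - - mu (z + s)) (at z within closed_segment a b)"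
    using assms(1)[OF z] assms(2) by (intro DERIV_diff has_field_derivative_ell DERIV_shift_sector) auto
  have "norm (mu (z + s) - mu z) \<le> 4 * exp (- x) * norm (z + s - z)"
    using assms(1)[OF z] assms(2) by (intro mu_diff_le) auto
  then show "norm (- mu z - - mu (z + s)) \<le> 4 * exp (- x) * norm s" by simp
qed auto

lemma ell_mixed_second_difference_le:
  assumes "\<And>z. z \<in> closed_segment a b \<Longrightarrow> z \<in> sector x \<and> z + s \<in> sector x \<and> z + 2 * s \<in> sector x" "0 \<le> x"
  shows "norm ((ell a - 2 * ell (a + s) + ell (a + 2 * s)) - (ell b - 2 * ell (b + s) + ell (b + 2 * s)))
    \<le> 16 * exp (- x) * (norm s)\<^sup>2 * norm (a - b)"
proof (rule field_differentiable_bound[where S = "closed_segment a b"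
      and f' = "\<lambda>z. - mu z - 2 * (- mu (z + s)) + - mu (z + 2 * s)"
      and f = "\<lambda>z. ell z - 2 * ell (z + s) + ell (z + 2 * s)"])
  fix z assume z: "z \<in> closed_segment a b"
  show "((\<lambda>z. ell z - 2 * ell (z + s) + ell (z + 2 * s)) has_field_derivative
      - mu z - 2 * (- mu (z + s)) + - mu (z + 2 * s)) (at z within closed_segment a b)"
    using assms(1)[OF z] assms(2)
    by (intro DERIV_diff DERIV_add DERIV_cmult has_field_derivative_ell DERIV_shift_sector) auto
  have "norm (mu z - 2 * mu (z + s) + mu (z + 2 * s)) \<le> 16 * exp (- x) * (norm s)\<^sup>2"
    using assms(1)[OF z] assms(2) by (intro mu_second_difference_le) auto
  moreover have "- mu z - 2 * (- mu (z + s)) + - mu (z + 2 * s) = - (mu z - 2 * mu (z + s) + mu (z + 2 * s))"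
    by simp
  ultimately show "norm (- mu z - 2 * (- mu (z + s)) + - mu (z + 2 * s)) \<le> 16 * exp (- x) * (norm s)\<^sup>2"
    by (metis norm_minus_cancel)
qed auto

text \<open>Parity enters only as a sign: \<open>ell (wpt t \<theta> \<alpha> p) - ell (wpt t
  \<theta> (- \<alpha>) p)\<close> is \<open>- ((-1) ^ p) * k p\<close> with \<open>k\<close> smooth
  in \<open>p\<close>. The alternating sum is about half of its first term \<open>k (Suc K)\<close>,
  and \<open>k p\<close> is close to \<open>\<i> * \<alpha>\<close> for small \<open>t * p\<close>
  because \<open>mu 0 = 1 / 2\<close>. The factor \<open>\<bar>\<alpha>\<bar>\<close> in the error
  later cancels the pole of the cotangent.\<close>

lemma log_Phi_odd_le:
  fixes K N :: nat
  assumes t: "0 < t" "t \<le> 1" "4 * \<bar>\<theta>\<bar> \<le> t" "4 * \<bar>\<alpha>\<bar> \<le> 1" and N: "1 / 2 \<le> real N * t\<^sup>2" and KN: "K \<le> N"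
  defines "A \<equiv> {K<..N}"
  shows "norm ((log_Phi A t \<theta> \<alpha> - log_Phi A t \<theta> (- \<alpha>)) / 2 - (-1) ^ K * \<i> * of_real \<alpha> / 4)
    \<le> (26 + 4 * real K) * \<bar>\<alpha>\<bar> * (t + \<bar>\<alpha>\<bar>)"
proof -
  define s where "s = Complex t (- \<theta>)"
  define a where "a = (\<lambda>p. of_nat p * s - \<i> * of_real \<alpha>)"
  define b where "b = (\<lambda>p. of_nat p * s + \<i> * of_real \<alpha>)"
  define k where "k = (\<lambda>p. ell (a p) - ell (b p))"
  have ns: "norm s \<le> 2 * t"
    using cmod_le[of s] t by (simp add: s_def)
  have ab: "norm (a p - b p) = 2 * \<bar>\<alpha>\<bar>" for p
    by (simp add: a_def b_def norm_mult)
  \<comment> \<open>One bound \<open>t * real p\<close> serves all three points, because a shift by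
    \<open>s\<close> raises the real part by \<open>t\<close>.\<close>
  have sec: "z \<in> sector (t * real p)" "z + s \<in> sector (t * real p)" "z + 2 * s \<in> sector (t * real p)"
    if z: "z \<in> closed_segment (a p) (b p)" for z p
  proof -
    obtain r where r: "0 \<le> r" "r \<le> 1" "z = (1 - r) *\<^sub>R a p + r *\<^sub>R b p"
      using z by (auto simp: closed_segment_def)
    define \<beta> where "\<beta> = (2 * r - 1) * \<alpha>"
    have \<beta>: "\<bar>\<beta>\<bar> \<le> \<bar>\<alpha>\<bar>" using r by (auto simp: \<beta>_def abs_mult intro: mult_left_le_one_le)
    have zp: "z + of_nat j * s = Complex (t * real (p + j)) (- \<theta> * real (p + j) + \<beta>)" for j
      unfolding r(3) by (simp add: complex_eq_iff a_def b_def s_def \<beta>_def algebra_simps)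
    have "Complex (t * real (p + j)) (- \<theta> * real (p + j) + \<beta>) \<in> sector (t * real p)" for j
    proof (rule Complex_in_sector[OF t(1,3,4)])
      show "t * real p \<le> t * real (p + j)" using t by simp
      have "\<bar>- \<theta> * real (p + j) + \<beta>\<bar> \<le> \<bar>- \<theta> * real (p + j)\<bar> + \<bar>\<beta>\<bar>" by (rule abs_triangle_ineq)
      then show "\<bar>- \<theta> * real (p + j) + \<beta>\<bar> \<le> \<bar>\<theta>\<bar> * real (p + j) + \<bar>\<alpha>\<bar>"
        using \<beta> by (simp add: abs_mult)
    qed
    then have "z + of_nat j * s \<in> sector (t * real p)" for j unfolding zp .
    from this[of 0] this[of 1] this[of 2]
    show "z \<in> sector (t * real p)" "z + s \<in> sector (t * real p)" "z + 2 * s \<in> sector (t * real p)" by simp_all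
  qed
  have tp: "0 \<le> t * real p" for p using t by simp
  have Suc: "a (Suc p) = a p + s" "b (Suc p) = b p + s" "a (Suc (Suc p)) = a p + 2 * s"
     "b (Suc (Suc p)) = b p + 2 * s" for p
    by (simp_all add: a_def b_def algebra_simps)
  have k1: "norm (k p) \<le> 4 * \<bar>\<alpha>\<bar> * exp (- (t * real p))" for p
    using ell_diff_le[OF sec(1)[of "a p" p] sec(1)[of "b p" p] tp[of p]] by (simp add: k_def ab mult_ac)
  have k2: "norm (k p - k (Suc p)) \<le> 16 * t * \<bar>\<alpha>\<bar>" for p
  proof -
    have "norm (k p - k (Suc p)) \<le> 4 * exp (- (t * real p)) * norm s * (2 * \<bar>\<alpha>\<bar>)"
      using ell_mixed_difference_le[of "a p" "b p" "t * real p" s] sec[of _ p] tp[of p]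
      by (simp add: k_def ab Suc algebra_simps)
    also have "\<dots> \<le> 4 * 1 * (2 * t) * (2 * \<bar>\<alpha>\<bar>)"
      using ns tp[of p] by (intro mult_right_mono mult_mono) auto
    finally show ?thesis by simp
  qed
  have k3: "norm (k p - 2 * k (Suc p) + k (Suc (Suc p))) \<le> 128 * t\<^sup>2 * \<bar>\<alpha>\<bar> * exp (- (t * real p))" for p
  proof -
    have "norm (k p - 2 * k (Suc p) + k (Suc (Suc p))) \<le> 16 * exp (- (t * real p)) * (norm s)\<^sup>2 * (2 * \<bar>\<alpha>\<bar>)"
      using ell_mixed_second_difference_le[of "a p" "b p" "t * real p" s] sec[of _ p] tp[of p]
      by (simp add: k_def ab Suc algebra_simps)
    also have "\<dots> \<le> 16 * exp (- (t * real p)) * (2 * t)\<^sup>2 * (2 * \<bar>\<alpha>\<bar>)"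
      using ns by (intro mult_right_mono mult_left_mono power_mono) auto
    finally show ?thesis by (simp add: power_mult_distrib mult_ac)
  qed
  \<comment> \<open>Adding \<open>z / 2\<close> to \<open>ell z\<close> removes the derivative
    \<open>- 1 / 2\<close> at 0, so the derivative of the new function is of size
    \<open>norm z\<close>; the added terms differ by \<open>- \<i> * \<alpha>\<close>.\<close>
  have k0: "norm (k p - \<i> * of_real \<alpha>) \<le> 8 * \<bar>\<alpha>\<bar> * (2 * t * real p + \<bar>\<alpha>\<bar>)" for p
  proof -
    have "norm ((ell (a p) + a p / 2) - (ell (b p) + b p / 2)) \<le> (4 * (2 * t * real p + \<bar>\<alpha>\<bar>)) * norm (a p - b p)"
    proof (rule field_differentiable_bound[where S = "closed_segment (a p) (b p)" and f' = "\<lambda>z. - mu z + 1 / 2"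
         and f = "\<lambda>z. ell z + z / 2"])
      fix z assume z: "z \<in> closed_segment (a p) (b p)"
      show "((\<lambda>z. ell z + z / 2) has_field_derivative - mu z + 1 / 2) (at z within closed_segment (a p) (b p))"
        by (rule DERIV_add[OF has_field_derivative_ell[OF sec(1)[OF z] tp]]) (auto intro!: derivative_eq_intros)
      have "z \<in> sector 0" using sec(1)[OF z] tp[of p] by (auto simp: sector_def)
      then have "norm (mu z - mu 0) \<le> 4 * exp (- 0) * norm (z - 0)"
        by (intro mu_diff_le) (auto simp: sector_def)
      moreover have "norm z \<le> 2 * t * real p + \<bar>\<alpha>\<bar>"
      proof -
        have c: "closed_segment (a p) (b p) \<subseteq> cball 0 (2 * t * real p + \<bar>\<alpha>\<bar>)"
        proof (rule closed_segment_subset)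
          have *: "norm (of_nat p * s) \<le> 2 * t * real p"
            using mult_left_mono[OF ns, of "real p"] by (simp add: norm_mult mult_ac)
          show "a p \<in> cball 0 (2 * t * real p + \<bar>\<alpha>\<bar>)" "b p \<in> cball 0 (2 * t * real p + \<bar>\<alpha>\<bar>)"
            using norm_triangle_ineq4[of "of_nat p * s" "\<i> * of_real \<alpha>"]
              norm_triangle_ineq[of "of_nat p * s" "\<i> * of_real \<alpha>"] *
            by (auto simp: a_def b_def norm_mult)
        qed auto
        then show ?thesis using z by auto
      qed
      ultimately show "norm (- mu z + 1 / 2) \<le> 4 * (2 * t * real p + \<bar>\<alpha>\<bar>)"
        by (simp add: mu_def norm_minus_commute)
    qed auto
    moreover have "(ell (a p) + a p / 2) - (ell (b p) + b p / 2) = k p - \<i> * of_real \<alpha>"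
      by (simp add: k_def a_def b_def algebra_simps add_divide_distrib diff_divide_distrib)
    ultimately show ?thesis unfolding ab by (simp add: mult_ac)
  qed
  define g where "g = (\<lambda>j. k (Suc K + j))"
  define M where "M = N - K"
  define S where "S = (\<Sum>j<M. (-1) ^ j * g j)"
  have diff: "log_Phi A t \<theta> \<alpha> - log_Phi A t \<theta> (- \<alpha>) = (-1) ^ K * S"
  proof -
    have "ell (wpt t \<theta> \<alpha> p) - ell (wpt t \<theta> (- \<alpha>) p) = - ((-1) ^ p) * k p" for p
    proof (cases "odd p")
      case True
      then have "wpt t \<theta> \<alpha> p = a p" "wpt t \<theta> (- \<alpha>) p = b p"
        by (auto simp: wpt_def parity_sign_def a_def b_def s_def complex_eq_iff)
      then show ?thesis using True by (simp add: k_def)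
    next
      case False
      then have "wpt t \<theta> \<alpha> p = b p" "wpt t \<theta> (- \<alpha>) p = a p"
        by (auto simp: wpt_def parity_sign_def a_def b_def s_def complex_eq_iff)
      then show ?thesis using False by (simp add: k_def)
    qed
    then have "log_Phi A t \<theta> \<alpha> - log_Phi A t \<theta> (- \<alpha>) = (\<Sum>p\<in>{K<..N}. - ((-1) ^ p) * k p)"
      by (simp add: log_Phi_def A_def flip: sum_subtractf)
    also have "\<dots> = (\<Sum>j<M. - ((-1) ^ (Suc K + j)) * k (Suc K + j))"
      by (rule sum.reindex_bij_witness[of _ "\<lambda>j. Suc K + j" "\<lambda>p. p - Suc K"]) (auto simp: M_def)
    also have "\<dots> = (-1) ^ K * S"
      by (simp add: S_def g_def sum_distrib_left power_add mult.assoc)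
    finally show ?thesis .
  qed
  have "norm (S - g 0 / 2) \<le> norm (g M) / 2 + norm (g 0 - g 1) / 4
     + norm (g M - g (Suc M)) / 4 + (\<Sum>j<M. norm (g j - 2 * g (Suc j) + g (Suc (Suc j)))) / 4"
    unfolding S_def by (rule alternating_sum_le)
  moreover have "norm (g M) \<le> 8 * t * \<bar>\<alpha>\<bar>"
  proof -
    have "norm (g M) \<le> 4 * \<bar>\<alpha>\<bar> * exp (- (t * real (Suc N)))"
      using k1[of "Suc N"] KN by (simp add: g_def M_def)
    also have "\<dots> \<le> 4 * \<bar>\<alpha>\<bar> * exp (- (t * real N))" using t by (intro mult_left_mono) auto
    also have "\<dots> \<le> 4 * \<bar>\<alpha>\<bar> * ((2 * t) ^ 1 * fact 1)" using tail_le(1)[OF t(1) N, of 1] by (intro mult_left_mono) auto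
    finally show ?thesis by (simp add: mult_ac)
  qed
  moreover have "norm (g 0 - g 1) \<le> 16 * t * \<bar>\<alpha>\<bar>" "norm (g M - g (Suc M)) \<le> 16 * t * \<bar>\<alpha>\<bar>"
    using k2[of "Suc K"] k2[of "Suc K + M"] by (auto simp: g_def)
  moreover have "(\<Sum>j<M. norm (g j - 2 * g (Suc j) + g (Suc (Suc j)))) \<le> 128 * t * \<bar>\<alpha>\<bar>"
  proof -
    have "(\<Sum>j<M. norm (g j - 2 * g (Suc j) + g (Suc (Suc j)))) \<le> (\<Sum>j<M. 128 * t\<^sup>2 * \<bar>\<alpha>\<bar> * exp (- (t * real (Suc K + j))))"
    proof (rule sum_mono)
      fix j
      show "norm (g j - 2 * g (Suc j) + g (Suc (Suc j))) \<le> 128 * t\<^sup>2 * \<bar>\<alpha>\<bar> * exp (- (t * real (Suc K + j)))"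
        using k3[of "Suc K + j"] by (simp add: g_def)
    qed
    also have "\<dots> = (\<Sum>p\<in>{K<..N}. 128 * t\<^sup>2 * \<bar>\<alpha>\<bar> * exp (- (t * real p)))"
      by (rule sum.reindex_bij_witness[of _ "\<lambda>p. p - Suc K" "\<lambda>j. Suc K + j"]) (auto simp: M_def)
    also have "\<dots> = 128 * t\<^sup>2 * \<bar>\<alpha>\<bar> * (\<Sum>p\<in>{K<..N}. exp (- (t * real p)))" by (simp add: sum_distrib_left)
    also have "\<dots> \<le> 128 * t\<^sup>2 * \<bar>\<alpha>\<bar> * (1 / t)" by (intro mult_left_mono sum_subset_exp_le t) auto
    also have "\<dots> = 128 * t * \<bar>\<alpha>\<bar>" using t by (simp add: power2_eq_square)
    finally show ?thesis .
  qed
  \<comment> \<open>The pieces of \<open>alternating_sum_le\<close> add up as 8/2 + 16/4 + 16/4 +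
    128/4 = 44. With the 8 from \<open>k0\<close> at \<open>Suc K\<close> this becomes 52, and the
    final halving gives 26.\<close>
  ultimately have "norm (S - g 0 / 2) \<le> 44 * (t * \<bar>\<alpha>\<bar>)" by simp
  moreover have "norm (g 0 / 2 - \<i> * of_real \<alpha> / 2) \<le> (8 * real K + 8) * (t * \<bar>\<alpha>\<bar>) + 4 * (\<bar>\<alpha>\<bar> * \<bar>\<alpha>\<bar>)"
    using k0[of "Suc K"] by (simp add: g_def norm_divide algebra_simps flip: diff_divide_distrib)
  ultimately have "norm (S - \<i> * of_real \<alpha> / 2) \<le> (8 * real K + 52) * (t * \<bar>\<alpha>\<bar>) + 4 * (\<bar>\<alpha>\<bar> * \<bar>\<alpha>\<bar>)"
    using norm_triangle_ineq[of "S - g 0 / 2" "g 0 / 2 - \<i> * of_real \<alpha> / 2"] by (simp add: algebra_simps)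
  moreover have "norm ((log_Phi A t \<theta> \<alpha> - log_Phi A t \<theta> (- \<alpha>)) / 2 - (-1) ^ K * \<i> * of_real \<alpha> / 4)
    = norm (S - \<i> * of_real \<alpha> / 2) / 2"
  proof -
    have "(log_Phi A t \<theta> \<alpha> - log_Phi A t \<theta> (- \<alpha>)) / 2 - (-1) ^ K * \<i> * of_real \<alpha> / 4
      = (-1) ^ K * ((S - \<i> * of_real \<alpha> / 2) / 2)"
      unfolding diff by (simp add: algebra_simps diff_divide_distrib)
    then show ?thesis by (simp only: norm_mult norm_power norm_divide) simp
  qed
  moreover have "2 * (\<bar>\<alpha>\<bar> * \<bar>\<alpha>\<bar>) \<le> (26 + 4 * real K) * (\<bar>\<alpha>\<bar> * \<bar>\<alpha>\<bar>)"
    by (intro mult_right_mono) auto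
  moreover have "(26 + 4 * k) * a * (t + a) = ((8 * k + 52) * (t * a)) / 2 + (26 + 4 * k) * (a * a)" for k a :: real
    by (simp add: field_simps)
  from this[of "real K" "\<bar>\<alpha>\<bar>"] have "(26 + 4 * real K) * \<bar>\<alpha>\<bar> * (t + \<bar>\<alpha>\<bar>)
    = ((8 * real K + 52) * (t * \<bar>\<alpha>\<bar>)) / 2 + (26 + 4 * real K) * (\<bar>\<alpha>\<bar> * \<bar>\<alpha>\<bar>)" .
  ultimately show ?thesis by linarith
qed

text \<open>Half of the quadratic form of the leading variances,
  \<open>pi\<^sup>2 / (6 * t ^ 3)\<close> for the sum and \<open>1 / (2 * t)\<close> for the
  excess.\<close>

definition gauss_exp :: "real \<Rightarrow> real \<Rightarrow> real \<Rightarrow> real" where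
  "gauss_exp t \<theta> \<alpha> = pi\<^sup>2 / 12 * (\<theta>\<^sup>2 / t ^ 3) + \<alpha>\<^sup>2 / (4 * t)"

text \<open>Polynomial errors are paid for with part of the exponent; \<open>exp (- q / 4)\<close>
  is kept for the later integration. With \<open>y = q / 4\<close> the larger polynomial is at most
  \<open>1 + 48 * y + 256 * y\<^sup>2\<close>, and \<open>y\<^sup>2 \<le> 2 * exp y\<close> leads to
  561, rounded up to 600.\<close>

lemma polynomial_gauss_le:
  fixes u w q :: real
  assumes "0 \<le> u" "0 \<le> w" "(u\<^sup>2 + w\<^sup>2) / 4 \<le> q"
  shows "(u + u\<^sup>2 + w\<^sup>2 + u ^ 3 + w ^ 3) * exp (- q / 2) \<le> 600 * exp (- q / 4)"
    and "(1 + w) * exp (- q / 2) \<le> 600 * exp (- q / 4)"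
proof -
  define y where "y = q / 4"
  have v: "u\<^sup>2 + w\<^sup>2 \<le> 16 * y" "0 \<le> y" using assms by (auto simp: y_def intro: order_trans[of _ "(u\<^sup>2 + w\<^sup>2) / 4"])
  have e: "1 \<le> exp y" "y \<le> exp y" "y\<^sup>2 \<le> 2 * exp y"
    using v power_le_fact_exp[of y 1] power_le_fact_exp[of y 2] by auto
  have lin: "z \<le> 1 + z\<^sup>2" and cub: "0 \<le> z \<Longrightarrow> z ^ 3 \<le> z\<^sup>2 + (z\<^sup>2)\<^sup>2" for z :: real
  proof -
    have "0 \<le> (z - 1 / 2)\<^sup>2" by simp
    then show lin: "z \<le> 1 + z\<^sup>2" by (simp add: power2_eq_square algebra_simps)
    have "z\<^sup>2 * z \<le> z\<^sup>2 * (1 + z\<^sup>2)" by (intro mult_left_mono lin) auto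
    then show "z ^ 3 \<le> z\<^sup>2 + (z\<^sup>2)\<^sup>2" by (simp add: eval_nat_numeral algebra_simps)
  qed
  have "(u\<^sup>2)\<^sup>2 + (w\<^sup>2)\<^sup>2 \<le> (u\<^sup>2 + w\<^sup>2)\<^sup>2" by (simp add: power2_sum)
  also have "\<dots> \<le> (16 * y)\<^sup>2" using v by (intro power_mono) auto
  finally have "(u\<^sup>2)\<^sup>2 + (w\<^sup>2)\<^sup>2 \<le> 256 * y\<^sup>2" by (simp add: power_mult_distrib)
  then have P: "u + u\<^sup>2 + w\<^sup>2 + u ^ 3 + w ^ 3 \<le> 600 * exp y" "1 + w \<le> 600 * exp y"
    using lin[of u] lin[of w] cub[OF assms(1)] cub[OF assms(2)] v e zero_le_power2[of u] zero_le_power2[of w]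
    by linarith+
  have ex: "exp (- q / 4) = exp y * exp (- q / 2)" by (simp add: y_def flip: exp_add)
  show "(u + u\<^sup>2 + w\<^sup>2 + u ^ 3 + w ^ 3) * exp (- q / 2) \<le> 600 * exp (- q / 4)"
    "(1 + w) * exp (- q / 2) \<le> 600 * exp (- q / 4)"
    unfolding ex using mult_right_mono[OF P(1), of "exp (- q / 2)"] mult_right_mono[OF P(2), of "exp (- q / 2)"]
    by (simp_all add: mult.assoc)
qed

text \<open>\<open>S\<close> stands for the factor from the odd part and the kernel,
  \<open>S0\<close> for its limit at the origin; keeping them abstract lets the difference and a
  fixed excess share one estimate. The hypothesis on \<open>N\<close> makes the phase
  \<open>- N * \<theta>\<close> cancel the mean term up to
  \<open>\<bar>\<theta>\<bar> * R / t\<close>.\<close>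

lemma major_arc_le:
  fixes K N :: nat and S S0 :: complex
  assumes t: "0 < t" "t \<le> 1" and \<theta>: "10000 * \<bar>\<theta>\<bar> \<le> t" and \<alpha>: "10000 * \<bar>\<alpha>\<bar> \<le> 1"
    and N: "real N * t\<^sup>2 = pi\<^sup>2 / 12" and KN: "K \<le> N" and D: "norm (S - S0) \<le> D * (t + \<bar>\<alpha>\<bar>)" "0 \<le> D"
  defines "A \<equiv> {K<..N}"
  defines "R \<equiv> 132 + 12 * real K"
  shows "norm (exp (- \<i> * of_real (real N * \<theta>)) * exp ((log_Phi A t \<theta> \<alpha> + log_Phi A t \<theta> (- \<alpha>)) / 2) * S
      - of_real (Zt A t) * S0 * of_real (exp (- gauss_exp t \<theta> \<alpha>)))
    \<le> Zt A t * (600 * ((R + 3072) * exp (2 * R) * (norm S0 + 2 * D) + D) * sqrt t * exp (- gauss_exp t \<theta> \<alpha> / 4))"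
proof -
  \<comment> \<open>After the rescaling \<open>\<bar>\<theta>\<bar> = u * r ^ 3\<close> and
    \<open>\<bar>\<alpha>\<bar> = w * r\<close> the exponent \<open>q\<close> is free of
    \<open>t\<close>, and every error carries at least one factor \<open>r\<close>.\<close>
  define r where "r = sqrt t"
  have r: "0 < r" "r \<le> 1" "t = r\<^sup>2" using t by (auto simp: r_def)
  define u where "u = \<bar>\<theta>\<bar> / r ^ 3"
  define w where "w = \<bar>\<alpha>\<bar> / r"
  have uw: "0 \<le> u" "0 \<le> w" "\<bar>\<theta>\<bar> = u * r ^ 3" "\<bar>\<alpha>\<bar> = w * r" using r by (auto simp: u_def w_def)
  define q where "q = gauss_exp t \<theta> \<alpha>"
  have q_eq: "q = pi\<^sup>2 / 12 * u\<^sup>2 + w\<^sup>2 / 4"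
    unfolding q_def gauss_exp_def power2_abs[of \<theta>, symmetric] power2_abs[of \<alpha>, symmetric] uw(3,4) r(3)
    using r(1) by (simp add: power_mult_distrib power2_eq_square power3_eq_cube field_simps)
  have "3 / 4 \<le> pi\<^sup>2 / 12" using pi_gt3 mult_mono[of 3 pi 3 pi] by (simp add: power2_eq_square)
  then have "3 / 4 * u\<^sup>2 \<le> pi\<^sup>2 / 12 * u\<^sup>2" by (intro mult_right_mono) auto
  then have q34: "3 / 4 * u\<^sup>2 + w\<^sup>2 / 4 \<le> q" unfolding q_eq by simp
  then have q4: "(u\<^sup>2 + w\<^sup>2) / 4 \<le> q" using zero_le_power2[of u] by argo
  have R: "132 \<le> R" by (simp add: R_def)
  have "pi\<^sup>2 / 12 \<ge> 1 / 2" using \<open>3 / 4 \<le> pi\<^sup>2 / 12\<close> by simp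
  then have N2: "1 / 2 \<le> real N * t\<^sup>2" using N by simp
  define M1 where "M1 = (\<Sum>p\<in>A. real p * rmu (t * real p))"
  define VS where "VS = (\<Sum>p\<in>A. (real p)\<^sup>2 * rnu (t * real p))"
  define VD where "VD = (\<Sum>p\<in>A. rnu (t * real p))"
  define L where "L = (log_Phi A t \<theta> \<alpha> + log_Phi A t \<theta> (- \<alpha>)) / 2"
  define Q where "Q = L - (of_real (ln (Zt A t)) + \<i> * of_real (\<theta> * M1) - of_real ((\<theta>\<^sup>2 * VS + \<alpha>\<^sup>2 * VD) / 2))"
  \<comment> \<open>\<open>X\<close> collects all deviations from the ideal Gaussian exponent: the
    cubic remainder, the mean and the two variances.\<close>
  define X where "X = Q + \<i> * of_real (\<theta> * (M1 - real N)) - of_real ((\<theta>\<^sup>2 * (VS - pi\<^sup>2 / (6 * t ^ 3))) / 2)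
     - of_real ((\<alpha>\<^sup>2 * (VD - 1 / (2 * t))) / 2)"
  have Q_le: "norm Q \<le> 32 * (96 * \<bar>\<theta>\<bar> ^ 3 / t ^ 4 + \<bar>\<alpha>\<bar> ^ 3 / t)"
    unfolding Q_def L_def M1_def VS_def VD_def A_def
    by (rule log_Phi_even_le) (use t \<theta> \<alpha> in auto)
  have b1: "\<bar>\<theta> * (M1 - real N)\<bar> \<le> R * u * r"
  proof -
    have "real N = pi\<^sup>2 / (12 * t\<^sup>2)" using N t by (simp add: field_simps)
    then have "\<bar>M1 - real N\<bar> \<le> R / t" using sum_rmu[OF t N2 KN] by (simp add: M1_def A_def R_def)
    then have "\<bar>\<theta>\<bar> * \<bar>M1 - real N\<bar> \<le> \<bar>\<theta>\<bar> * (R / t)" by (intro mult_left_mono) auto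
    also have "\<dots> = R * u * r" unfolding uw r(3) using r(1) by (simp add: power2_eq_square power3_eq_cube)
    finally show ?thesis by (simp add: abs_mult)
  qed
  have b2: "\<bar>(\<theta>\<^sup>2 * (VS - pi\<^sup>2 / (6 * t ^ 3))) / 2\<bar> \<le> R * u\<^sup>2 * r\<^sup>2 / 2"
  proof -
    have "\<bar>VS - pi\<^sup>2 / (6 * t ^ 3)\<bar> \<le> R / t\<^sup>2"
      using sum_square_rnu[OF t N2 KN] by (simp add: VS_def A_def R_def)
    then have "\<bar>\<theta>\<bar>\<^sup>2 * \<bar>VS - pi\<^sup>2 / (6 * t ^ 3)\<bar> \<le> \<bar>\<theta>\<bar>\<^sup>2 * (R / t\<^sup>2)" by (intro mult_left_mono) auto
    also have "\<dots> = R * u\<^sup>2 * r\<^sup>2" unfolding uw r(3) using r(1) by (simp add: power2_eq_square power3_eq_cube)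
    finally show ?thesis by (simp add: abs_mult)
  qed
  have b3: "\<bar>(\<alpha>\<^sup>2 * (VD - 1 / (2 * t))) / 2\<bar> \<le> R * w\<^sup>2 * r\<^sup>2 / 2"
  proof -
    have "\<bar>VD - 1 / (2 * t)\<bar> \<le> R"
      using sum_rnu[OF t N2 KN] by (simp add: VD_def A_def R_def)
    then have "\<bar>\<alpha>\<bar>\<^sup>2 * \<bar>VD - 1 / (2 * t)\<bar> \<le> \<bar>\<alpha>\<bar>\<^sup>2 * R" by (intro mult_left_mono) auto
    also have "\<dots> = R * w\<^sup>2 * r\<^sup>2" unfolding uw by (simp add: power_mult_distrib)
    finally show ?thesis by (simp add: abs_mult)
  qed
  have b4: "norm Q \<le> 3072 * u ^ 3 * r + 32 * w ^ 3 * r"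
  proof -
    have "32 * (96 * \<bar>\<theta>\<bar> ^ 3 / t ^ 4 + \<bar>\<alpha>\<bar> ^ 3 / t) = 3072 * u ^ 3 * r + 32 * w ^ 3 * r"
      unfolding uw r(3) using r(1) by (simp add: eval_nat_numeral field_simps)
    then show ?thesis using Q_le by simp
  qed
  have "norm X \<le> norm Q + \<bar>\<theta> * (M1 - real N)\<bar> + \<bar>(\<theta>\<^sup>2 * (VS - pi\<^sup>2 / (6 * t ^ 3))) / 2\<bar>
      + \<bar>(\<alpha>\<^sup>2 * (VD - 1 / (2 * t))) / 2\<bar>"
  proof -
    have "norm (a + b - c - d) \<le> norm a + norm b + norm c + norm d" for a b c d :: complex
      using norm_triangle_ineq4[of "a + b - c" d] norm_triangle_ineq4[of "a + b" c] norm_triangle_ineq[of a b]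
      by linarith
    from this[of Q "\<i> * of_real (\<theta> * (M1 - real N))" "of_real ((\<theta>\<^sup>2 * (VS - pi\<^sup>2 / (6 * t ^ 3))) / 2)"
       "of_real ((\<alpha>\<^sup>2 * (VD - 1 / (2 * t))) / 2)"]
    show ?thesis unfolding X_def norm_mult norm_of_real norm_ii by simp
  qed
  then have X0: "norm X \<le> R * u * r + R * u\<^sup>2 * r\<^sup>2 / 2 + R * w\<^sup>2 * r\<^sup>2 / 2 + 3072 * u ^ 3 * r + 32 * w ^ 3 * r"
    using b1 b2 b3 b4 by linarith
  have X1: "norm X \<le> (R + 3072) * (u + u\<^sup>2 + w\<^sup>2 + u ^ 3 + w ^ 3) * r"
  proof -
    have rr: "r\<^sup>2 \<le> r" using r by (simp add: power2_eq_square mult_left_le)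
    have "R * u\<^sup>2 * r\<^sup>2 \<le> R * u\<^sup>2 * r" "R * w\<^sup>2 * r\<^sup>2 \<le> R * w\<^sup>2 * r"
      using rr R by (intro mult_left_mono; simp)+
    moreover have "0 \<le> u * r" "0 \<le> u\<^sup>2 * r" "0 \<le> w\<^sup>2 * r" "0 \<le> u ^ 3 * r" "0 \<le> w ^ 3 * r"
      "0 \<le> R * (u\<^sup>2 * r)" "0 \<le> R * (w\<^sup>2 * r)" "0 \<le> R * (u ^ 3 * r)" "0 \<le> R * (w ^ 3 * r)"
      using uw r R by auto
    moreover have "(R + 3072) * (u + u\<^sup>2 + w\<^sup>2 + u ^ 3 + w ^ 3) * r
       = R * u * r + R * u\<^sup>2 * r + R * w\<^sup>2 * r + R * (u ^ 3 * r) + R * (w ^ 3 * r)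
         + 3072 * (u * r) + 3072 * (u\<^sup>2 * r) + 3072 * (w\<^sup>2 * r) + 3072 * u ^ 3 * r + 3072 * w ^ 3 * r"
      by (simp add: algebra_simps)
    ultimately show ?thesis using X0 by (simp add: mult.assoc)
  qed
  \<comment> \<open>This fixes the constant 10000. It bounds \<open>u * r\<close> and
    \<open>w * r\<close>, so the cubic terms are at most \<open>3072 / 10000 * u\<^sup>2\<close> and
    \<open>32 / 10000 * w\<^sup>2\<close>, below the \<open>3 / 8 * u\<^sup>2\<close> and
    \<open>w\<^sup>2 / 8\<close> that half of \<open>q\<close> provides.\<close>
  have X2: "norm X \<le> 2 * R + q / 2"
  proof -
    have ur: "u * r \<le> 1 / 10000"
    proof -
      have "(u * r) * r\<^sup>2 \<le> (1 / 10000) * r\<^sup>2" using \<theta> unfolding uw r(3) by (simp add: power2_eq_square power3_eq_cube mult_ac)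
      then show ?thesis using r(1) by (simp only: mult_le_cancel_right) auto
    qed
    have wr: "w * r \<le> 1 / 10000" using \<alpha> unfolding uw by simp
    have pos: "0 \<le> u * r" "0 \<le> w * r" using uw r by auto
    have "R * (u * r) \<le> R * 1" using ur R by (intro mult_left_mono) auto
    moreover have "R * (u * r)\<^sup>2 \<le> R * 1" "R * (w * r)\<^sup>2 \<le> R * 1" 
      using ur wr R pos by (intro mult_left_mono power_le_one; simp)+
    moreover have "3072 * u\<^sup>2 * (u * r) \<le> 3072 * u\<^sup>2 * (1 / 10000)" "32 * w\<^sup>2 * (w * r) \<le> 32 * w\<^sup>2 * (1 / 10000)"
      using ur wr by (intro mult_left_mono; simp)+
    moreover have "3072 * u\<^sup>2 * (u * r) = 3072 * u ^ 3 * r" "32 * w\<^sup>2 * (w * r) = 32 * w ^ 3 * r"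
      "R * (u * r)\<^sup>2 = R * u\<^sup>2 * r\<^sup>2" "R * (w * r)\<^sup>2 = R * w\<^sup>2 * r\<^sup>2" "R * (u * r) = R * u * r"
      by (simp_all add: power2_eq_square power3_eq_cube)
    ultimately show ?thesis using X0 q34 zero_le_power2[of u] zero_le_power2[of w] by linarith
  qed
  have eq: "exp (- \<i> * of_real (real N * \<theta>)) * exp L = of_real (Zt A t) * (of_real (exp (- q)) * exp X)"
  proof -
    have "- \<i> * of_real (real N * \<theta>) + L = of_real (ln (Zt A t)) + (of_real (- q) + X)"
      unfolding X_def Q_def q_def gauss_exp_def using t
      by (simp add: field_simps)
    moreover have "exp (of_real (ln (Zt A t))) = (of_real (Zt A t) :: complex)"
      using Zt_pos[of A t] by (simp only: exp_of_real exp_ln)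
    ultimately show ?thesis by (metis exp_add exp_of_real)
  qed
  have nS: "norm S \<le> norm S0 + 2 * D"
  proof -
    have "D * (t + \<bar>\<alpha>\<bar>) \<le> D * 2" using t \<alpha> D by (intro mult_left_mono) auto
    then show ?thesis using D norm_triangle_ineq[of S0 "S - S0"] by simp
  qed
  have S_le: "norm (S - S0) \<le> D * (r * (1 + w))"
  proof -
    have "r\<^sup>2 \<le> r" using r by (simp add: power2_eq_square mult_left_le)
    then have "t + \<bar>\<alpha>\<bar> \<le> r * (1 + w)" unfolding uw r(3) by (simp add: algebra_simps)
    then have "D * (t + \<bar>\<alpha>\<bar>) \<le> D * (r * (1 + w))" using D by (intro mult_left_mono) auto
    then show ?thesis using D by simp
  qed
  define E where "E = exp X * S - S0"
  have "norm E \<le> norm (exp X - 1) * norm S + norm (S - S0)"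
  proof -
    have "E = (exp X - 1) * S + (S - S0)" by (simp add: E_def algebra_simps)
    then show ?thesis by (metis norm_mult norm_triangle_ineq)
  qed
  also have "\<dots> \<le> (norm X * exp (norm X)) * (norm S0 + 2 * D) + D * (r * (1 + w))"
    using norm_exp_minus_one_le[of X] nS S_le by (intro add_mono mult_mono) auto
  also have "\<dots> \<le> (((R + 3072) * (u + u\<^sup>2 + w\<^sup>2 + u ^ 3 + w ^ 3) * r) * (exp (2 * R) * exp (q / 2))) * (norm S0 + 2 * D)
     + D * (r * (1 + w))"
  proof (intro add_mono mult_right_mono order_refl)
    have "0 \<le> (R + 3072) * (u + u\<^sup>2 + w\<^sup>2 + u ^ 3 + w ^ 3) * r"
      using X1 norm_ge_zero order_trans by blast
    then show "norm X * exp (norm X) \<le> ((R + 3072) * (u + u\<^sup>2 + w\<^sup>2 + u ^ 3 + w ^ 3) * r) * (exp (2 * R) * exp (q / 2))"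
      using X1 X2 by (intro mult_mono) (auto simp flip: exp_add)
    show "0 \<le> norm S0 + 2 * D" using D by simp
  qed (use uw r in auto)
  finally have E: "norm E \<le> (((R + 3072) * (u + u\<^sup>2 + w\<^sup>2 + u ^ 3 + w ^ 3) * r) * (exp (2 * R) * exp (q / 2))) * (norm S0 + 2 * D)
     + D * (r * (1 + w))" .
  have "exp (- q) * norm E \<le> exp (- q) * ((((R + 3072) * (u + u\<^sup>2 + w\<^sup>2 + u ^ 3 + w ^ 3) * r) * (exp (2 * R) * exp (q / 2))) * (norm S0 + 2 * D)
     + D * (r * (1 + w)))" by (intro mult_left_mono E) auto
  also have "\<dots> = (R + 3072) * r * exp (2 * R) * (norm S0 + 2 * D) * ((u + u\<^sup>2 + w\<^sup>2 + u ^ 3 + w ^ 3) * (exp (- q) * exp (q / 2)))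
     + D * r * ((1 + w) * exp (- q))" by (simp add: algebra_simps)
  also have "exp (- q) * exp (q / 2) = exp (- q / 2)" by (simp flip: exp_add)
  also have "(R + 3072) * r * exp (2 * R) * (norm S0 + 2 * D) * ((u + u\<^sup>2 + w\<^sup>2 + u ^ 3 + w ^ 3) * exp (- q / 2))
     + D * r * ((1 + w) * exp (- q))
     \<le> (R + 3072) * r * exp (2 * R) * (norm S0 + 2 * D) * (600 * exp (- q / 4)) + D * r * (600 * exp (- q / 4))"
  proof (intro add_mono mult_left_mono polynomial_gauss_le[OF uw(1,2) q4])
    have "0 \<le> q" using q4 zero_le_power2[of u] zero_le_power2[of w] by argo
    then have "(1 + w) * exp (- q) \<le> (1 + w) * exp (- q / 2)" using uw by (intro mult_left_mono) auto
    then show "(1 + w) * exp (- q) \<le> 600 * exp (- q / 4)"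
      using polynomial_gauss_le(2)[OF uw(1,2) q4] by linarith
  qed (use R D r in auto)
  also have "\<dots> = 600 * ((R + 3072) * exp (2 * R) * (norm S0 + 2 * D) + D) * r * exp (- q / 4)"
    by (simp add: algebra_simps)
  finally have fin: "exp (- q) * norm E \<le> 600 * ((R + 3072) * exp (2 * R) * (norm S0 + 2 * D) + D) * r * exp (- q / 4)" .
  have "exp (- \<i> * of_real (real N * \<theta>)) * exp L * S - of_real (Zt A t) * S0 * of_real (exp (- q))
    = of_real (Zt A t) * (of_real (exp (- q)) * E)"
    unfolding eq E_def by (simp add: algebra_simps)
  also have "norm \<dots> = Zt A t * (exp (- q) * norm E)"
    using Zt_pos[of A t] by (simp add: norm_mult)
  also have "\<dots> \<le> Zt A t * (600 * ((R + 3072) * exp (2 * R) * (norm S0 + 2 * D) + D) * r * exp (- q / 4))"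
    using Zt_pos[of A t] by (intro mult_left_mono fin) auto
  finally show ?thesis unfolding L_def q_def r_def .
qed

section \<open>Minor arc\<close>

lemma abs_sin_ge:
  fixes x :: real assumes "\<bar>x\<bar> \<le> pi / 2" shows "\<bar>x\<bar> / 3 \<le> \<bar>sin x\<bar>"
proof -
  have "\<bar>sin x - x\<bar> \<le> \<bar>x\<bar> ^ 3 / 6"
    using Maclaurin_sin_bound[of x 3] by (simp add: sin_coeff_def eval_nat_numeral)
  moreover have "\<bar>x\<bar> ^ 3 \<le> 4 * \<bar>x\<bar>"
  proof -
    have "\<bar>x\<bar> \<le> 2" using assms pi_less_4 by linarith
    then have "\<bar>x\<bar> * \<bar>x\<bar> \<le> 2 * 2" by (intro mult_mono) auto
    then have "(\<bar>x\<bar> * \<bar>x\<bar>) * \<bar>x\<bar> \<le> 4 * \<bar>x\<bar>" by (intro mult_right_mono) auto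
    then show ?thesis by (simp add: power3_eq_cube)
  qed
  ultimately show ?thesis by linarith
qed

lemma one_minus_cos_ge:
  fixes x :: real assumes "\<bar>x\<bar> \<le> pi" shows "x\<^sup>2 / 18 \<le> 1 - cos x"
proof -
  have "(\<bar>x / 2\<bar> / 3)\<^sup>2 \<le> \<bar>sin (x / 2)\<bar>\<^sup>2" using assms by (intro power_mono abs_sin_ge) auto
  then show ?thesis using cos_double_sin[of "x / 2"] by (simp add: power_divide)
qed

lemma one_minus_cos_le: "1 - cos x \<le> (x :: real)\<^sup>2 / 2"
proof -
  have "\<bar>sin (x / 2)\<bar>\<^sup>2 \<le> \<bar>x / 2\<bar>\<^sup>2" by (intro power_mono abs_sin_x_le_abs_x) auto
  then show ?thesis using cos_double_sin[of "x / 2"] by (simp add: power_divide)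
qed

text \<open>With \<open>1 - cos x = 2 * (sin (x / 2))\<^sup>2\<close> this is subadditivity of
  \<open>\<bar>sin x\<bar>\<close> followed by
  \<open>(a + b)\<^sup>2 \<le> 2 * a\<^sup>2 + 2 * b\<^sup>2\<close>. It transfers damping at a sum
  of two phases to at least one of them.\<close>

lemma one_minus_cos_add_le: "1 - cos (x + y) \<le> 2 * (1 - cos x) + 2 * (1 - cos (y :: real))"
proof -
  define a b where "a = x / 2" and "b = y / 2"
  have c: "1 - cos (x + y) = 2 * (sin (a + b))\<^sup>2" "1 - cos x = 2 * (sin a)\<^sup>2" "1 - cos y = 2 * (sin b)\<^sup>2"
    using cos_double_sin[of "a + b"] cos_double_sin[of a] cos_double_sin[of b]
    by (auto simp: a_def b_def add_divide_distrib algebra_simps)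
  have "\<bar>sin (a + b)\<bar> \<le> \<bar>sin a\<bar> + \<bar>sin b\<bar>"
  proof -
    have "\<bar>sin (a + b)\<bar> \<le> \<bar>sin a * cos b\<bar> + \<bar>cos a * sin b\<bar>" unfolding sin_add by (rule abs_triangle_ineq)
    also have "\<dots> \<le> \<bar>sin a\<bar> * 1 + 1 * \<bar>sin b\<bar>" unfolding abs_mult by (intro add_mono mult_mono) auto
    finally show ?thesis by simp
  qed
  then have "\<bar>sin (a + b)\<bar>\<^sup>2 \<le> (\<bar>sin a\<bar> + \<bar>sin b\<bar>)\<^sup>2" by (intro power_mono) auto
  also have "\<dots> \<le> 2 * \<bar>sin a\<bar>\<^sup>2 + 2 * \<bar>sin b\<bar>\<^sup>2"
    using zero_le_power2[of "\<bar>sin a\<bar> - \<bar>sin b\<bar>"] by (simp add: power2_eq_square algebra_simps)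
  finally show ?thesis unfolding c by simp
qed

text \<open>The squared modulus is \<open>(1 + x)\<^sup>2 - 2 * y\<close> with
  \<open>y = x * (1 - cos b)\<close>. Since \<open>(1 + x)\<^sup>2 \<le> 4\<close>, the relative
  loss is at least \<open>y / 2\<close>, which the square root halves once more.\<close>

lemma norm_one_plus_cis_le:
  assumes "0 \<le> x" "x \<le> 1"
  shows "norm (1 + of_real x * cis b) \<le> (1 + x) * exp (- (x * (1 - cos b) / 4))"
proof (rule power2_le_imp_le)
  define y where "y = x * (1 - cos b)"
  have y: "0 \<le> y" using assms by (simp add: y_def)
  have "(norm (1 + of_real x * cis b))\<^sup>2 = (1 + x * cos b)\<^sup>2 + (x * sin b)\<^sup>2"
    by (simp add: cmod_power2)
  also have "\<dots> = 1 + 2 * (x * cos b) + x\<^sup>2 * ((sin b)\<^sup>2 + (cos b)\<^sup>2)"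
  proof -
    have "(1 + x * a)\<^sup>2 + (x * c)\<^sup>2 = 1 + 2 * (x * a) + x\<^sup>2 * (c\<^sup>2 + a\<^sup>2)" for a c :: real
      by (simp add: power2_eq_square algebra_simps)
    then show ?thesis .
  qed
  also have "\<dots> = (1 + x)\<^sup>2 - 2 * y"
    unfolding sin_cos_squared_add y_def by (simp add: power2_eq_square algebra_simps)
  also have "\<dots> \<le> (1 + x)\<^sup>2 - (1 + x)\<^sup>2 / 2 * y"
  proof -
    have "(1 + x)\<^sup>2 \<le> 2\<^sup>2" using assms by (intro power_mono) auto
    then have "(1 + x)\<^sup>2 / 2 * y \<le> 2 * y" using y by (intro mult_right_mono) auto
    then show ?thesis by simp
  qed
  also have "\<dots> = (1 + x)\<^sup>2 * (1 - y / 2)" by (simp add: algebra_simps)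
  also have "\<dots> \<le> (1 + x)\<^sup>2 * exp (- (y / 2))"
    using exp_ge_add_one_self[of "- (y / 2)"] by (intro mult_left_mono) auto
  also have "\<dots> = ((1 + x) * exp (- (y / 4)))\<^sup>2"
    by (simp add: power_mult_distrib flip: exp_double)
  finally show "(norm (1 + of_real x * cis b))\<^sup>2 \<le> ((1 + x) * exp (- (x * (1 - cos b) / 4)))\<^sup>2"
    by (simp add: y_def)
qed (use assms in auto)

lemma exp_minus_wpt: "exp (- wpt t \<theta> \<alpha> p) = of_real (exp (- (t * real p))) * cis (\<theta> * real p + parity_sign p * \<alpha>)"
  by (simp add: wpt_def exp_eq_polar add.commute)

lemma norm_Phi_le:
  assumes "0 \<le> t"
  shows "norm (Phi A t \<theta> \<alpha>) \<le> Zt A t *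
    exp (- ((\<Sum>p\<in>A. exp (- (t * real p)) * (1 - cos (\<theta> * real p + parity_sign p * \<alpha>))) / 4))"
proof (cases "finite A")
  case True
  have "norm (Phi A t \<theta> \<alpha>) = (\<Prod>p\<in>A. norm (1 + exp (- wpt t \<theta> \<alpha> p)))"
    by (simp add: Phi_def prod_norm)
  also have "\<dots> \<le> (\<Prod>p\<in>A. (1 + exp (- (t * real p))) *
      exp (- (exp (- (t * real p)) * (1 - cos (\<theta> * real p + parity_sign p * \<alpha>)) / 4)))"
    unfolding exp_minus_wpt using assms by (intro prod_mono conjI norm_one_plus_cis_le) auto
  also have "\<dots> = Zt A t * exp (\<Sum>p\<in>A. - (exp (- (t * real p)) * (1 - cos (\<theta> * real p + parity_sign p * \<alpha>)) / 4))"
    using True by (simp add: Zt_def prod.distrib exp_sum)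
  finally show ?thesis by (simp add: sum_negf sum_divide_distrib)
qed (simp add: Phi_def Zt_def)

section \<open>Lower bounds for the damping sum\<close>

lemma sum_pairs_le:
  fixes f :: "nat \<Rightarrow> real"
  assumes "\<And>p. 0 \<le> f p" "2 * K + 2 * M \<le> N"
  shows "(\<Sum>j<M. f (2 * K + 1 + 2 * j) + f (2 * K + 2 + 2 * j)) \<le> (\<Sum>p\<in>{K<..N}. f p)"
proof -
  have "(\<Sum>j<M. f (2 * K + 1 + 2 * j) + f (2 * K + 2 + 2 * j)) = (\<Sum>p\<in>{2 * K + 1..<2 * K + 1 + 2 * M}. f p)"
    by (induction M) auto
  also have "\<dots> \<le> (\<Sum>p\<in>{K<..N}. f p)" using assms by (intro sum_mono2) auto
  finally show ?thesis .
qed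

text \<open>Among odd parts the phases \<open>\<theta> * p + \<alpha>\<close> form an arithmetic
  progression, so the damping is a geometric series with real ratio \<open>r\<close> minus one with
  ratio \<open>z = r * cis (2 * \<theta>)\<close>. Once \<open>\<bar>sin \<theta>\<bar>\<close> is
  comparable with \<open>t\<close>, the latter is smaller by a fixed factor, uniformly in
  \<alpha>.\<close>

lemma minor_arc_geometric:
  fixes K N :: nat
  assumes t: "0 < t" "t \<le> 1" and c: "0 < c" "c \<le> 1" "c * t \<le> \<bar>sin \<theta>\<bar>"
    and tc: "864 * t \<le> c\<^sup>2" and N: "1 / 2 \<le> real N * t\<^sup>2" "4 * K + 4 \<le> N"
  shows "c\<^sup>2 * exp (- real (2 * K + 1)) / 216 / t
    \<le> (\<Sum>p\<in>{K<..N}. exp (- (t * real p)) * (1 - cos (\<theta> * real p + parity_sign p * \<alpha>)))"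
proof -
  define f where "f = (\<lambda>p. exp (- (t * real p)) * (1 - cos (\<theta> * real p + parity_sign p * \<alpha>)))"
  \<comment> \<open>About a quarter of \<open>N\<close>: \<open>M\<close> pairs starting at
    \<open>2 * K + 1\<close> stay within \<open>N\<close>, while \<open>N \<le> 4 * M\<close> still
    makes \<open>r ^ M\<close> negligible.\<close>
  define M where "M = (N + 3) div 4"
  have M: "2 * K + 2 * M \<le> N" "N \<le> 4 * M" using N(2) by (auto simp: M_def)
  define r where "r = exp (- (2 * t))"
  define z where "z = of_real r * cis (2 * \<theta>)"
  define \<zeta> where "\<zeta> = cis (\<theta> * real (2 * K + 1) + \<alpha>)"
  have r: "0 < r" "r < 1" using t by (auto simp: r_def)
  have f0: "0 \<le> f p" for p by (simp add: f_def)
  have fj: "f (2 * K + 1 + 2 * j) = exp (- (t * real (2 * K + 1))) * (r ^ j - Re (\<zeta> * z ^ j))" for j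
  proof -
    have "\<theta> * real (2 * K + 1 + 2 * j) + parity_sign (2 * K + 1 + 2 * j) * \<alpha>
      = (\<theta> * real (2 * K + 1) + \<alpha>) + real j * (2 * \<theta>)"
      by (simp add: parity_sign_def algebra_simps)
    moreover have "\<zeta> * cis (2 * \<theta>) ^ j = cis ((\<theta> * real (2 * K + 1) + \<alpha>) + real j * (2 * \<theta>))"
      by (simp only: \<zeta>_def Complex.DeMoivre cis_mult)
    ultimately have "cos (\<theta> * real (2 * K + 1 + 2 * j) + parity_sign (2 * K + 1 + 2 * j) * \<alpha>) = Re (\<zeta> * cis (2 * \<theta>) ^ j)"
      by (simp only: cis.sel)
    moreover have "exp (- (t * real (2 * K + 1 + 2 * j))) = exp (- (t * real (2 * K + 1))) * r ^ j"
      by (simp add: r_def algebra_simps flip: exp_add exp_of_nat_mult)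
    moreover have "Re (\<zeta> * z ^ j) = r ^ j * Re (\<zeta> * cis (2 * \<theta>) ^ j)"
      by (simp add: z_def power_mult_distrib algebra_simps flip: of_real_power)
    ultimately show ?thesis by (simp only: f_def right_diff_distrib mult.assoc mult_1_right)
  qed
  define S where "S = (\<Sum>j<M. r ^ j - Re (\<zeta> * z ^ j))"
  have z1: "z \<noteq> 1" using r norm_cis[of "2 * \<theta>"] by (metis abs_of_pos less_irrefl mult.right_neutral norm_mult norm_of_real norm_one z_def)
  \<comment> \<open>27 is 9 times 3: \<open>exp (- 2) \<ge> 1 / 9\<close> bounds \<open>r\<close>
    from below, and \<open>(1 + \<delta>)\<^sup>2 \<le> 1 + 3 * \<delta>\<close>. The hypothesis
    with 864, which is 27 times 32, then gives \<open>4 * t \<le> \<delta> / 8\<close>.\<close>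
  define \<delta> where "\<delta> = c\<^sup>2 / 27"
  have \<delta>: "0 < \<delta>" "\<delta> \<le> 1" using c power_le_one[of c 2] by (auto simp: \<delta>_def)
  have nz: "(1 - r) * (1 + \<delta>) \<le> norm (1 - z)"
  proof (rule power2_le_imp_le)
    have "cos (2 * \<theta>) = 1 - 2 * (sin \<theta>)\<^sup>2" by (rule cos_double_sin)
    moreover have "(norm (1 - z))\<^sup>2 = (1 - r * cos (2 * \<theta>))\<^sup>2 + (r * sin (2 * \<theta>))\<^sup>2"
      by (simp add: z_def cmod_power2)
    moreover have "(1 - r * a)\<^sup>2 + (r * b)\<^sup>2 = 1 - 2 * r * a + r\<^sup>2 * (b\<^sup>2 + a\<^sup>2)" for a b :: real
      by (simp add: power2_eq_square algebra_simps)
    ultimately have "(norm (1 - z))\<^sup>2 = 1 - 2 * r * (1 - 2 * (sin \<theta>)\<^sup>2) + r\<^sup>2 * 1"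
      using sin_cos_squared_add[of "2 * \<theta>"] by metis
    then have n2: "(norm (1 - z))\<^sup>2 = (1 - r)\<^sup>2 + 4 * r * (sin \<theta>)\<^sup>2"
      by (simp add: power2_eq_square algebra_simps)
    have "1 - r \<le> 2 * t" using exp_ge_add_one_self[of "- (2 * t)"] by (simp add: r_def)
    then have "c * (1 - r) \<le> c * (2 * t)" using c by (intro mult_left_mono) auto
    then have "c * (1 - r) \<le> 2 * \<bar>sin \<theta>\<bar>" using c(3) by linarith
    then have "(c * (1 - r))\<^sup>2 \<le> (2 * \<bar>sin \<theta>\<bar>)\<^sup>2" using c r by (intro power_mono) auto
    then have s: "c\<^sup>2 * (1 - r)\<^sup>2 \<le> 4 * (sin \<theta>)\<^sup>2" by (simp add: power_mult_distrib)
    have "exp 1 \<le> (3 :: real)" by (rule exp_le)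
    then have "exp 2 \<le> (9 :: real)" using mult_mono[of "exp 1" 3 "exp 1" "3 :: real"] by (simp flip: exp_add)
    then have "1 / 9 \<le> exp (- 2 :: real)" by (simp add: exp_minus field_simps)
    also have "\<dots> \<le> r" using t by (simp add: r_def)
    finally have "1 / 9 * (c\<^sup>2 * (1 - r)\<^sup>2) \<le> r * (4 * (sin \<theta>)\<^sup>2)"
      by (rule mult_mono[OF _ s]) (use r in auto)
    moreover have "((1 - r) * (1 + \<delta>))\<^sup>2 \<le> (1 - r)\<^sup>2 * (1 + c\<^sup>2 / 9)"
    proof -
      have "\<delta>\<^sup>2 \<le> \<delta>" using \<delta> by (simp add: power2_eq_square mult_left_le)
      then have "(1 + \<delta>)\<^sup>2 \<le> 1 + 3 * \<delta>" by (simp add: power2_sum)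
      then have "(1 - r)\<^sup>2 * (1 + \<delta>)\<^sup>2 \<le> (1 - r)\<^sup>2 * (1 + c\<^sup>2 / 9)" by (intro mult_left_mono) (auto simp: \<delta>_def)
      then show ?thesis by (simp add: power_mult_distrib)
    qed
    ultimately show "((1 - r) * (1 + \<delta>))\<^sup>2 \<le> (norm (1 - z))\<^sup>2" unfolding n2 by (simp add: algebra_simps)
  qed simp
  have rM: "r ^ M \<le> \<delta> / 8"
  proof -
    have "t * real N / 2 \<le> real M * (2 * t)" using M(2) t by (simp add: field_simps)
    then have "r ^ M \<le> exp (- (t * real N) / 2)" by (simp add: r_def flip: exp_of_nat_mult)
    also have "\<dots> \<le> 4 * t" using tail_le(2)[OF t(1) N(1), of 1] by simp
    also have "\<dots> \<le> \<delta> / 8" using tc by (simp add: \<delta>_def)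
    finally show ?thesis .
  qed
  have "S = (1 - r ^ M) / (1 - r) - Re (\<zeta> * ((1 - z ^ M) / (1 - z)))"
    unfolding S_def sum_subtractf Re_sum[symmetric] sum_distrib_left[symmetric]
    using r z1 by (simp add: sum_gp_strict)
  moreover have "Re (\<zeta> * ((1 - z ^ M) / (1 - z))) \<le> (1 + r ^ M) / ((1 - r) * (1 + \<delta>))"
  proof -
    have "Re (\<zeta> * ((1 - z ^ M) / (1 - z))) \<le> norm (\<zeta> * ((1 - z ^ M) / (1 - z)))" by (rule complex_Re_le_cmod)
    also have "\<dots> = norm (1 - z ^ M) / norm (1 - z)" by (simp add: norm_mult norm_divide \<zeta>_def)
    also have "norm (1 - z ^ M) \<le> 1 + norm (z ^ M)" using norm_triangle_ineq4[of 1 "z ^ M"] by simp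
    also have "norm (z ^ M) = r ^ M" using r by (simp add: z_def norm_mult norm_power)
    finally have "Re (\<zeta> * ((1 - z ^ M) / (1 - z))) \<le> (1 + r ^ M) / norm (1 - z)" by (simp add: divide_right_mono)
    also have "\<dots> \<le> (1 + r ^ M) / ((1 - r) * (1 + \<delta>))"
      using nz r \<delta> z1 by (intro divide_left_mono mult_pos_pos) auto
    finally show ?thesis .
  qed
  ultimately have "(1 - r ^ M) / (1 - r) - (1 + r ^ M) / ((1 - r) * (1 + \<delta>)) \<le> S" by linarith
  moreover have "(1 - r ^ M) / (1 - r) - (1 + r ^ M) / ((1 - r) * (1 + \<delta>)) = (1 - r ^ M - (1 + r ^ M) / (1 + \<delta>)) / (1 - r)"
    using r \<delta> by (simp add: diff_divide_distrib mult.commute)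
  moreover have num: "\<delta> / 4 \<le> 1 - r ^ M - (1 + r ^ M) / (1 + \<delta>)"
  proof -
    have "\<delta> * \<delta> \<le> \<delta> * 1" "r ^ M * \<delta> \<le> r ^ M * 1" using \<delta> r by (intro mult_left_mono; simp)+
    moreover have "(1 - r ^ M) * (1 + \<delta>) - (1 + r ^ M) - \<delta> / 4 * (1 + \<delta>)
       = \<delta> - 2 * r ^ M - r ^ M * \<delta> - \<delta> / 4 - \<delta> * \<delta> / 4"
      by (simp add: algebra_simps)
    ultimately have "\<delta> / 4 * (1 + \<delta>) \<le> (1 - r ^ M) * (1 + \<delta>) - (1 + r ^ M)" using rM \<delta> by linarith
    then have "\<delta> / 4 \<le> ((1 - r ^ M) * (1 + \<delta>) - (1 + r ^ M)) / (1 + \<delta>)" using \<delta> by (simp add: pos_le_divide_eq)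
    then show ?thesis using \<delta> by (simp add: diff_divide_distrib)
  qed
  moreover have "\<delta> / 4 / (2 * t) \<le> \<delta> / 4 / (1 - r)"
    using \<delta> r exp_ge_add_one_self[of "- (2 * t)"] by (intro divide_left_mono) (auto simp: r_def)
  moreover have "\<delta> / 4 / (1 - r) \<le> (1 - r ^ M - (1 + r ^ M) / (1 + \<delta>)) / (1 - r)" 
    using num r by (intro divide_right_mono) auto
  ultimately have S: "\<delta> / (8 * t) \<le> S" by simp
  have "c\<^sup>2 * exp (- real (2 * K + 1)) / 216 / t = exp (- real (2 * K + 1)) * (\<delta> / (8 * t))" by (simp add: \<delta>_def)
  also have "\<dots> \<le> exp (- (t * real (2 * K + 1))) * S"
  proof (intro mult_mono S)
    show "exp (- real (2 * K + 1)) \<le> exp (- (t * real (2 * K + 1)))"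
      using mult_right_mono[OF t(2), of "real (2 * K + 1)"]
      by (simp only: exp_le_cancel_iff neg_le_iff_le mult_1 of_nat_0_le_iff)
  qed (use \<delta> t in auto)
  also have "\<dots> = (\<Sum>j<M. f (2 * K + 1 + 2 * j))" by (simp only: fj S_def sum_distrib_left)
  also have "\<dots> \<le> (\<Sum>j<M. f (2 * K + 1 + 2 * j) + f (2 * K + 2 + 2 * j))" using f0 by (intro sum_mono) auto
  also have "\<dots> \<le> (\<Sum>p\<in>{K<..N}. f p)" by (rule sum_pairs_le[OF f0 M(1)])
  finally show ?thesis by (simp add: f_def)
qed

text \<open>While \<open>p * t \<le> 1\<close> all weights are at least \<open>exp (- 1)\<close>, so
  it is enough to damp each pair of an odd part and its successor by a fixed amount. There are at
  least \<open>1 / (8 * t)\<close> such pairs, and \<open>exp 1 \<le> 3\<close> completes the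
  24.\<close>

lemma minor_arc_window:
  fixes K N :: nat
  assumes t: "0 < t" "8 * (real K + 1) * t \<le> 1" and N: "1 / t \<le> real N" and \<eta>: "0 \<le> \<eta>"
    and pair: "\<And>p. odd p \<Longrightarrow> real (Suc p) * t \<le> 1 \<Longrightarrow>
       \<eta> \<le> (1 - cos (\<theta> * real p + \<alpha>)) + (1 - cos (\<theta> * real (Suc p) - \<alpha>))"
  shows "\<eta> / 24 / t \<le> (\<Sum>p\<in>{K<..N}. exp (- (t * real p)) * (1 - cos (\<theta> * real p + parity_sign p * \<alpha>)))"
proof -
  define f where "f = (\<lambda>p. exp (- (t * real p)) * (1 - cos (\<theta> * real p + parity_sign p * \<alpha>)))"
  define M where "M = nat \<lfloor>1 / (4 * t)\<rfloor>"
  have f0: "0 \<le> f p" for p by (simp add: f_def)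
  have "0 \<le> real K * t" using t by simp
  moreover have "8 * (real K + 1) * t = 8 * t + 8 * (real K * t)" by (simp add: algebra_simps)
  ultimately have t8: "8 * t \<le> 1" using t by linarith
  have M1: "real M \<le> 1 / (4 * t)" using t by (simp add: M_def)
  have "1 / (4 * t) - 1 \<le> real M" using t by (simp add: M_def)
  moreover have "1 \<le> 1 / (8 * t)" using t8 t by (simp add: field_simps)
  moreover have "1 / (4 * t) = 1 / (8 * t) + 1 / (8 * t)" by simp
  ultimately have M2: "1 / (8 * t) \<le> real M" by linarith
  have small: "real (2 * K + 2 * M + 2) * t \<le> 1"
  proof -
    have "real M * t \<le> 1 / (4 * t) * t" using M1 t by (intro mult_right_mono) auto
    then have "real M * t \<le> 1 / 4" using t by simp
    moreover have "(2 * real K + 2) * t \<le> 1 / 4" using t by (simp add: algebra_simps)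
    ultimately show ?thesis by (simp add: algebra_simps)
  qed
  then have "real (2 * K + 2 * M + 2) \<le> 1 / t" using t by (simp add: field_simps)
  then have MN: "2 * K + 2 * M \<le> N" using N by linarith
  have pairj: "exp (- 1) * \<eta> \<le> f (2 * K + 1 + 2 * j) + f (2 * K + 2 + 2 * j)" if j: "j < M" for j
  proof -
    define p where "p = 2 * K + 1 + 2 * j"
    have p: "odd p" "2 * K + 2 + 2 * j = Suc p" by (auto simp: p_def)
    have "real (Suc p) * t \<le> real (2 * K + 2 * M + 2) * t" using j t by (intro mult_right_mono) (auto simp: p_def)
    then have pt: "real (Suc p) * t \<le> 1" using small by linarith
    moreover have "real p * t \<le> real (Suc p) * t" using t by (intro mult_right_mono) auto
    ultimately have e: "exp (- 1) \<le> exp (- (t * real p))" "exp (- 1) \<le> exp (- (t * real (Suc p)))"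
      by (simp_all add: mult.commute)
    have "exp (- 1) * \<eta> \<le> exp (- 1) * ((1 - cos (\<theta> * real p + \<alpha>)) + (1 - cos (\<theta> * real (Suc p) - \<alpha>)))"
      using pair[OF p(1) pt] by (intro mult_left_mono) auto
    also have "\<dots> = exp (- 1) * (1 - cos (\<theta> * real p + \<alpha>)) + exp (- 1) * (1 - cos (\<theta> * real (Suc p) - \<alpha>))"
      by (simp add: algebra_simps)
    also have "\<dots> \<le> exp (- (t * real p)) * (1 - cos (\<theta> * real p + \<alpha>))
       + exp (- (t * real (Suc p))) * (1 - cos (\<theta> * real (Suc p) - \<alpha>))"
      using e by (intro add_mono mult_right_mono) auto
    also have "\<dots> = f p + f (Suc p)" using p(1) by (simp add: f_def parity_sign_def)
    finally show ?thesis unfolding p(2) p_def .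
  qed
  have "exp 1 \<le> (3 :: real)" by (rule exp_le)
  then have "1 / 3 \<le> exp (- 1 :: real)" by (simp add: exp_minus field_simps)
  then have "(1 / (8 * t)) * (1 / 3 * \<eta>) \<le> real M * (exp (- 1) * \<eta>)"
    using M2 \<eta> t by (intro mult_mono) auto
  also have "\<dots> = (\<Sum>j<M. exp (- 1) * \<eta>)" by simp
  also have "\<dots> \<le> (\<Sum>j<M. f (2 * K + 1 + 2 * j) + f (2 * K + 2 + 2 * j))" using pairj by (intro sum_mono) auto
  also have "\<dots> \<le> (\<Sum>p\<in>{K<..N}. f p)" by (rule sum_pairs_le[OF f0 MN])
  finally show ?thesis by (simp add: f_def mult_ac)
qed

text \<open>If \<open>\<bar>sin \<theta>\<bar>\<close> is below \<open>c1 * t\<close>, then \<theta>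
  is close to 0 or to \<open>\<plusminus> pi\<close>. Near 0 the angle \<alpha> must itself be
  bounded away from 0. Near \<open>\<plusminus> pi\<close> the phases of two consecutive parts add
  up to \<open>\<theta> * (2 * p + 1)\<close>: there \<alpha> has disappeared, and the cosine is at
  most 0.\<close>

lemma minor_arc:
  fixes K :: nat
  shows "\<exists>c>0. \<exists>t0>0. \<forall>t N \<theta> \<alpha>. 0 < t \<longrightarrow> t \<le> t0 \<longrightarrow> real N * t\<^sup>2 = pi\<^sup>2 / 12 \<longrightarrow> \<bar>\<theta>\<bar> \<le> pi \<longrightarrow> \<bar>\<alpha>\<bar> \<le> pi \<longrightarrow>
    t \<le> 10000 * \<bar>\<theta>\<bar> \<or> 1 \<le> 10000 * \<bar>\<alpha>\<bar> \<longrightarrow> norm (Phi {K<..N} t \<theta> \<alpha>) \<le> Zt {K<..N} t * exp (- (c / t))"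
proof -
  \<comment> \<open>With \<open>\<bar>x\<bar> \<le> 3 * \<bar>sin x\<bar>\<close> this leads to
    \<open>\<bar>\<theta>\<bar> \<le> t / 400000\<close>, forty times below the threshold of the
    major arc, so the phase \<open>\<theta> * p\<close> cannot compensate an \<alpha> of size
    \<open>1 / 10000\<close>.\<close>
  define c1 :: real where "c1 = 1 / 1200000"
  define ca where "ca = c1\<^sup>2 * exp (- real (2 * K + 1)) / 216"
  \<comment> \<open>The gap \<open>1 / (18 * 10 ^ 8)\<close> for \<open>1 - cos \<alpha>\<close> is
    halved and loses a small correction from \<open>\<theta> * p\<close>; more than
    \<open>2 / 10 ^ 10\<close> is left.\<close>
  define \<eta> :: real where "\<eta> = 2 / 10 ^ 10"
  define c where "c = min ca (\<eta> / 24)"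
  define t0 where "t0 = min (c1\<^sup>2 / 864) (1 / (8 * (real K + 1)))"
  have pos: "0 < c1" "0 < ca" "0 < \<eta>" by (auto simp: c1_def ca_def \<eta>_def)
  then have "0 < c / 4" "0 < t0" by (auto simp: c_def t0_def)
  moreover have "norm (Phi {K<..N} t \<theta> \<alpha>) \<le> Zt {K<..N} t * exp (- (c / 4 / t))"
    if t: "0 < t" "t \<le> t0" and N: "real N * t\<^sup>2 = pi\<^sup>2 / 12" and \<theta>: "\<bar>\<theta>\<bar> \<le> pi" and \<alpha>: "\<bar>\<alpha>\<bar> \<le> pi"
      and far: "t \<le> 10000 * \<bar>\<theta>\<bar> \<or> 1 \<le> 10000 * \<bar>\<alpha>\<bar>" for t \<theta> \<alpha> :: real and N
  proof -
    define E where "E = (\<Sum>p\<in>{K<..N}. exp (- (t * real p)) * (1 - cos (\<theta> * real p + parity_sign p * \<alpha>)))"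
    have t1: "864 * t \<le> c1\<^sup>2" using t by (simp add: t0_def)
    have "t \<le> 1 / (8 * (real K + 1))" using t by (simp add: t0_def)
    then have t2: "8 * (real K + 1) * t \<le> 1" by (simp add: field_simps)
    have "0 \<le> real K * t" using t by simp
    moreover have "8 * (real K + 1) * t = 8 * t + 8 * (real K * t)" by (simp add: algebra_simps)
    ultimately have t3: "t \<le> 1 / 8" using t2 by linarith
    have N2: "1 / 2 \<le> real N * t\<^sup>2" using N pi_gt3 mult_mono[of 3 pi 3 pi] by (simp add: power2_eq_square)
    have N3: "1 / t \<le> real N"
    proof -
      have "1 \<le> real N * t * (2 * t)" using N2 by (simp add: power2_eq_square mult_ac)
      also have "\<dots> \<le> real N * t * 1" using t t3 by (intro mult_left_mono) auto
      finally show ?thesis using t by (simp add: field_simps)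
    qed
    have N4: "4 * K + 4 \<le> N"
    proof -
      have "8 * (real K + 1) \<le> 1 / t" using t2 t by (simp add: field_simps)
      then have "8 * (real K + 1) \<le> real N" using N3 by linarith
      then have "real (8 * (K + 1)) \<le> real N" by simp
      then show ?thesis unfolding of_nat_le_iff by simp
    qed
    have "c / t \<le> E"
    proof (cases "c1 * t \<le> \<bar>sin \<theta>\<bar>")
      case True
      have "ca / t \<le> E" unfolding ca_def E_def
        by (rule minor_arc_geometric[OF _ _ _ _ True t1 N2 N4]) (use t t3 in \<open>auto simp: c1_def\<close>)
      moreover have "c / t \<le> ca / t" using t by (intro divide_right_mono) (auto simp: c_def)
      ultimately show ?thesis by linarith
    next
      case False
      have "\<eta> / 24 / t \<le> E" unfolding E_def
      proof (rule minor_arc_window[OF t(1) t2 N3])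
        fix p :: nat assume p: "odd p" "real (Suc p) * t \<le> 1"
        have pt: "real p * t \<le> 1" using p(2) t by (simp add: algebra_simps)
        show "\<eta> \<le> (1 - cos (\<theta> * real p + \<alpha>)) + (1 - cos (\<theta> * real (Suc p) - \<alpha>))"
        proof (cases "\<bar>\<theta>\<bar> \<le> pi / 2")
          case near0: True
          have "\<bar>\<theta>\<bar> \<le> 3 * \<bar>sin \<theta>\<bar>" using abs_sin_ge[OF near0] by simp
          then have th: "\<bar>\<theta>\<bar> \<le> t / 400000" using False by (simp add: c1_def)
          then have "1 \<le> 10000 * \<bar>\<alpha>\<bar>" using far t by auto
          then have "(1 / 10000)\<^sup>2 \<le> \<bar>\<alpha>\<bar>\<^sup>2" by (intro power_mono) auto
          then have a: "1 / 10 ^ 8 / 18 \<le> 1 - cos \<alpha>" using one_minus_cos_ge[OF \<alpha>] by (simp add: power_divide)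
          have "\<bar>\<theta> * real p\<bar> \<le> t / 400000 * real p"
            using mult_right_mono[OF th, of "real p"] by (simp add: abs_mult)
          also have "\<dots> \<le> 1 / 400000" using pt by (simp add: mult.commute)
          finally have "\<bar>\<theta> * real p\<bar>\<^sup>2 \<le> (1 / 400000)\<^sup>2" by (intro power_mono) auto
          then have b: "1 - cos (- (\<theta> * real p)) \<le> (1 / 400000)\<^sup>2 / 2"
            using one_minus_cos_le[of "\<theta> * real p"] by simp
          have "1 - cos \<alpha> \<le> 2 * (1 - cos (\<theta> * real p + \<alpha>)) + 2 * (1 - cos (- (\<theta> * real p)))"
            using one_minus_cos_add_le[of "\<theta> * real p + \<alpha>" "- (\<theta> * real p)"] by simp
          then have "\<eta> \<le> 1 - cos (\<theta> * real p + \<alpha>)" using a b by (simp add: \<eta>_def power_divide)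
          moreover have "cos (\<theta> * real (Suc p) - \<alpha>) \<le> 1" by simp
          ultimately show ?thesis by linarith
        next
          case nearpi: False
          define \<theta>' where "\<theta>' = \<theta> - sgn \<theta> * pi"
          have s: "sgn \<theta> = 1 \<or> sgn \<theta> = - 1" using nearpi by (auto simp: sgn_if)
          have th': "\<bar>\<theta>'\<bar> \<le> pi / 2" using \<theta> nearpi by (auto simp: \<theta>'_def sgn_if abs_if split: if_splits)
          have "\<bar>sin \<theta>'\<bar> = \<bar>sin \<theta>\<bar>" using s by (auto simp: \<theta>'_def)
          then have "\<bar>\<theta>'\<bar> \<le> 3 * \<bar>sin \<theta>\<bar>" using abs_sin_ge[OF th'] by simp
          then have th: "\<bar>\<theta>'\<bar> \<le> t / 400000" using False by (simp add: c1_def)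
          \<comment> \<open>\<open>q\<close> is odd, hence \<open>\<theta> * q\<close> differs from
            \<open>\<theta>' * q\<close> by an odd multiple of \<open>pi\<close>, which flips the
            sign of the cosine.\<close>
          define q where "q = 2 * p + 1"
          have q: "odd q" "real q = real p + real (Suc p)" by (auto simp: q_def)
          have "\<bar>\<theta>' * real q\<bar> \<le> t / 400000 * real q"
            using mult_right_mono[OF th, of "real q"] by (simp add: abs_mult)
          also have "\<dots> \<le> 1" using p(2) pt unfolding q(2) by (simp add: algebra_simps)
          finally have "0 \<le> cos (\<theta>' * real q)" using pi_gt3 by (intro cos_ge_zero) auto
          moreover have "cos (\<theta> * real q) = - cos (\<theta>' * real q)"
          proof -
            have "\<theta> * real q = \<theta>' * real q + sgn \<theta> * (real q * pi)" by (simp add: \<theta>'_def algebra_simps)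
            then show ?thesis using s q(1) by (auto simp: cos_add cos_diff cos_npi)
          qed
          moreover have "1 - cos (\<theta> * real q) \<le> 2 * (1 - cos (\<theta> * real p + \<alpha>)) + 2 * (1 - cos (\<theta> * real (Suc p) - \<alpha>))"
            using one_minus_cos_add_le[of "\<theta> * real p + \<alpha>" "\<theta> * real (Suc p) - \<alpha>"]
            unfolding q(2) by (simp add: algebra_simps)
          ultimately show ?thesis by (simp add: \<eta>_def)
        qed
      qed (simp add: \<eta>_def)
      moreover have "c / t \<le> \<eta> / 24 / t" using t by (intro divide_right_mono) (auto simp: c_def)
      ultimately show ?thesis by linarith
    qed
    then have "exp (- (E / 4)) \<le> exp (- (c / 4 / t))" by simp
    then have "Zt {K<..N} t * exp (- (E / 4)) \<le> Zt {K<..N} t * exp (- (c / 4 / t))"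
      using Zt_pos[of "{K<..N}" t] by (intro mult_left_mono) auto
    then show ?thesis using norm_Phi_le[of t "{K<..N}" \<theta> \<alpha>] t unfolding E_def by linarith
  qed
  ultimately show ?thesis by blast
qed

section \<open>Gaussian localization\<close>

lemma has_bochner_integral_gauss:
  assumes "0 < c"
  shows "has_bochner_integral lborel (\<lambda>x :: real. exp (- (c * x\<^sup>2))) (sqrt (pi / c))"
proof -
  define s where "s = sqrt (1 / (2 * c))"
  have s: "0 < s" "s\<^sup>2 = 1 / (2 * c)" using assms by (auto simp: s_def)
  have "has_bochner_integral lborel (\<lambda>x. sqrt (2 * pi * s\<^sup>2) * normal_density 0 s x) (sqrt (2 * pi * s\<^sup>2) * 1)"
    using integrable_normal_density[OF s(1)] integral_normal_density[OF s(1)]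
    by (intro has_bochner_integral_mult_right) (simp add: has_bochner_integral_iff)
  moreover have "sqrt (2 * pi * s\<^sup>2) * normal_density 0 s x = exp (- (c * x\<^sup>2))" for x
    using s assms by (simp add: normal_density_def)
  moreover have "2 * pi * s\<^sup>2 = pi / c" using s assms by simp
  ultimately show ?thesis by simp
qed

text \<open>The comparison is pointwise on the whole line; outside the interval the Gaussian itself
  is the error. The null set \<open>x = 0\<close> is left out because the cotangent formula breaks
  down there. The factor 2 is the square root of the 4 in \<open>c / 4\<close>.\<close>

lemma gauss_approximation:
  fixes f :: "real \<Rightarrow> complex" and a c r B E :: real
  assumes f: "continuous_on {-r..r} f" and c: "0 < c" and r: "0 \<le> r" and B: "0 \<le> B" and E: "0 \<le> E"
    and inside: "\<And>x. \<bar>x\<bar> \<le> r \<Longrightarrow> x \<noteq> 0 \<Longrightarrow> norm (f x - A * of_real (exp (- (c * x\<^sup>2)))) \<le> B * exp (- (c / 4 * x\<^sup>2)) + E"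
    and outside: "\<And>x. r < \<bar>x\<bar> \<Longrightarrow> norm A * exp (- (c * x\<^sup>2)) \<le> B * exp (- (c / 4 * x\<^sup>2))"
  shows "norm (integral {-r..r} f - A * of_real (sqrt (pi / c))) \<le> 2 * B * sqrt (pi / c) + 2 * r * E"
proof -
  define g where "g = (\<lambda>x :: real. indicator {-r..r} x *\<^sub>R f x - A * of_real (exp (- (c * x\<^sup>2))))"
  define b where "b = (\<lambda>x :: real. B * exp (- (c / 4 * x\<^sup>2)) + E * indicator {-r..r} x)"
  have fi: "set_integrable lborel {-r..r} f" by (rule borel_integrable_atLeastAtMost'[OF f])
  have G: "has_bochner_integral lborel (\<lambda>x :: real. exp (- (c * x\<^sup>2))) (sqrt (pi / c))"
    "has_bochner_integral lborel (\<lambda>x :: real. exp (- (c / 4 * x\<^sup>2))) (sqrt (pi / (c / 4)))"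
    using c by (intro has_bochner_integral_gauss; simp)+
  have "has_bochner_integral lborel (\<lambda>x. indicator {-r..r} x *\<^sub>R f x) (integral {-r..r} f)"
    using fi set_borel_integral_eq_integral[OF fi]
    by (simp add: has_bochner_integral_iff set_integrable_def set_lebesgue_integral_def)
  then have g: "has_bochner_integral lborel g (integral {-r..r} f - A * of_real (sqrt (pi / c)))"
    unfolding g_def
    by (intro has_bochner_integral_diff has_bochner_integral_mult_right has_bochner_integral_of_real G)
  have "has_bochner_integral lborel (\<lambda>x. indicator {-r..r} x :: real) (2 * r)"
    using r by (simp add: has_bochner_integral_iff)
  then have b: "has_bochner_integral lborel b (B * sqrt (pi / (c / 4)) + E * (2 * r))"
    unfolding b_def by (intro has_bochner_integral_add has_bochner_integral_mult_right G)
  have "AE x in lborel. norm (g x) \<le> b x"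
    using AE_lborel_singleton[of 0]
  proof eventually_elim
    case (elim x)
    show ?case
    proof (cases "\<bar>x\<bar> \<le> r")
      case True
      then have "x \<in> {-r..r}" by auto
      then show ?thesis using inside[OF True] elim by (simp add: g_def b_def)
    next
      case False
      then have "x \<notin> {-r..r}" by auto
      then show ?thesis using outside[of x] False by (simp add: g_def b_def norm_mult)
    qed
  qed
  then have "integral\<^sup>L lborel (\<lambda>x. norm (g x)) \<le> integral\<^sup>L lborel b"
    using g b by (intro integral_mono_AE) (auto simp: has_bochner_integral_iff)
  then have "norm (integral\<^sup>L lborel g) \<le> integral\<^sup>L lborel b"
    using integral_norm_bound[of lborel g] by linarith
  moreover have "sqrt (pi / (c / 4)) = 2 * sqrt (pi / c)"
  proof -
    have "pi / (c / 4) = 4 * (pi / c)" by simp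
    then show ?thesis by (simp only: real_sqrt_mult real_sqrt_four)
  qed
  ultimately show ?thesis
    using g b by (simp add: has_bochner_integral_iff mult_ac)
qed

section \<open>Extraction of coefficients\<close>

lemma integral_cis:
  fixes m :: int
  shows "integral {-pi..pi} (\<lambda>x. cis (of_int m * x)) = (if m = 0 then of_real (2 * pi) else 0)"
proof (cases "m = 0")
  case False
  define F where "F = (\<lambda>x. cis (of_int m * x) / (\<i> * of_int m))"
  have "((\<lambda>x. cis (of_int m * x)) has_integral (F pi - F (- pi))) {-pi..pi}"
  proof (rule fundamental_theorem_of_calculus)
    fix x :: real
    have "(F has_vector_derivative (cis (of_int m * x))) (at x)"
    proof -
      have "((\<lambda>x. exp (\<i> * of_int m * of_real x)) has_vector_derivative (\<i> * of_int m * exp (\<i> * of_int m * of_real x))) (at x)"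
        by (rule has_vector_derivative_real_field) (auto intro!: derivative_eq_intros)
      then have "((\<lambda>x. exp (\<i> * of_int m * of_real x) / (\<i> * of_int m)) has_vector_derivative (\<i> * of_int m * exp (\<i> * of_int m * of_real x)) / (\<i> * of_int m)) (at x)"
        by (rule has_vector_derivative_divide)
      then show ?thesis using False by (simp add: F_def cis_conv_exp mult.assoc)
    qed
    then show "(F has_vector_derivative cis (of_int m * x)) (at x within {-pi..pi})"
      by (rule has_vector_derivative_at_within)
  qed auto
  moreover have "F pi = F (- pi)"
  proof -
    have "cis (of_int m * pi) = cis (of_int m * - pi)"
      by (simp add: complex_eq_iff) (metis mult.commute sin_npi_int)
    then show ?thesis by (simp add: F_def)
  qed
  ultimately show ?thesis using False by (simp add: integral_unique)
qed (simp add: scaleR_conv_of_real)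

text \<open>Integrating in \<alpha> first replaces each kernel \<open>T i\<close> by its mean
  \<open>\<tau> i\<close>; integrating in \<theta> then selects \<open>s i = N\<close> by
  orthogonality. Both times the integrand is compared with a Gaussian. The flat error
  \<open>C * t ^ 3\<close> is harmless, since the main term has size
  \<open>t\<^sup>2\<close>.\<close>

lemma localization:
  fixes I :: "'i set" and s :: "'i \<Rightarrow> nat" and T :: "'i \<Rightarrow> real \<Rightarrow> complex" and \<tau> :: "'i \<Rightarrow> complex"
    and S0 :: complex and t C Z :: real and N :: nat
  assumes I: "finite I" and cont: "\<And>i. continuous_on {-pi..pi} (T i)"
    and \<tau>: "\<And>i. integral {-pi..pi} (T i) = of_real (2 * pi) * \<tau> i"
    and t: "0 < t" "t \<le> 1" and Z: "0 < Z" and C: "0 \<le> C"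
    and bd: "\<And>\<theta> \<alpha>. \<bar>\<theta>\<bar> \<le> pi \<Longrightarrow> \<bar>\<alpha>\<bar> \<le> pi \<Longrightarrow> \<alpha> \<noteq> 0 \<Longrightarrow>
      norm (cis (- (real N * \<theta>)) * (\<Sum>i\<in>I. of_real (exp (- (t * real (s i)))) * cis (\<theta> * real (s i)) * T i \<alpha>)
        - of_real Z * S0 * of_real (exp (- gauss_exp t \<theta> \<alpha>)))
      \<le> Z * (C * sqrt t * exp (- gauss_exp t \<theta> \<alpha> / 4) + C * t ^ 3)"
  shows "norm (of_real (4 * pi\<^sup>2 * exp (- (t * real N))) * (\<Sum>i\<in>{i\<in>I. s i = N}. \<tau> i)
      - of_real (Z * (4 * sqrt 3 * t\<^sup>2)) * S0) \<le> Z * (200 * (C + norm S0) * (t\<^sup>2 * sqrt t))"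
proof -
  define a where "a = pi\<^sup>2 / 12"
  have a: "3 / 4 \<le> a" using pi_gt3 mult_mono[of 3 pi 3 pi] by (simp add: a_def power2_eq_square)
  define D where "D = C + norm S0"
  have D: "0 \<le> D" "norm S0 \<le> D" "C \<le> D" using C by (auto simp: D_def)
  \<comment> \<open>Beyond \<open>pi\<close> three quarters of the exponent already exceed
    \<open>1 / t\<close>, and \<open>exp (- (1 / t)) \<le> t \<le> sqrt t\<close>.\<close>
  have tail: "exp (- (c * x\<^sup>2)) \<le> sqrt t * exp (- (c / 4 * x\<^sup>2))" if "1 / (4 * t) \<le> c" "pi < \<bar>x\<bar>" for c x :: real
  proof -
    have "3\<^sup>2 \<le> \<bar>x\<bar>\<^sup>2" using that pi_gt3 by (intro power_mono) auto
    moreover have "0 < 1 / (4 * t)" using t by simp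
    then have "0 \<le> c" using that(1) by linarith
    ultimately have "1 / (4 * t) * 9 \<le> c * x\<^sup>2" using that(1) by (intro mult_mono) auto
    moreover have "1 / t = 4 * (1 / (4 * t))" "0 < 1 / (4 * t)" using t by auto
    ultimately have "1 / t \<le> 3 / 4 * (c * x\<^sup>2)" by linarith
    then have "exp (- (3 / 4 * (c * x\<^sup>2))) \<le> exp (- (1 / t))" by simp
    also have "\<dots> \<le> fact 1 / (1 / t) ^ 1" using t by (intro exp_neg_le) auto
    also have "\<dots> \<le> sqrt t"
    proof -
      have "sqrt t * sqrt t \<le> sqrt t * 1" using t by (intro mult_left_mono) auto
      then show ?thesis using t by simp
    qed
    finally have "exp (- (3 / 4 * (c * x\<^sup>2))) * exp (- (c / 4 * x\<^sup>2)) \<le> sqrt t * exp (- (c / 4 * x\<^sup>2))"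
      by (intro mult_right_mono) auto
    moreover have "exp (- (3 / 4 * (c * x\<^sup>2))) * exp (- (c / 4 * x\<^sup>2)) = exp (- (c * x\<^sup>2))"
      by (simp flip: exp_add)
    ultimately show ?thesis by (simp only:)
  qed
  define F where "F = (\<lambda>\<theta>. cis (- (real N * \<theta>)) * (\<Sum>i\<in>I. of_real (exp (- (t * real (s i)))) * cis (\<theta> * real (s i)) * \<tau> i))"
  have inner: "norm (of_real (2 * pi) * F \<theta> - of_real Z * S0 * of_real (2 * sqrt (pi * t)) * of_real (exp (- (a / t ^ 3 * \<theta>\<^sup>2))))
     \<le> (4 * Z * D * sqrt t * sqrt (pi * t)) * exp (- (a / t ^ 3 / 4 * \<theta>\<^sup>2)) + 2 * pi * (Z * (C * t ^ 3))"
    if \<theta>: "\<bar>\<theta>\<bar> \<le> pi" for \<theta>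
  proof -
    define f where "f = (\<lambda>\<alpha>. cis (- (real N * \<theta>)) * (\<Sum>i\<in>I. of_real (exp (- (t * real (s i)))) * cis (\<theta> * real (s i)) * T i \<alpha>))"
    define e where "e = exp (- (a / t ^ 3 * \<theta>\<^sup>2))"
    define e4 where "e4 = exp (- (a / t ^ 3 / 4 * \<theta>\<^sup>2))"
    have g: "exp (- gauss_exp t \<theta> \<alpha>) = e * exp (- (1 / (4 * t) * \<alpha>\<^sup>2))"
      "exp (- gauss_exp t \<theta> \<alpha> / 4) = e4 * exp (- (1 / (4 * t) / 4 * \<alpha>\<^sup>2))" for \<alpha>
      unfolding e_def e4_def exp_add[symmetric] by (simp_all add: gauss_exp_def a_def field_simps)
    have "norm (integral {-pi..pi} f - (of_real Z * S0 * of_real e) * of_real (sqrt (pi / (1 / (4 * t)))))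
      \<le> 2 * (Z * D * sqrt t * e4) * sqrt (pi / (1 / (4 * t))) + 2 * pi * (Z * (C * t ^ 3))"
    proof (rule gauss_approximation)
      show "continuous_on {-pi..pi} f" unfolding f_def by (intro continuous_intros cont)
      show "0 < 1 / (4 * t)" "0 \<le> pi" "0 \<le> Z * D * sqrt t * e4" "0 \<le> Z * (C * t ^ 3)"
        using t Z C D by (auto simp: e4_def)
      show "norm (f \<alpha> - of_real Z * S0 * of_real e * of_real (exp (- (1 / (4 * t) * \<alpha>\<^sup>2))))
        \<le> Z * D * sqrt t * e4 * exp (- (1 / (4 * t) / 4 * \<alpha>\<^sup>2)) + Z * (C * t ^ 3)"
        if \<alpha>: "\<bar>\<alpha>\<bar> \<le> pi" "\<alpha> \<noteq> 0" for \<alpha>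
      proof -
        have "norm (f \<alpha> - of_real Z * S0 * of_real (e * exp (- (1 / (4 * t) * \<alpha>\<^sup>2))))
          \<le> Z * (C * sqrt t * (e4 * exp (- (1 / (4 * t) / 4 * \<alpha>\<^sup>2))) + C * t ^ 3)"
          using bd[OF \<theta> \<alpha>] unfolding g f_def .
        also have "\<dots> \<le> Z * (D * sqrt t * (e4 * exp (- (1 / (4 * t) / 4 * \<alpha>\<^sup>2))) + C * t ^ 3)"
          using D Z t by (intro mult_left_mono add_right_mono mult_right_mono) (auto simp: e4_def)
        finally show ?thesis by (simp add: algebra_simps)
      qed
      show "norm (of_real Z * S0 * of_real e) * exp (- (1 / (4 * t) * \<alpha>\<^sup>2))
        \<le> Z * D * sqrt t * e4 * exp (- (1 / (4 * t) / 4 * \<alpha>\<^sup>2))" if "pi < \<bar>\<alpha>\<bar>" for \<alpha>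
      proof -
        have "0 \<le> a / t ^ 3 * \<theta>\<^sup>2" using a t by simp
        moreover have "x / 4 \<le> x" if "0 \<le> x" for x :: real using that by simp
        ultimately have "(a / t ^ 3 * \<theta>\<^sup>2) / 4 \<le> a / t ^ 3 * \<theta>\<^sup>2" by blast
        moreover have "a / t ^ 3 / 4 * \<theta>\<^sup>2 = (a / t ^ 3 * \<theta>\<^sup>2) / 4" by simp
        ultimately have "e \<le> e4" unfolding e_def e4_def exp_le_cancel_iff by (simp only: neg_le_iff_le)
        then have "norm (of_real Z * S0 * of_real e) \<le> Z * D * e4"
          using Z D by (auto simp: norm_mult e_def intro!: mult_mono)
        then have "norm (of_real Z * S0 * of_real e) * exp (- (1 / (4 * t) * \<alpha>\<^sup>2))
          \<le> (Z * D * e4) * (sqrt t * exp (- (1 / (4 * t) / 4 * \<alpha>\<^sup>2)))"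
          using tail[OF order_refl that] Z D by (intro mult_mono) (auto simp: e4_def)
        then show ?thesis by (simp add: mult_ac)
      qed
    qed
    moreover have "integral {-pi..pi} f = of_real (2 * pi) * F \<theta>"
    proof -
      have "integral {-pi..pi} f = cis (- (real N * \<theta>)) * (\<Sum>i\<in>I. of_real (exp (- (t * real (s i)))) * cis (\<theta> * real (s i)) * integral {-pi..pi} (T i))"
        unfolding f_def
        by (subst integral_mult_right, subst integral_sum)
          (auto intro!: I integrable_continuous_interval continuous_intros cont)
      then show ?thesis unfolding \<tau> F_def by (simp add: sum_distrib_left mult_ac)
    qed
    moreover have "sqrt (pi / (1 / (4 * t))) = 2 * sqrt (pi * t)"
    proof -
      have "pi / (1 / (4 * t)) = 4 * (pi * t)" by simp
      then show ?thesis by (simp only: real_sqrt_mult real_sqrt_four)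
    qed
    ultimately show ?thesis unfolding e_def[symmetric] e4_def[symmetric] by (simp add: mult_ac)
  qed
  have est: "norm (integral {-pi..pi} (\<lambda>\<theta>. of_real (2 * pi) * F \<theta>) - (of_real Z * S0 * of_real (2 * sqrt (pi * t))) * of_real (sqrt (pi / (a / t ^ 3))))
     \<le> 2 * (4 * Z * D * sqrt t * sqrt (pi * t)) * sqrt (pi / (a / t ^ 3)) + 2 * pi * (2 * pi * (Z * (C * t ^ 3)))"
  proof (rule gauss_approximation)
    show "continuous_on {-pi..pi} (\<lambda>\<theta>. of_real (2 * pi) * F \<theta>)" unfolding F_def by (intro continuous_intros)
    show "0 < a / t ^ 3" "0 \<le> pi" "0 \<le> 4 * Z * D * sqrt t * sqrt (pi * t)" "0 \<le> 2 * pi * (Z * (C * t ^ 3))"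
      using a t Z D C by auto
    show "norm (of_real (2 * pi) * F \<theta> - of_real Z * S0 * of_real (2 * sqrt (pi * t)) * of_real (exp (- (a / t ^ 3 * \<theta>\<^sup>2))))
     \<le> 4 * Z * D * sqrt t * sqrt (pi * t) * exp (- (a / t ^ 3 / 4 * \<theta>\<^sup>2)) + 2 * pi * (Z * (C * t ^ 3))"
      if "\<bar>\<theta>\<bar> \<le> pi" for \<theta> by (rule inner[OF that])
    show "norm (of_real Z * S0 * of_real (2 * sqrt (pi * t))) * exp (- (a / t ^ 3 * \<theta>\<^sup>2))
        \<le> 4 * Z * D * sqrt t * sqrt (pi * t) * exp (- (a / t ^ 3 / 4 * \<theta>\<^sup>2))" if "pi < \<bar>\<theta>\<bar>" for \<theta>
    proof -
      have "1 / (4 * t) \<le> a / t ^ 3"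
      proof -
        have "t\<^sup>2 \<le> 1" using t by (intro power_le_one) auto
        then have "t\<^sup>2 \<le> a * 4" using a by linarith
        then show ?thesis using t by (simp add: field_simps power2_eq_square power3_eq_cube)
      qed
      then have tl: "exp (- (a / t ^ 3 * \<theta>\<^sup>2)) \<le> sqrt t * exp (- (a / t ^ 3 / 4 * \<theta>\<^sup>2))"
        by (rule tail[OF _ that])
      have "norm (of_real Z * S0 * of_real (2 * sqrt (pi * t))) \<le> Z * D * (4 * sqrt (pi * t))"
        using Z D t by (auto simp: norm_mult intro!: mult_mono)
      then have "norm (of_real Z * S0 * of_real (2 * sqrt (pi * t))) * exp (- (a / t ^ 3 * \<theta>\<^sup>2))
        \<le> (Z * D * (4 * sqrt (pi * t))) * (sqrt t * exp (- (a / t ^ 3 / 4 * \<theta>\<^sup>2)))"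
        using tl Z D t by (intro mult_mono) simp_all
      then show ?thesis by (simp add: mult_ac)
    qed
  qed
  have int: "integral {-pi..pi} (\<lambda>\<theta>. of_real (2 * pi) * F \<theta>) = of_real (4 * pi\<^sup>2 * exp (- (t * real N))) * (\<Sum>i\<in>{i\<in>I. s i = N}. \<tau> i)"
  proof -
    have F_eq: "F \<theta> = (\<Sum>i\<in>I. (of_real (exp (- (t * real (s i)))) * \<tau> i) * cis (of_int (int (s i) - int N) * \<theta>))" for \<theta>
    proof -
      have 1: "cis (- (real N * \<theta>)) * cis (\<theta> * real (s i)) = cis (of_int (int (s i) - int N) * \<theta>)" for i
        unfolding cis_mult by (simp add: algebra_simps)
      have 2: "c * (e * d * u) = (e * u) * (c * d)" for c d e u :: complex by (simp add: mult_ac)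
      show ?thesis unfolding F_def sum_distrib_left 2 1 ..
    qed
    have "integral {-pi..pi} (\<lambda>\<theta>. of_real (2 * pi) * F \<theta>) = of_real (2 * pi) *
       (\<Sum>i\<in>I. (of_real (exp (- (t * real (s i)))) * \<tau> i) * integral {-pi..pi} (\<lambda>\<theta>. cis (of_int (int (s i) - int N) * \<theta>)))"
      unfolding F_eq
      by (subst integral_mult_right, subst integral_sum)
        (auto intro!: I integrable_continuous_interval continuous_intros)
    also have "(\<Sum>i\<in>I. (of_real (exp (- (t * real (s i)))) * \<tau> i) * integral {-pi..pi} (\<lambda>\<theta>. cis (of_int (int (s i) - int N) * \<theta>)))
      = (\<Sum>i\<in>I. if s i = N then of_real (exp (- (t * real N))) * \<tau> i * of_real (2 * pi) else 0)"
      unfolding integral_cis by (intro sum.cong) auto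
    also have "\<dots> = (\<Sum>i\<in>{i\<in>I. s i = N}. of_real (exp (- (t * real N))) * \<tau> i * of_real (2 * pi))"
      by (rule sum.inter_filter[OF I, symmetric])
    finally show ?thesis by (simp add: sum_distrib_left sum_distrib_right power2_eq_square mult_ac)
  qed
  \<comment> \<open>With \<open>a = pi\<^sup>2 / 12\<close> all powers of \<open>pi\<close> cancel:
    the product of the roots is \<open>sqrt (12 * t ^ 4)\<close>.\<close>
  have root: "sqrt (pi * t) * sqrt (pi / (a / t ^ 3)) = 2 * sqrt 3 * t\<^sup>2"
  proof -
    have "pi * t * (pi / (a / t ^ 3)) = (2 * t\<^sup>2)\<^sup>2 * 3"
      using t by (simp add: a_def field_simps eval_nat_numeral)
    then have "sqrt (pi * t) * sqrt (pi / (a / t ^ 3)) = sqrt ((2 * t\<^sup>2)\<^sup>2 * 3)"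
      by (simp only: real_sqrt_mult[symmetric])
    also have "\<dots> = 2 * sqrt 3 * t\<^sup>2" using t by (simp only: real_sqrt_mult real_sqrt_abs) simp
    finally show ?thesis .
  qed
  have main: "(of_real Z * S0 * of_real (2 * sqrt (pi * t))) * of_real (sqrt (pi / (a / t ^ 3))) = of_real (Z * (4 * sqrt 3 * t\<^sup>2)) * S0"
  proof -
    have "(of_real Z * S0 * of_real (2 * sqrt (pi * t))) * of_real (sqrt (pi / (a / t ^ 3)))
      = of_real (Z * 2 * (sqrt (pi * t) * sqrt (pi / (a / t ^ 3)))) * S0" by (simp add: mult_ac)
    then show ?thesis unfolding root by (simp add: mult_ac)
  qed
  \<comment> \<open>The 200 covers 32 from the Gaussian part, by \<open>sqrt 3 \<le> 2\<close>, and
    64 from the flat part, by \<open>pi \<le> 4\<close>.\<close>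
  have err: "2 * (4 * Z * D * sqrt t * sqrt (pi * t)) * sqrt (pi / (a / t ^ 3)) + 2 * pi * (2 * pi * (Z * (C * t ^ 3)))
    \<le> Z * (200 * D * (t\<^sup>2 * sqrt t))"
  proof -
    have "2 * (4 * Z * D * sqrt t * sqrt (pi * t)) * sqrt (pi / (a / t ^ 3))
      = 8 * Z * D * sqrt t * (sqrt (pi * t) * sqrt (pi / (a / t ^ 3)))" by simp
    also have "\<dots> = 16 * sqrt 3 * (Z * D * (t\<^sup>2 * sqrt t))" unfolding root by simp
    also have "\<dots> \<le> 32 * (Z * D * (t\<^sup>2 * sqrt t))"
    proof (intro mult_right_mono)
      have "sqrt 3 \<le> sqrt 4" by (rule real_sqrt_le_mono) simp
      then show "16 * sqrt 3 \<le> 32" by simp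
    qed (use Z D t in auto)
    finally have 1: "2 * (4 * Z * D * sqrt t * sqrt (pi * t)) * sqrt (pi / (a / t ^ 3)) \<le> 32 * (Z * D * (t\<^sup>2 * sqrt t))" .
    have "t ^ 3 \<le> t\<^sup>2 * sqrt t"
    proof -
      have "sqrt t * sqrt t \<le> sqrt t * 1" using t by (intro mult_left_mono) auto
      then have "t \<le> sqrt t" using t by simp
      then have "t\<^sup>2 * t \<le> t\<^sup>2 * sqrt t" by (intro mult_left_mono) auto
      then show ?thesis by (simp add: power2_eq_square power3_eq_cube)
    qed
    then have "(4 * (pi * pi)) * (Z * (C * t ^ 3)) \<le> (4 * (4 * 4)) * (Z * (D * (t\<^sup>2 * sqrt t)))"
      using pi_less_4 Z C D t by (intro mult_mono) auto
    moreover have "(4 * (pi * pi)) * (Z * (C * t ^ 3)) = 2 * pi * (2 * pi * (Z * (C * t ^ 3)))"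
      "(4 * (4 * 4)) * (Z * (D * (t\<^sup>2 * sqrt t))) = 64 * (Z * D * (t\<^sup>2 * sqrt t))"
      "Z * (200 * D * (t\<^sup>2 * sqrt t)) = 200 * (Z * D * (t\<^sup>2 * sqrt t))" by (simp_all add: mult_ac)
    moreover have "0 \<le> Z * D * (t\<^sup>2 * sqrt t)" using Z D t by simp
    ultimately show ?thesis using 1 by linarith
  qed
  show ?thesis using order_trans[OF est err] unfolding int main D_def .
qed

section \<open>Fourier kernels\<close>

definition excess :: "nat set \<Rightarrow> int" where
  "excess S = (\<Sum>p\<in>S. if odd p then 1 else - 1)"

text \<open>Multiplying out, the factors that contribute their exponential form a set
  \<open>S\<close> of distinct parts. Each part turns \<alpha> by its parity sign only, so \<alpha>
  sees nothing but the excess.\<close>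

lemma Phi_expand:
  assumes "finite A"
  shows "Phi A t \<theta> \<alpha> = (\<Sum>S\<in>Pow A. of_real (exp (- (t * real (\<Sum>S)))) * cis (\<theta> * real (\<Sum>S)) * cis (of_int (excess S) * \<alpha>))"
proof -
  have "Phi A t \<theta> \<alpha> = (\<Sum>S\<in>Pow A. (\<Prod>p\<in>S. exp (- wpt t \<theta> \<alpha> p)) * (\<Prod>p\<in>A - S. 1))"
    unfolding Phi_def add.commute[of 1] by (rule prod_add[OF assms])
  also have "\<dots> = (\<Sum>S\<in>Pow A. of_real (exp (- (t * real (\<Sum>S)))) * cis (\<theta> * real (\<Sum>S)) * cis (of_int (excess S) * \<alpha>))"
  proof (rule sum.cong)
    fix S assume "S \<in> Pow A"
    then have S: "finite S" using assms finite_subset by auto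
    have "(\<Prod>p\<in>S. exp (- wpt t \<theta> \<alpha> p)) = exp (\<Sum>p\<in>S. - wpt t \<theta> \<alpha> p)" using S by (simp add: exp_sum)
    also have "(\<Sum>p\<in>S. - wpt t \<theta> \<alpha> p) = Complex (- (t * real (\<Sum>S))) (\<theta> * real (\<Sum>S) + of_int (excess S) * \<alpha>)"
    proof -
      have "of_int (excess S) = (\<Sum>p\<in>S. parity_sign p)"
        unfolding excess_def of_int_sum by (intro sum.cong) (auto simp: parity_sign_def)
      moreover have "Re (\<Sum>p\<in>S. - wpt t \<theta> \<alpha> p) = - (t * real (\<Sum>S))"
        by (simp add: wpt_def sum_negf sum_distrib_left)
      moreover have "Im (\<Sum>p\<in>S. - wpt t \<theta> \<alpha> p) = \<theta> * real (\<Sum>S) + (\<Sum>p\<in>S. parity_sign p) * \<alpha>"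
        by (simp only: wpt_def Im_sum uminus_complex.sel complex.sel minus_minus sum.distrib
            sum_distrib_left sum_distrib_right of_nat_sum)
      ultimately show ?thesis by (simp only: complex_eq_iff complex.sel)
    qed
    also have "exp \<dots> = of_real (exp (- (t * real (\<Sum>S)))) * cis (\<theta> * real (\<Sum>S)) * cis (of_int (excess S) * \<alpha>)"
      by (simp add: exp_eq_polar mult.assoc cis_mult)
    finally show "(\<Prod>p\<in>S. exp (- wpt t \<theta> \<alpha> p)) * (\<Prod>p\<in>A - S. 1)
      = of_real (exp (- (t * real (\<Sum>S)))) * cis (\<theta> * real (\<Sum>S)) * cis (of_int (excess S) * \<alpha>)" by simp
  qed simp
  finally show ?thesis .
qed

text \<open>Fourier analysis of the sign: \<open>sgn d\<close> is the mean over a period of \<open>sin (d\<alpha>) cot (\<alpha>/2)\<close>, which is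
  this trigonometric polynomial.\<close>

definition sgn_kernel :: "int \<Rightarrow> real \<Rightarrow> complex" where
  "sgn_kernel d \<alpha> = of_int (sgn d) * (\<Sum>j<nat \<bar>d\<bar>.
     (cis (of_int (int j) * \<alpha>) + cis (of_int (- int j) * \<alpha>)
      + (cis (of_int (int (Suc j)) * \<alpha>) + cis (of_int (- int (Suc j)) * \<alpha>))) / 2)"

lemma continuous_on_sgn_kernel: "continuous_on S (sgn_kernel d)"
  unfolding sgn_kernel_def[abs_def] by (intro continuous_intros) auto

text \<open>Only the frequency 0 survives. It occurs for \<open>j = 0\<close> alone, and twice,
  which the division by 2 undoes.\<close>

lemma integral_sgn_kernel: "integral {-pi..pi} (sgn_kernel d) = of_real (2 * pi) * of_int (sgn d)"
proof -
  have i: "(\<lambda>\<alpha>. cis (of_int m * \<alpha>)) integrable_on {-pi..pi}" for m :: int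
    by (intro integrable_continuous_interval continuous_intros)
  have c: "((\<lambda>\<alpha>. cis (of_int m * \<alpha>)) has_integral (if m = 0 then of_real (2 * pi) else 0)) {-pi..pi}" for m :: int
    using integrable_integral[OF i[of m]] unfolding integral_cis .
  have "(sgn_kernel d has_integral of_int (sgn d) * (\<Sum>j<nat \<bar>d\<bar>.
     ((if int j = 0 then of_real (2 * pi) else 0) + (if - int j = 0 then of_real (2 * pi) else 0)
      + ((if int (Suc j) = 0 then of_real (2 * pi) else 0) + (if - int (Suc j) = 0 then of_real (2 * pi) else 0))) / 2)) {-pi..pi}"
    unfolding sgn_kernel_def[abs_def]
    by (intro has_integral_mult_right has_integral_sum has_integral_divide has_integral_add c) auto
  moreover have "(\<Sum>j<nat \<bar>d\<bar>.
     ((if int j = 0 then of_real (2 * pi) else 0) + (if - int j = 0 then of_real (2 * pi) else 0)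
      + ((if int (Suc j) = 0 then of_real (2 * pi) else 0) + (if - int (Suc j) = 0 then of_real (2 * pi) else 0))) / 2)
     = (\<Sum>j<nat \<bar>d\<bar>. if j = 0 then of_real (2 * pi) else (0 :: complex))"
    by (intro sum.cong) auto
  moreover have "\<dots> = (if d = 0 then 0 else of_real (2 * pi))" by (auto simp: sum.delta)
  ultimately show ?thesis by (auto simp: integral_unique)
qed

text \<open>The sum telescopes by \<open>(cos x + cos (x + \<alpha>)) * sin (\<alpha> / 2) = (sin (x
  + \<alpha>) - sin x) * cos (\<alpha> / 2)\<close>. The form without division is valid at the pole
  of the cotangent too.\<close>

lemma sgn_kernel_sin: "sgn_kernel d \<alpha> * of_real (sin (\<alpha> / 2)) = of_real (sin (of_int d * \<alpha>) * cos (\<alpha> / 2))"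
proof -
  have cc: "cis (of_int k * \<alpha>) + cis (of_int (- k) * \<alpha>) = of_real (2 * cos (of_int k * \<alpha>))" for k :: int
    by (simp add: complex_eq_iff)
  have step: "(cos x + cos (x + \<alpha>)) * sin (\<alpha> / 2) = (sin (x + \<alpha>) - sin x) * cos (\<alpha> / 2)" for x
  proof -
    define h where "h = \<alpha> / 2"
    have "\<alpha> = h + h" by (simp add: h_def)
    then show ?thesis
      unfolding h_def[symmetric] using sin_cos_squared_add[of h]
      by (simp only: sin_add cos_add) algebra
  qed
  have "(\<Sum>j<m. cos (of_int (int j) * \<alpha>) + cos (of_int (int (Suc j)) * \<alpha>)) * sin (\<alpha> / 2) = sin (real m * \<alpha>) * cos (\<alpha> / 2)" for m
  proof (induction m)
    case (Suc m)
    show ?case using Suc step[of "real m * \<alpha>"] by (simp add: algebra_simps)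
  qed simp
  from this[of "nat \<bar>d\<bar>"]
  have eq: "of_int (sgn d) * ((\<Sum>j<nat \<bar>d\<bar>. cos (of_int (int j) * \<alpha>) + cos (of_int (int (Suc j)) * \<alpha>)) * sin (\<alpha> / 2))
    = of_int (sgn d) * sin (real (nat \<bar>d\<bar>) * \<alpha>) * cos (\<alpha> / 2)" by simp
  have "of_int (sgn d) * sin (real (nat \<bar>d\<bar>) * \<alpha>) = sin (of_int d * \<alpha>)"
    by (auto simp: sgn_if)
  note eq[unfolded this]
  moreover have "sgn_kernel d \<alpha> = of_real (of_int (sgn d) * (\<Sum>j<nat \<bar>d\<bar>. cos (of_int (int j) * \<alpha>) + cos (of_int (int (Suc j)) * \<alpha>)))"
    unfolding sgn_kernel_def cc by (simp add: add_divide_distrib)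
  ultimately show ?thesis by (simp only: of_real_mult[symmetric] mult.assoc)
qed

text \<open>\<open>sin (d * \<alpha>)\<close> is a difference of the two exponentials by which
  \<open>Phi\<close> expands at \<alpha> and at \<open>- \<alpha>\<close>, and the cotangent does
  not depend on the subset.\<close>

lemma sum_sgn_kernel:
  assumes "finite A" "sin (\<alpha> / 2) \<noteq> 0"
  shows "(\<Sum>S\<in>Pow A. of_real (exp (- (t * real (\<Sum>S)))) * cis (\<theta> * real (\<Sum>S)) * sgn_kernel (excess S) \<alpha>)
    = (Phi A t \<theta> \<alpha> - Phi A t \<theta> (- \<alpha>)) / (2 * \<i>) * of_real (cos (\<alpha> / 2) / sin (\<alpha> / 2))"
proof -
  have ker: "sgn_kernel d \<alpha> = (cis (of_int d * \<alpha>) - cis (of_int d * - \<alpha>)) / (2 * \<i>) * of_real (cos (\<alpha> / 2) / sin (\<alpha> / 2))" for d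
  proof -
    have "(cis (of_int d * \<alpha>) - cis (of_int d * - \<alpha>)) / (2 * \<i>) = of_real (sin (of_int d * \<alpha>))"
      by (simp add: complex_eq_iff Re_divide Im_divide power2_eq_square)
    moreover have "sgn_kernel d \<alpha> = sgn_kernel d \<alpha> * of_real (sin (\<alpha> / 2)) / of_real (sin (\<alpha> / 2))"
      using assms by simp
    ultimately show ?thesis unfolding sgn_kernel_sin by simp
  qed
  show ?thesis
    unfolding Phi_expand[OF assms(1)] sum_subtractf[symmetric] sum_divide_distrib sum_distrib_right
  proof (intro sum.cong refl)
    have alg: "a * ((u - v) / z * k) = (a * u - a * v) / z * k" for a u v z k :: complex
      by (simp flip: right_diff_distrib)
    fix S
    show "of_real (exp (- (t * real (\<Sum>S)))) * cis (\<theta> * real (\<Sum>S)) * sgn_kernel (excess S) \<alpha>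
      = (of_real (exp (- (t * real (\<Sum>S)))) * cis (\<theta> * real (\<Sum>S)) * cis (of_int (excess S) * \<alpha>)
         - of_real (exp (- (t * real (\<Sum>S)))) * cis (\<theta> * real (\<Sum>S)) * cis (of_int (excess S) * - \<alpha>))
        / (2 * \<i>) * of_real (cos (\<alpha> / 2) / sin (\<alpha> / 2))"
      unfolding ker by (rule alg)
  qed
qed

section \<open>Cancelling the pole of the cotangent\<close>

lemma abs_cot_half_le:
  assumes "\<bar>\<alpha>\<bar> \<le> pi" "\<alpha> \<noteq> 0"
  shows "sin (\<alpha> / 2) \<noteq> 0" "\<bar>cos (\<alpha> / 2) / sin (\<alpha> / 2)\<bar> \<le> 6 / \<bar>\<alpha>\<bar>"
proof -
  have s: "\<bar>\<alpha>\<bar> / 6 \<le> \<bar>sin (\<alpha> / 2)\<bar>" using abs_sin_ge[of "\<alpha> / 2"] assms by simp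
  then show "sin (\<alpha> / 2) \<noteq> 0" using assms by auto
  have "\<bar>cos (\<alpha> / 2)\<bar> / \<bar>sin (\<alpha> / 2)\<bar> \<le> 1 / (\<bar>\<alpha>\<bar> / 6)"
    using s assms by (intro frac_le) auto
  then show "\<bar>cos (\<alpha> / 2) / sin (\<alpha> / 2)\<bar> \<le> 6 / \<bar>\<alpha>\<bar>" by (simp add: abs_divide)
qed

text \<open>\<open>x * cos x - sin x\<close> is cubic in \<open>x = \<alpha> / 2\<close>, while
  \<open>\<bar>sin x\<bar>\<close> is at least \<open>\<bar>x\<bar> / 3\<close>. The defect is thus
  quadratic; a linear bound matches the other errors.\<close>

lemma cot_half_approx:
  fixes \<alpha> :: real
  assumes "\<bar>\<alpha>\<bar> \<le> 1" "\<alpha> \<noteq> 0"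
  shows "\<bar>\<alpha> / 4 * (cos (\<alpha> / 2) / sin (\<alpha> / 2)) - 1 / 2\<bar> \<le> \<bar>\<alpha>\<bar>"
proof -
  define x where "x = \<alpha> / 2"
  have x: "\<bar>x\<bar> \<le> 1 / 2" "x \<noteq> 0" using assms by (auto simp: x_def)
  have s: "\<bar>x\<bar> / 3 \<le> \<bar>sin x\<bar>" using x pi_gt3 by (intro abs_sin_ge) auto
  then have s0: "sin x \<noteq> 0" using x by auto
  have "\<bar>sin x - x\<bar> \<le> \<bar>x\<bar> ^ 3 / 6"
    using Maclaurin_sin_bound[of x 3] by (simp add: sin_coeff_def eval_nat_numeral)
  moreover have "\<bar>x * (cos x - 1)\<bar> \<le> \<bar>x\<bar> ^ 3 / 2"
  proof -
    have "\<bar>x\<bar> * \<bar>cos x - 1\<bar> \<le> \<bar>x\<bar> * (x\<^sup>2 / 2)"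
      using one_minus_cos_le[of x] by (intro mult_left_mono) auto
    then show ?thesis by (simp add: abs_mult power3_eq_cube power2_eq_square)
  qed
  ultimately have "\<bar>x * (cos x - 1) + (x - sin x)\<bar> \<le> \<bar>x\<bar> ^ 3"
    using abs_triangle_ineq[of "x * (cos x - 1)" "x - sin x"] zero_le_power[of "\<bar>x\<bar>" 3] by linarith
  then have n: "\<bar>x * cos x - sin x\<bar> \<le> \<bar>x\<bar> ^ 3" by (simp add: algebra_simps)
  have "\<bar>(x * cos x - sin x) / sin x\<bar> \<le> \<bar>x\<bar> ^ 3 / (\<bar>x\<bar> / 3)"
    unfolding abs_divide using n s x by (intro frac_le) auto
  also have "\<dots> = 3 * (\<bar>x\<bar> * \<bar>x\<bar>)" using x by (simp add: power3_eq_cube)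
  also have "\<dots> \<le> 3 * (\<bar>x\<bar> * (1 / 2))" using x by (intro mult_left_mono) auto
  also have "(x * cos x - sin x) / sin x = x * (cos x / sin x) - 1" using s0 by (simp add: diff_divide_distrib)
  finally have "\<bar>x * (cos x / sin x) - 1\<bar> \<le> 3 / 2 * \<bar>x\<bar>" by (simp add: mult.commute)
  moreover have "\<alpha> / 4 * (cos x / sin x) - 1 / 2 = (x * (cos x / sin x) - 1) / 2" by (simp add: x_def diff_divide_distrib)
  then have "\<bar>\<alpha> / 4 * (cos x / sin x) - 1 / 2\<bar> = \<bar>x * (cos x / sin x) - 1\<bar> / 2" by (simp only: abs_divide abs_numeral)
  ultimately have "\<bar>\<alpha> / 4 * (cos x / sin x) - 1 / 2\<bar> \<le> (3 / 2 * \<bar>x\<bar>) / 2"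
    by (simp only: divide_right_mono zero_le_numeral)
  also have "\<dots> \<le> \<bar>\<alpha>\<bar>" by (simp add: x_def)
  finally show ?thesis unfolding x_def .
qed

text \<open>For far \<theta> and small \<alpha> the pole has to be cancelled as well, so the
  difference must gain a factor \<open>\<bar>\<alpha>\<bar>\<close>. Along the segment from \<alpha>
  to \<open>- \<alpha>\<close> the logarithmic derivative is at most \<open>2 / t\<^sup>2\<close>:
  each factor has modulus at least \<open>t / 2\<close>, and the weights sum to at most
  \<open>1 / t\<close>.\<close>

lemma Phi_diff_le:
  fixes K N :: nat
  assumes t: "0 < t" "t \<le> 1" and P: "\<And>\<beta>. \<bar>\<beta>\<bar> \<le> \<bar>\<alpha>\<bar> \<Longrightarrow> norm (Phi {K<..N} t \<theta> \<beta>) \<le> P"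
  shows "norm (Phi {K<..N} t \<theta> \<alpha> - Phi {K<..N} t \<theta> (- \<alpha>)) \<le> 4 / t\<^sup>2 * P * \<bar>\<alpha>\<bar>"
proof -
  \<comment> \<open>The angle becomes a complex variable \<open>z\<close>, so that the mean value
    bound for complex derivatives applies on the segment.\<close>
  define e where "e = (\<lambda>p z. exp (- of_real (t * real p) + \<i> * of_real (\<theta> * real p) + \<i> * of_real (parity_sign p) * z) :: complex)"
  define G where "G = (\<lambda>z. \<Prod>p\<in>{K<..N}. 1 + e p z)"
  have e_real: "e p (of_real \<beta>) = exp (- wpt t \<theta> \<beta> p)" for p \<beta>
    unfolding e_def by (rule arg_cong[of _ _ exp]) (simp add: complex_eq_iff wpt_def)
  have G_real: "G (of_real \<beta>) = Phi {K<..N} t \<theta> \<beta>" for \<beta> by (simp add: G_def Phi_def e_real)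
  have ne: "norm (e p (of_real \<beta>)) = exp (- (t * real p))" for p \<beta> by (simp add: e_real wpt_def)
  have P0: "0 \<le> P" by (rule order_trans[OF norm_ge_zero P[of 0]]) simp
  have den: "t / 2 \<le> norm (1 + e p (of_real \<beta>))" if "p \<in> {K<..N}" for p \<beta>
  proof -
    have "1 * t \<le> real p * t" using that t by (intro mult_right_mono) auto
    then have "exp (- (t * real p)) \<le> exp (- t)" by (simp add: mult.commute)
    also have "\<dots> \<le> 1 - t / 2"
    proof -
      have "1 \<le> (1 - t / 2) * (1 + t)" using t by (simp add: algebra_simps power2_eq_square)
      also have "\<dots> \<le> (1 - t / 2) * exp t" using t exp_ge_add_one_self[of t] by (intro mult_left_mono) auto
      finally show ?thesis by (simp add: exp_minus field_simps)
    qed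
    finally show ?thesis using norm_triangle_ineq4[of "1 + e p (of_real \<beta>)" "e p (of_real \<beta>)"] ne[of p \<beta>] by simp
  qed
  have "norm (G (of_real \<alpha>) - G (of_real (- \<alpha>))) \<le> (P * (2 / t\<^sup>2)) * norm (of_real \<alpha> - of_real (- \<alpha>) :: complex)"
  proof (rule field_differentiable_bound[where S = "closed_segment (of_real \<alpha>) (of_real (- \<alpha>))"
        and f' = "\<lambda>z. G z * (\<Sum>p\<in>{K<..N}. (\<i> * of_real (parity_sign p) * e p z) / (1 + e p z))"])
    fix z :: complex assume "z \<in> closed_segment (of_real \<alpha>) (of_real (- \<alpha>))"
    then obtain u where u: "0 \<le> u" "u \<le> 1" "z = (1 - u) *\<^sub>R of_real \<alpha> + u *\<^sub>R of_real (- \<alpha>)"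
      by (auto simp: closed_segment_def)
    define \<beta> where "\<beta> = (1 - 2 * u) * \<alpha>"
    have z: "z = of_real \<beta>" unfolding u(3) \<beta>_def by (simp add: scaleR_conv_of_real algebra_simps)
    have \<beta>: "\<bar>\<beta>\<bar> \<le> \<bar>\<alpha>\<bar>" using u by (auto simp: \<beta>_def abs_mult intro: mult_left_le_one_le)
    have "(G has_field_derivative G z * (\<Sum>p\<in>{K<..N}. (\<i> * of_real (parity_sign p) * e p z) / (1 + e p z))) (at z)"
      unfolding G_def
    proof (rule has_field_derivative_prod')
      show "1 + e p z \<noteq> 0" if "p \<in> {K<..N}" for p using den[OF that, of \<beta>] t unfolding z by auto
      show "((\<lambda>z. 1 + e p z) has_field_derivative \<i> * of_real (parity_sign p) * e p z) (at z)" for p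
        unfolding e_def by (auto intro!: derivative_eq_intros)
    qed
    then show "(G has_field_derivative G z * (\<Sum>p\<in>{K<..N}. (\<i> * of_real (parity_sign p) * e p z) / (1 + e p z)))
        (at z within closed_segment (of_real \<alpha>) (of_real (- \<alpha>)))" by (rule has_field_derivative_at_within)
    have "norm (\<Sum>p\<in>{K<..N}. (\<i> * of_real (parity_sign p) * e p z) / (1 + e p z)) \<le> (\<Sum>p\<in>{K<..N}. 2 / t * exp (- (t * real p)))"
    proof (rule sum_norm_le)
      fix p assume p: "p \<in> {K<..N}"
      have "norm ((\<i> * of_real (parity_sign p) * e p z) / (1 + e p z)) = exp (- (t * real p)) / norm (1 + e p z)"
        unfolding norm_divide norm_mult z ne by (simp add: parity_sign_def)
      also have "\<dots> \<le> exp (- (t * real p)) / (t / 2)"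
        using den[OF p, of \<beta>] t unfolding z by (intro divide_left_mono) (auto intro!: mult_pos_pos)
      finally show "norm ((\<i> * of_real (parity_sign p) * e p z) / (1 + e p z)) \<le> 2 / t * exp (- (t * real p))" by (simp add: mult.commute)
    qed
    also have "\<dots> = 2 / t * (\<Sum>p\<in>{K<..N}. exp (- (t * real p)))" by (simp add: sum_distrib_left)
    also have "\<dots> \<le> 2 / t * (1 / t)" using t by (intro mult_left_mono sum_subset_exp_le) auto
    finally have "norm (\<Sum>p\<in>{K<..N}. (\<i> * of_real (parity_sign p) * e p z) / (1 + e p z)) \<le> 2 / t\<^sup>2"
      by (simp add: power2_eq_square)
    then show "norm (G z * (\<Sum>p\<in>{K<..N}. (\<i> * of_real (parity_sign p) * e p z) / (1 + e p z))) \<le> P * (2 / t\<^sup>2)"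
      unfolding norm_mult using P[OF \<beta>] P0 unfolding z G_real by (intro mult_mono) auto
  qed auto
  moreover have "norm (of_real \<alpha> - of_real (- \<alpha>) :: complex) = 2 * \<bar>\<alpha>\<bar>"
    by (simp flip: of_real_add)
  ultimately show ?thesis unfolding G_real by (simp add: mult_ac)
qed

text \<open>\<open>\<Psi>\<close> is the integrand for either kernel. On the minor arc it and the
  Gaussian are treated as separate errors of order \<open>t ^ 3\<close>. The allowance
  \<open>1 / t\<^sup>2\<close> there is the price of the cotangent; the power 5 behind
  \<open>fact 5 = 120\<close> pays for it and for \<open>t ^ 3\<close> together.\<close>

lemma arc_bounds_combine:
  fixes K N :: nat and S0 :: complex
  assumes t: "0 < t" "t \<le> 1" and N: "real N * t\<^sup>2 = pi\<^sup>2 / 12" and KN: "K \<le> N" and D: "0 \<le> D" and M: "0 \<le> M" and c: "0 < c"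
    and major: "10000 * \<bar>\<theta>\<bar> \<le> t \<Longrightarrow> 10000 * \<bar>\<alpha>\<bar> \<le> 1 \<Longrightarrow> \<exists>S. norm (S - S0) \<le> D * (t + \<bar>\<alpha>\<bar>) \<and>
       \<Psi> = exp (- \<i> * of_real (real N * \<theta>)) * exp ((log_Phi {K<..N} t \<theta> \<alpha> + log_Phi {K<..N} t \<theta> (- \<alpha>)) / 2) * S"
    and minor: "t \<le> 10000 * \<bar>\<theta>\<bar> \<or> 1 \<le> 10000 * \<bar>\<alpha>\<bar> \<Longrightarrow> norm \<Psi> \<le> Zt {K<..N} t * (M * exp (- (c / t)) / t\<^sup>2)"
  defines "R \<equiv> 132 + 12 * real K"
  defines "C \<equiv> 600 * ((R + 3072) * exp (2 * R) * (norm S0 + 2 * D) + D) + 120 * M / c ^ 5 + 6 * (4 * 10 ^ 8) ^ 3 * norm S0"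
  shows "norm (\<Psi> - of_real (Zt {K<..N} t) * S0 * of_real (exp (- gauss_exp t \<theta> \<alpha>)))
    \<le> Zt {K<..N} t * (C * sqrt t * exp (- gauss_exp t \<theta> \<alpha> / 4) + C * t ^ 3)"
proof -
  define Z where "Z = Zt {K<..N} t"
  have Z: "0 < Z" by (simp add: Z_def Zt_pos)
  define C1 where "C1 = 600 * ((R + 3072) * exp (2 * R) * (norm S0 + 2 * D) + D)"
  have C1: "0 \<le> C1" using D by (simp add: C1_def R_def)
  have C2: "0 \<le> 120 * M / c ^ 5 + 6 * (4 * 10 ^ 8) ^ 3 * norm S0" using M c by simp
  have C: "C1 \<le> C" "120 * M / c ^ 5 + 6 * (4 * 10 ^ 8) ^ 3 * norm S0 \<le> C" "0 \<le> C"
    using C1 C2 unfolding C_def C1_def[symmetric] by linarith+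
  show ?thesis
  proof (cases "10000 * \<bar>\<theta>\<bar> \<le> t \<and> 10000 * \<bar>\<alpha>\<bar> \<le> 1")
    case True
    then obtain S where S: "norm (S - S0) \<le> D * (t + \<bar>\<alpha>\<bar>)"
       "\<Psi> = exp (- \<i> * of_real (real N * \<theta>)) * exp ((log_Phi {K<..N} t \<theta> \<alpha> + log_Phi {K<..N} t \<theta> (- \<alpha>)) / 2) * S"
      using major by blast
    have "norm (\<Psi> - of_real Z * S0 * of_real (exp (- gauss_exp t \<theta> \<alpha>))) \<le> Z * (C1 * sqrt t * exp (- gauss_exp t \<theta> \<alpha> / 4))"
      unfolding S(2) Z_def C1_def R_def
      by (rule major_arc_le[OF t _ _ N KN S(1) D]) (use True in auto)
    also have "\<dots> \<le> Z * (C * sqrt t * exp (- gauss_exp t \<theta> \<alpha> / 4) + C * t ^ 3)"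
    proof (intro mult_left_mono)
      have "C1 * sqrt t * exp (- gauss_exp t \<theta> \<alpha> / 4) \<le> C * sqrt t * exp (- gauss_exp t \<theta> \<alpha> / 4)"
        using C t by (intro mult_right_mono) auto
      moreover have "0 \<le> C * t ^ 3" using C t by simp
      ultimately show "C1 * sqrt t * exp (- gauss_exp t \<theta> \<alpha> / 4) \<le> C * sqrt t * exp (- gauss_exp t \<theta> \<alpha> / 4) + C * t ^ 3" by linarith
    qed (use Z in auto)
    finally show ?thesis unfolding Z_def .
  next
    case False
    then have far: "t \<le> 10000 * \<bar>\<theta>\<bar> \<or> 1 \<le> 10000 * \<bar>\<alpha>\<bar>" by auto
    \<comment> \<open>Off the major arc \<theta> is at least \<open>t / 10 ^ 4\<close> or \<alpha>
      at least \<open>1 / 10 ^ 4\<close> in absolute value; squaring gives \<open>10 ^ 8\<close>,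
      and 1/4 is a lower bound for the coefficients in both halves of
      \<open>gauss_exp\<close>.\<close>
    have "1 / (4 * 10 ^ 8) / t \<le> gauss_exp t \<theta> \<alpha>"
      using far
    proof
      assume "t \<le> 10000 * \<bar>\<theta>\<bar>"
      then have "t\<^sup>2 \<le> (10000 * \<bar>\<theta>\<bar>)\<^sup>2" using t by (intro power_mono) auto
      then have th: "t\<^sup>2 / 10 ^ 8 \<le> \<theta>\<^sup>2" by (simp add: power_mult_distrib)
      have "3 / 4 \<le> pi\<^sup>2 / 12" using pi_gt3 mult_mono[of 3 pi 3 pi] by (simp add: power2_eq_square)
      then have "1 / 4 * (t\<^sup>2 / 10 ^ 8 / t ^ 3) \<le> pi\<^sup>2 / 12 * (\<theta>\<^sup>2 / t ^ 3)"
        using th t by (intro mult_mono divide_right_mono) auto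
      moreover have "1 / 4 * (t\<^sup>2 / 10 ^ 8 / t ^ 3) = 1 / (4 * 10 ^ 8) / t"
        using t by (simp add: power2_eq_square power3_eq_cube)
      moreover have "0 \<le> \<alpha>\<^sup>2 / (4 * t)" using t by simp
      ultimately show ?thesis unfolding gauss_exp_def by linarith
    next
      assume "1 \<le> 10000 * \<bar>\<alpha>\<bar>"
      then have "1\<^sup>2 \<le> (10000 * \<bar>\<alpha>\<bar>)\<^sup>2" by (intro power_mono) auto
      then have "1 / 10 ^ 8 \<le> \<alpha>\<^sup>2" by (simp add: power_mult_distrib)
      then have "1 / 10 ^ 8 / (4 * t) \<le> \<alpha>\<^sup>2 / (4 * t)" using t by (intro divide_right_mono) auto
      moreover have "0 \<le> pi\<^sup>2 / 12 * (\<theta>\<^sup>2 / t ^ 3)" using t by simp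
      ultimately show ?thesis unfolding gauss_exp_def by simp
    qed
    then have "exp (- gauss_exp t \<theta> \<alpha>) \<le> exp (- (1 / (4 * 10 ^ 8) / t))" by simp
    also have "\<dots> \<le> fact 3 / (1 / (4 * 10 ^ 8) / t) ^ 3" using t by (intro exp_neg_le) auto
    also have "\<dots> = 6 * (4 * 10 ^ 8) ^ 3 * t ^ 3" using t by (simp add: eval_nat_numeral)
    finally have "exp (- gauss_exp t \<theta> \<alpha>) * norm S0 \<le> 6 * (4 * 10 ^ 8) ^ 3 * t ^ 3 * norm S0"
      by (rule mult_right_mono) simp
    moreover have "M * exp (- (c / t)) / t\<^sup>2 \<le> 120 * M / c ^ 5 * t ^ 3"
    proof -
      have "exp (- (c / t)) \<le> fact 5 / (c / t) ^ 5" using c t by (intro exp_neg_le) auto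
      then have "M * exp (- (c / t)) / t\<^sup>2 \<le> M * (fact 5 / (c / t) ^ 5) / t\<^sup>2"
        using M by (intro divide_right_mono mult_left_mono) auto
      also have "\<dots> = 120 * M / c ^ 5 * t ^ 3" using t c by (simp add: fact_numeral power_divide eval_nat_numeral)
      finally show ?thesis .
    qed
    ultimately have "M * exp (- (c / t)) / t\<^sup>2 + exp (- gauss_exp t \<theta> \<alpha>) * norm S0
       \<le> (120 * M / c ^ 5 + 6 * (4 * 10 ^ 8) ^ 3 * norm S0) * t ^ 3" by (simp add: algebra_simps)
    also have "\<dots> \<le> C * t ^ 3" using C t by (intro mult_right_mono) auto
    also have "\<dots> \<le> C * sqrt t * exp (- gauss_exp t \<theta> \<alpha> / 4) + C * t ^ 3" using C t by simp
    finally have "Z * (M * exp (- (c / t)) / t\<^sup>2 + exp (- gauss_exp t \<theta> \<alpha>) * norm S0)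
       \<le> Z * (C * sqrt t * exp (- gauss_exp t \<theta> \<alpha> / 4) + C * t ^ 3)" using Z by (intro mult_left_mono) auto
    moreover have "norm (\<Psi> - of_real Z * S0 * of_real (exp (- gauss_exp t \<theta> \<alpha>))) \<le> norm \<Psi> + Z * norm S0 * exp (- gauss_exp t \<theta> \<alpha>)"
      by (rule order_trans[OF norm_triangle_ineq4]) (use Z in \<open>simp add: norm_mult\<close>)
    ultimately show ?thesis using minor[OF far] unfolding Z_def[symmetric] by (simp add: algebra_simps)
  qed
qed

text \<open>\<open>e\<close> and \<open>z\<close> are the even and odd parts of
  \<open>log_Phi\<close> in \<alpha>: the Gaussian factor \<open>exp e\<close> is shared by both
  signs of \<alpha>, and only \<open>z\<close> changes sign. The factor 3 absorbs
  \<open>t + \<bar>\<alpha>\<bar> \<le> 2\<close> and the leading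
  \<open>\<bar>\<alpha>\<bar> / 4\<close>.\<close>

lemma log_Phi_odd_bounds:
  fixes K N :: nat
  assumes t: "0 < t" "t \<le> 1" "10000 * \<bar>\<theta>\<bar> \<le> t" "10000 * \<bar>\<alpha>\<bar> \<le> 1" and N: "1 / 2 \<le> real N * t\<^sup>2" and KN: "K \<le> N"
  defines "e \<equiv> (log_Phi {K<..N} t \<theta> \<alpha> + log_Phi {K<..N} t \<theta> (- \<alpha>)) / 2"
  defines "z \<equiv> (log_Phi {K<..N} t \<theta> \<alpha> - log_Phi {K<..N} t \<theta> (- \<alpha>)) / 2"
  shows "Phi {K<..N} t \<theta> \<alpha> = exp e * exp z" "Phi {K<..N} t \<theta> (- \<alpha>) = exp e * exp (- z)"
    and "norm (z - (-1) ^ K * \<i> * of_real \<alpha> / 4) \<le> (26 + 4 * real K) * \<bar>\<alpha>\<bar> * (t + \<bar>\<alpha>\<bar>)"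
    and "norm z \<le> 3 * (26 + 4 * real K) * \<bar>\<alpha>\<bar>"
proof -
  have small: "4 * \<bar>\<theta>\<bar> \<le> t" "4 * \<bar>\<alpha>\<bar> \<le> 1" "4 * \<bar>- \<alpha>\<bar> \<le> 1" using t by auto
  have "log_Phi {K<..N} t \<theta> \<alpha> = e + z" "log_Phi {K<..N} t \<theta> (- \<alpha>) = e + - z"
    by (simp_all add: e_def z_def field_simps)
  then show "Phi {K<..N} t \<theta> \<alpha> = exp e * exp z" "Phi {K<..N} t \<theta> (- \<alpha>) = exp e * exp (- z)"
    using Phi_eq_exp[OF t(1) small(1,2), of "{K<..N}"] Phi_eq_exp[OF t(1) small(1,3), of "{K<..N}"]
    by (simp_all only: exp_add)
  show le: "norm (z - (-1) ^ K * \<i> * of_real \<alpha> / 4) \<le> (26 + 4 * real K) * \<bar>\<alpha>\<bar> * (t + \<bar>\<alpha>\<bar>)"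
    unfolding z_def by (rule log_Phi_odd_le[OF t(1,2) small(1,2) N KN])
  have "norm z \<le> norm (z - (-1) ^ K * \<i> * of_real \<alpha> / 4) + norm ((-1) ^ K * \<i> * of_real \<alpha> / 4)"
    by (metis diff_add_cancel norm_triangle_ineq)
  also have "norm ((-1) ^ K * \<i> * of_real \<alpha> / 4) = \<bar>\<alpha>\<bar> / 4" by (simp add: norm_mult norm_power norm_divide)
  also have "(26 + 4 * real K) * \<bar>\<alpha>\<bar> * (t + \<bar>\<alpha>\<bar>) \<le> (26 + 4 * real K) * \<bar>\<alpha>\<bar> * 2"
    using t by (intro mult_left_mono) auto
  then have "norm (z - (-1) ^ K * \<i> * of_real \<alpha> / 4) + \<bar>\<alpha>\<bar> / 4 \<le> (26 + 4 * real K) * \<bar>\<alpha>\<bar> * 2 + 1 * \<bar>\<alpha>\<bar>"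
    using le by linarith
  also have "\<dots> \<le> (26 + 4 * real K) * \<bar>\<alpha>\<bar> * 2 + (26 + 4 * real K) * \<bar>\<alpha>\<bar>"
    by (intro add_left_mono mult_right_mono) auto
  finally show "norm z \<le> 3 * (26 + 4 * real K) * \<bar>\<alpha>\<bar>" by (simp add: algebra_simps)
qed

lemma cis_eq_exp: "cis (- (real N * \<theta>)) = exp (- \<i> * of_real (real N * \<theta>))"
  by (simp add: cis_conv_exp)

lemma half_le_of_saddle: "real N * t\<^sup>2 = pi\<^sup>2 / 12 \<Longrightarrow> 1 / 2 \<le> real N * t\<^sup>2"
  using pi_gt3 mult_mono[of 3 pi 3 pi] by (simp add: power2_eq_square)

text \<open>The limit \<open>(-1) ^ K / 2\<close> is the product of
  \<open>(-1) ^ K * \<alpha> / 4\<close>, the odd part divided by \<i>, with the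
  \<open>2 / \<alpha>\<close> of the cotangent. The sign in the theorem originates here.\<close>

lemma sgn_kernel_arcs:
  fixes K :: nat
  obtains C t0 :: real where "0 \<le> C" "0 < t0"
    "\<And>t N \<theta> \<alpha>. 0 < t \<Longrightarrow> t \<le> t0 \<Longrightarrow> t \<le> 1 \<Longrightarrow> real N * t\<^sup>2 = pi\<^sup>2 / 12 \<Longrightarrow> K \<le> N \<Longrightarrow> \<bar>\<theta>\<bar> \<le> pi \<Longrightarrow> \<bar>\<alpha>\<bar> \<le> pi \<Longrightarrow> \<alpha> \<noteq> 0 \<Longrightarrow>
      norm (cis (- (real N * \<theta>)) * (\<Sum>S\<in>Pow {K<..N}. of_real (exp (- (t * real (\<Sum>S)))) * cis (\<theta> * real (\<Sum>S)) * sgn_kernel (excess S) \<alpha>)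
        - of_real (Zt {K<..N} t) * ((-1) ^ K / 2) * of_real (exp (- gauss_exp t \<theta> \<alpha>)))
      \<le> Zt {K<..N} t * (C * sqrt t * exp (- gauss_exp t \<theta> \<alpha> / 4) + C * t ^ 3)"
proof -
  obtain c t0 where c: "0 < c" "0 < t0" and minor:
    "\<And>t N \<theta> \<alpha>. 0 < t \<Longrightarrow> t \<le> t0 \<Longrightarrow> real N * t\<^sup>2 = pi\<^sup>2 / 12 \<Longrightarrow> \<bar>\<theta>\<bar> \<le> pi \<Longrightarrow> \<bar>\<alpha>\<bar> \<le> pi \<Longrightarrow>
      t \<le> 10000 * \<bar>\<theta>\<bar> \<or> 1 \<le> 10000 * \<bar>\<alpha>\<bar> \<Longrightarrow> norm (Phi {K<..N} t \<theta> \<alpha>) \<le> Zt {K<..N} t * exp (- (c / t))"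
    using minor_arc[of K] by blast
  define B where "B = 26 + 4 * real K"
  have B: "0 \<le> B" by (simp add: B_def)
  define B' where "B' = B + 9 * B\<^sup>2 * exp (3 * B)"
  have B': "0 \<le> B'" using B by (simp add: B'_def)
  define D where "D = 6 * B' + 1"
  define R where "R = 132 + 12 * real K"
  define C where "C = 600 * ((R + 3072) * exp (2 * R) * (norm ((-1) ^ K / 2 :: complex) + 2 * D) + D) + 120 * 60000 / c ^ 5
     + 6 * (4 * 10 ^ 8) ^ 3 * norm ((-1) ^ K / 2 :: complex)"
  have D: "0 \<le> D" using B' by (simp add: D_def)
  have "0 \<le> C" unfolding C_def R_def using D c by (intro add_nonneg_nonneg mult_nonneg_nonneg) auto
  show thesis
  proof (rule that[OF \<open>0 \<le> C\<close> c(2)])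
    fix t \<theta> \<alpha> :: real and N :: nat
    assume t: "0 < t" "t \<le> t0" "t \<le> 1" and N: "real N * t\<^sup>2 = pi\<^sup>2 / 12" and KN: "K \<le> N"
      and \<theta>: "\<bar>\<theta>\<bar> \<le> pi" and \<alpha>: "\<bar>\<alpha>\<bar> \<le> pi" "\<alpha> \<noteq> 0"
    have N2: "1 / 2 \<le> real N * t\<^sup>2" by (rule half_le_of_saddle[OF N])
    define k where "k = cos (\<alpha> / 2) / sin (\<alpha> / 2)"
    have k: "\<bar>k\<bar> \<le> 6 / \<bar>\<alpha>\<bar>" unfolding k_def by (rule abs_cot_half_le[OF \<alpha>])
    have eq: "(\<Sum>S\<in>Pow {K<..N}. of_real (exp (- (t * real (\<Sum>S)))) * cis (\<theta> * real (\<Sum>S)) * sgn_kernel (excess S) \<alpha>)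
      = (Phi {K<..N} t \<theta> \<alpha> - Phi {K<..N} t \<theta> (- \<alpha>)) / (2 * \<i>) * of_real k"
      unfolding k_def by (rule sum_sgn_kernel[OF _ abs_cot_half_le(1)[OF \<alpha>]]) simp
    show "norm (cis (- (real N * \<theta>)) * (\<Sum>S\<in>Pow {K<..N}. of_real (exp (- (t * real (\<Sum>S)))) * cis (\<theta> * real (\<Sum>S)) * sgn_kernel (excess S) \<alpha>)
        - of_real (Zt {K<..N} t) * ((-1) ^ K / 2) * of_real (exp (- gauss_exp t \<theta> \<alpha>)))
      \<le> Zt {K<..N} t * (C * sqrt t * exp (- gauss_exp t \<theta> \<alpha> / 4) + C * t ^ 3)"
      unfolding eq C_def R_def
    proof (rule arc_bounds_combine[OF t(1,3) N KN D _ c(1)])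
      assume small: "10000 * \<bar>\<theta>\<bar> \<le> t" "10000 * \<bar>\<alpha>\<bar> \<le> 1"
      define e where "e = (log_Phi {K<..N} t \<theta> \<alpha> + log_Phi {K<..N} t \<theta> (- \<alpha>)) / 2"
      define z where "z = (log_Phi {K<..N} t \<theta> \<alpha> - log_Phi {K<..N} t \<theta> (- \<alpha>)) / 2"
      note lb = log_Phi_odd_bounds[OF t(1,3) small N2 KN, folded e_def z_def B_def]
      define G where "G = (exp z - exp (- z)) / (2 * \<i>)"
      define S where "S = G * of_real k"
      have "norm z \<le> 3 * B * 1" using small B by (intro order_trans[OF lb(4)] mult_left_mono) auto
      then have "exp (norm z) \<le> exp (3 * B)" by simp
      moreover have "(norm z)\<^sup>2 \<le> (3 * B * \<bar>\<alpha>\<bar>)\<^sup>2" by (intro power_mono lb(4)) auto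
      ultimately have z2: "(norm z)\<^sup>2 * exp (norm z) \<le> (3 * B * \<bar>\<alpha>\<bar>)\<^sup>2 * exp (3 * B)" by (intro mult_mono) auto
      \<comment> \<open>Difference of the quadratic remainders of \<open>exp z\<close> and
        \<open>exp (- z)\<close>; what it leaves of the numerator of \<open>G\<close> is
        \<open>2 * z\<close>.\<close>
      define w where "w = (exp z - 1 - z) - (exp (- z) - 1 - - z)"
      have "norm w \<le> (norm z)\<^sup>2 * exp (norm z) + (norm z)\<^sup>2 * exp (norm z)"
        using norm_triangle_ineq4[of "exp z - 1 - z" "exp (- z) - 1 - - z"]
          norm_exp_minus_one_minus_le[of z] norm_exp_minus_one_minus_le[of "- z"]
        unfolding w_def norm_minus_cancel by linarith
      then have w: "norm w \<le> 2 * ((3 * B * \<bar>\<alpha>\<bar>)\<^sup>2 * exp (3 * B))" using z2 by linarith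
      have "G - (-1) ^ K * of_real \<alpha> / 4 = w / (2 * \<i>) + (z - (-1) ^ K * \<i> * of_real \<alpha> / 4) / \<i>"
        unfolding G_def w_def by (simp add: field_simps)
      then have "norm (G - (-1) ^ K * of_real \<alpha> / 4) \<le> norm (w / (2 * \<i>)) + norm ((z - (-1) ^ K * \<i> * of_real \<alpha> / 4) / \<i>)"
        using norm_triangle_ineq by metis
      also have "\<dots> = norm w / 2 + norm (z - (-1) ^ K * \<i> * of_real \<alpha> / 4)" by (simp only: norm_divide norm_mult norm_ii norm_numeral)
      also have "\<dots> \<le> 9 * B\<^sup>2 * exp (3 * B) * (\<bar>\<alpha>\<bar> * \<bar>\<alpha>\<bar>) + B * (\<bar>\<alpha>\<bar> * (t + \<bar>\<alpha>\<bar>))"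
      proof (rule add_mono)
        have "2 * ((3 * B * \<bar>\<alpha>\<bar>)\<^sup>2 * exp (3 * B)) / 2 = 9 * B\<^sup>2 * exp (3 * B) * (\<bar>\<alpha>\<bar> * \<bar>\<alpha>\<bar>)"
          by (simp add: power2_eq_square)
        then show "norm w / 2 \<le> 9 * B\<^sup>2 * exp (3 * B) * (\<bar>\<alpha>\<bar> * \<bar>\<alpha>\<bar>)" using w by linarith
        show "norm (z - (-1) ^ K * \<i> * of_real \<alpha> / 4) \<le> B * (\<bar>\<alpha>\<bar> * (t + \<bar>\<alpha>\<bar>))" using lb(3) by (simp add: mult.assoc)
      qed
      also have "\<dots> \<le> 9 * B\<^sup>2 * exp (3 * B) * (\<bar>\<alpha>\<bar> * (t + \<bar>\<alpha>\<bar>)) + B * (\<bar>\<alpha>\<bar> * (t + \<bar>\<alpha>\<bar>))"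
        using t by (intro add_right_mono mult_left_mono) auto
      also have "\<dots> = B' * (\<bar>\<alpha>\<bar> * (t + \<bar>\<alpha>\<bar>))" by (simp add: B'_def algebra_simps)
      finally have G: "norm (G - (-1) ^ K * of_real \<alpha> / 4) \<le> B' * (\<bar>\<alpha>\<bar> * (t + \<bar>\<alpha>\<bar>))" .
      have "S - (-1) ^ K / 2 = (G - (-1) ^ K * of_real \<alpha> / 4) * of_real k + (-1) ^ K * of_real (\<alpha> / 4 * k - 1 / 2)"
        unfolding S_def by (simp add: algebra_simps)
      then have "norm (S - (-1) ^ K / 2) \<le> norm ((G - (-1) ^ K * of_real \<alpha> / 4) * of_real k) + norm ((-1) ^ K * of_real (\<alpha> / 4 * k - 1 / 2) :: complex)"
        using norm_triangle_ineq by metis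
      also have "\<dots> = norm (G - (-1) ^ K * of_real \<alpha> / 4) * \<bar>k\<bar> + \<bar>\<alpha> / 4 * k - 1 / 2\<bar>"
        by (simp only: norm_mult norm_power norm_of_real norm_minus_cancel norm_one power_one mult_1)
      also have "\<dots> \<le> (B' * (\<bar>\<alpha>\<bar> * (t + \<bar>\<alpha>\<bar>))) * (6 / \<bar>\<alpha>\<bar>) + \<bar>\<alpha>\<bar>"
      proof (intro add_mono mult_mono G k)
        show "\<bar>\<alpha> / 4 * k - 1 / 2\<bar> \<le> \<bar>\<alpha>\<bar>" unfolding k_def using small \<alpha> by (intro cot_half_approx) auto
      qed (use B' t in auto)
      also have "\<dots> = 6 * B' * (t + \<bar>\<alpha>\<bar>) + \<bar>\<alpha>\<bar>" using \<alpha> by simp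
      also have "\<dots> \<le> D * (t + \<bar>\<alpha>\<bar>)" using t by (simp add: D_def algebra_simps)
      finally have "norm (S - (-1) ^ K / 2) \<le> D * (t + \<bar>\<alpha>\<bar>)" .
      moreover have "(Phi {K<..N} t \<theta> \<alpha> - Phi {K<..N} t \<theta> (- \<alpha>)) / (2 * \<i>) * of_real k = exp e * S"
        unfolding lb(1,2) S_def G_def by (simp add: right_diff_distrib[symmetric])
      ultimately show "\<exists>S. norm (S - (-1) ^ K / 2) \<le> D * (t + \<bar>\<alpha>\<bar>) \<and>
        cis (- (real N * \<theta>)) * ((Phi {K<..N} t \<theta> \<alpha> - Phi {K<..N} t \<theta> (- \<alpha>)) / (2 * \<i>) * of_real k)
        = exp (- \<i> * of_real (real N * \<theta>)) * exp ((log_Phi {K<..N} t \<theta> \<alpha> + log_Phi {K<..N} t \<theta> (- \<alpha>)) / 2) * S"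
        unfolding cis_eq_exp e_def[symmetric] by (intro exI[of _ S]) (simp add: mult.assoc)
    next
      assume far: "t \<le> 10000 * \<bar>\<theta>\<bar> \<or> 1 \<le> 10000 * \<bar>\<alpha>\<bar>"
      define P where "P = Zt {K<..N} t * exp (- (c / t))"
      have P: "0 \<le> P" using Zt_pos[of "{K<..N}" t] by (simp add: P_def)
      \<comment> \<open>If \<open>\<bar>\<alpha>\<bar> \<ge> 1 / 10000\<close>, the triangle
        inequality suffices and the factor \<open>\<bar>\<alpha>\<bar>\<close> costs 10000.
        Otherwise the point is far because of \<theta>, so the minor bound holds for every angle
        between \<open>- \<alpha>\<close> and \<alpha>.\<close>
      have nd: "norm (Phi {K<..N} t \<theta> \<alpha> - Phi {K<..N} t \<theta> (- \<alpha>)) \<le> 20000 / t\<^sup>2 * P * \<bar>\<alpha>\<bar>"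
      proof (cases "1 \<le> 10000 * \<bar>\<alpha>\<bar>")
        case True
        have "norm (Phi {K<..N} t \<theta> \<alpha> - Phi {K<..N} t \<theta> (- \<alpha>)) \<le> P + P"
          unfolding P_def using True \<alpha> \<theta> N t
          by (intro order_trans[OF norm_triangle_ineq4] add_mono minor) auto
        also have "\<dots> \<le> 20000 * 1 * P * \<bar>\<alpha>\<bar>"
          using mult_right_mono[OF True P] by (simp add: mult_ac)
        also have "\<dots> \<le> 20000 * (1 / t\<^sup>2) * P * \<bar>\<alpha>\<bar>"
          using t P power_le_one[of t 2] by (intro mult_right_mono mult_left_mono) auto
        finally show ?thesis by simp
      next
        case False
        then have "norm (Phi {K<..N} t \<theta> \<alpha> - Phi {K<..N} t \<theta> (- \<alpha>)) \<le> 4 / t\<^sup>2 * P * \<bar>\<alpha>\<bar>"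
          unfolding P_def using far \<alpha> \<theta> N t by (intro Phi_diff_le minor) auto
        also have "\<dots> \<le> 20000 / t\<^sup>2 * P * \<bar>\<alpha>\<bar>" using t P by (intro mult_right_mono divide_right_mono) auto
        finally show ?thesis .
      qed
      have "norm (cis (- (real N * \<theta>)) * ((Phi {K<..N} t \<theta> \<alpha> - Phi {K<..N} t \<theta> (- \<alpha>)) / (2 * \<i>) * of_real k))
        = norm (Phi {K<..N} t \<theta> \<alpha> - Phi {K<..N} t \<theta> (- \<alpha>)) / 2 * \<bar>k\<bar>"
        by (simp add: norm_mult norm_divide)
      also have "\<dots> \<le> (20000 / t\<^sup>2 * P * \<bar>\<alpha>\<bar>) / 2 * (6 / \<bar>\<alpha>\<bar>)"
        using nd k P by (intro mult_mono divide_right_mono) auto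
      also have "\<dots> = Zt {K<..N} t * (60000 * exp (- (c / t)) / t\<^sup>2)" using \<alpha> by (simp add: P_def)
      finally show "norm (cis (- (real N * \<theta>)) * ((Phi {K<..N} t \<theta> \<alpha> - Phi {K<..N} t \<theta> (- \<alpha>)) / (2 * \<i>) * of_real k))
        \<le> Zt {K<..N} t * (60000 * exp (- (c / t)) / t\<^sup>2)" .
    qed simp
  qed
qed

text \<open>Here there is no pole to cancel: \<open>exp z\<close> and the kernel
  \<open>cis (- (d * \<alpha>))\<close> are both 1 up to a multiple of
  \<open>\<bar>\<alpha>\<bar>\<close>. Hence the limit 1, whatever \<open>d\<close> is.\<close>

lemma cis_kernel_arcs:
  fixes K :: nat and d :: int
  obtains C t0 :: real where "0 \<le> C" "0 < t0"
    "\<And>t N \<theta> \<alpha>. 0 < t \<Longrightarrow> t \<le> t0 \<Longrightarrow> t \<le> 1 \<Longrightarrow> real N * t\<^sup>2 = pi\<^sup>2 / 12 \<Longrightarrow> K \<le> N \<Longrightarrow> \<bar>\<theta>\<bar> \<le> pi \<Longrightarrow> \<bar>\<alpha>\<bar> \<le> pi \<Longrightarrow> \<alpha> \<noteq> 0 \<Longrightarrow>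
      norm (cis (- (real N * \<theta>)) * (\<Sum>S\<in>Pow {K<..N}. of_real (exp (- (t * real (\<Sum>S)))) * cis (\<theta> * real (\<Sum>S)) * cis (of_int (excess S - d) * \<alpha>))
        - of_real (Zt {K<..N} t) * 1 * of_real (exp (- gauss_exp t \<theta> \<alpha>)))
      \<le> Zt {K<..N} t * (C * sqrt t * exp (- gauss_exp t \<theta> \<alpha> / 4) + C * t ^ 3)"
proof -
  obtain c t0 where c: "0 < c" "0 < t0" and minor:
    "\<And>t N \<theta> \<alpha>. 0 < t \<Longrightarrow> t \<le> t0 \<Longrightarrow> real N * t\<^sup>2 = pi\<^sup>2 / 12 \<Longrightarrow> \<bar>\<theta>\<bar> \<le> pi \<Longrightarrow> \<bar>\<alpha>\<bar> \<le> pi \<Longrightarrow>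
      t \<le> 10000 * \<bar>\<theta>\<bar> \<or> 1 \<le> 10000 * \<bar>\<alpha>\<bar> \<Longrightarrow> norm (Phi {K<..N} t \<theta> \<alpha>) \<le> Zt {K<..N} t * exp (- (c / t))"
    using minor_arc[of K] by blast
  define B where "B = 3 * (26 + 4 * real K) + \<bar>of_int d\<bar>"
  have B: "0 \<le> B" by (simp add: B_def)
  define D where "D = B * exp B"
  define R where "R = 132 + 12 * real K"
  define C where "C = 600 * ((R + 3072) * exp (2 * R) * (norm (1 :: complex) + 2 * D) + D) + 120 * 1 / c ^ 5
     + 6 * (4 * 10 ^ 8) ^ 3 * norm (1 :: complex)"
  have D: "0 \<le> D" using B by (simp add: D_def)
  have "0 \<le> C" unfolding C_def R_def using D c by (intro add_nonneg_nonneg mult_nonneg_nonneg) auto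
  show thesis
  proof (rule that[OF \<open>0 \<le> C\<close> c(2)])
    fix t \<theta> \<alpha> :: real and N :: nat
    assume t: "0 < t" "t \<le> t0" "t \<le> 1" and N: "real N * t\<^sup>2 = pi\<^sup>2 / 12" and KN: "K \<le> N"
      and \<theta>: "\<bar>\<theta>\<bar> \<le> pi" and \<alpha>: "\<bar>\<alpha>\<bar> \<le> pi" "\<alpha> \<noteq> 0"
    have N2: "1 / 2 \<le> real N * t\<^sup>2" by (rule half_le_of_saddle[OF N])
    have eq: "(\<Sum>S\<in>Pow {K<..N}. of_real (exp (- (t * real (\<Sum>S)))) * cis (\<theta> * real (\<Sum>S)) * cis (of_int (excess S - d) * \<alpha>))
      = Phi {K<..N} t \<theta> \<alpha> * cis (- (of_int d * \<alpha>))"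
    proof -
      have "cis (of_int (m - d) * \<alpha>) = cis (of_int m * \<alpha>) * cis (- (of_int d * \<alpha>))" for m
        unfolding cis_mult by (simp add: algebra_simps)
      then show ?thesis by (simp add: Phi_expand sum_distrib_right mult.assoc)
    qed
    show "norm (cis (- (real N * \<theta>)) * (\<Sum>S\<in>Pow {K<..N}. of_real (exp (- (t * real (\<Sum>S)))) * cis (\<theta> * real (\<Sum>S)) * cis (of_int (excess S - d) * \<alpha>))
        - of_real (Zt {K<..N} t) * 1 * of_real (exp (- gauss_exp t \<theta> \<alpha>)))
      \<le> Zt {K<..N} t * (C * sqrt t * exp (- gauss_exp t \<theta> \<alpha> / 4) + C * t ^ 3)"
      unfolding eq C_def R_def
    proof (rule arc_bounds_combine[OF t(1,3) N KN D _ c(1)])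
      assume small: "10000 * \<bar>\<theta>\<bar> \<le> t" "10000 * \<bar>\<alpha>\<bar> \<le> 1"
      define e where "e = (log_Phi {K<..N} t \<theta> \<alpha> + log_Phi {K<..N} t \<theta> (- \<alpha>)) / 2"
      define z where "z = (log_Phi {K<..N} t \<theta> \<alpha> - log_Phi {K<..N} t \<theta> (- \<alpha>)) / 2"
      note lb = log_Phi_odd_bounds[OF t(1,3) small N2 KN, folded e_def z_def]
      define y where "y = z + \<i> * of_real (- (of_int d * \<alpha>))"
      have "norm y \<le> norm z + norm (\<i> * of_real (- (of_int d * \<alpha>)))" unfolding y_def by (rule norm_triangle_ineq)
      also have "norm (\<i> * of_real (- (of_int d * \<alpha>))) = \<bar>of_int d\<bar> * \<bar>\<alpha>\<bar>" by (simp add: norm_mult abs_mult)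
      finally have y1: "norm y \<le> B * \<bar>\<alpha>\<bar>" using lb(4) by (simp add: B_def algebra_simps)
      also have "\<dots> \<le> B * 1" using B small by (intro mult_left_mono) auto
      finally have y2: "norm y \<le> B" by simp
      have "norm (exp y - 1) \<le> norm y * exp (norm y)" by (rule norm_exp_minus_one_le)
      also have "\<dots> \<le> (B * \<bar>\<alpha>\<bar>) * exp B" using y1 y2 B by (intro mult_mono) auto
      also have "\<dots> \<le> D * (t + \<bar>\<alpha>\<bar>)" using B t by (simp add: D_def algebra_simps)
      finally have "norm (exp y - 1) \<le> D * (t + \<bar>\<alpha>\<bar>)" .
      moreover have "Phi {K<..N} t \<theta> \<alpha> * cis (- (of_int d * \<alpha>)) = exp e * exp y"
        unfolding lb(1) y_def exp_add cis_conv_exp by (simp add: mult.assoc)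
      ultimately show "\<exists>S. norm (S - 1) \<le> D * (t + \<bar>\<alpha>\<bar>) \<and>
        cis (- (real N * \<theta>)) * (Phi {K<..N} t \<theta> \<alpha> * cis (- (of_int d * \<alpha>)))
        = exp (- \<i> * of_real (real N * \<theta>)) * exp ((log_Phi {K<..N} t \<theta> \<alpha> + log_Phi {K<..N} t \<theta> (- \<alpha>)) / 2) * S"
        unfolding cis_eq_exp e_def[symmetric] by (intro exI[of _ "exp y"]) (simp add: mult.assoc)
    next
      assume far: "t \<le> 10000 * \<bar>\<theta>\<bar> \<or> 1 \<le> 10000 * \<bar>\<alpha>\<bar>"
      have "norm (cis (- (real N * \<theta>)) * (Phi {K<..N} t \<theta> \<alpha> * cis (- (of_int d * \<alpha>)))) \<le> Zt {K<..N} t * exp (- (c / t))"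
        using minor[OF t(1,2) N \<theta> \<alpha>(1) far] by (simp add: norm_mult)
      also have "\<dots> \<le> Zt {K<..N} t * (1 * exp (- (c / t)) / t\<^sup>2)"
        using Zt_pos[of "{K<..N}" t] t power_le_one[of t 2] by (intro mult_left_mono) (auto simp: field_simps)
      finally show "norm (cis (- (real N * \<theta>)) * (Phi {K<..N} t \<theta> \<alpha> * cis (- (of_int d * \<alpha>)))) \<le> Zt {K<..N} t * (1 * exp (- (c / t)) / t\<^sup>2)" .
    qed simp
  qed
qed

section \<open>Partitions\<close>

text \<open>Asymptotic number of distinct partitions with parts above \<open>K\<close> and one
  prescribed excess, the same for every excess. The leading term of the theorem is
  \<open>(-1) ^ K / 2\<close> times this.\<close>

definition main_term :: "nat \<Rightarrow> nat \<Rightarrow> real" where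
  "main_term K n = exp (pi * sqrt (real n / 3)) / (2 ^ K * (4 * sqrt 6) * real n)"

text \<open>At the minimum of \<open>t * n + pi\<^sup>2 / (12 * t)\<close> the two summands are
  equal, and their sum is the exponent of the theorem. The bound on \<open>sqrt t\<close> converts
  the local errors into a power of \<open>n\<close>.\<close>

lemma saddle_point:
  assumes "0 < n"
  defines "t \<equiv> pi / (2 * sqrt (3 * real n))"
  shows "0 < t" "real n * t\<^sup>2 = pi\<^sup>2 / 12" "t \<le> 2 / sqrt (real n)" "sqrt t \<le> 2 * real n powr (- 1 / 4)"
    and "t * real n + pi\<^sup>2 / (12 * t) = pi * sqrt (real n / 3)"
proof -
  show t: "0 < t" using assms by (simp add: t_def)
  show nt: "real n * t\<^sup>2 = pi\<^sup>2 / 12" using assms by (simp add: t_def power_divide power_mult_distrib)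
  have "pi / (2 * sqrt (3 * real n)) \<le> 4 / (2 * sqrt (real n))"
    using pi_less_4 assms by (intro frac_le mult_left_mono real_sqrt_le_mono) auto
  then show t2: "t \<le> 2 / sqrt (real n)" by (simp add: t_def)
  have "sqrt t \<le> sqrt (2 / sqrt (real n))" using t2 by simp
  also have "\<dots> = sqrt 2 * real n powr (- 1 / 4)"
    using assms by (simp add: real_sqrt_divide powr_half_sqrt[symmetric] powr_powr powr_minus_divide)
  also have "\<dots> \<le> 2 * real n powr (- 1 / 4)" by (intro mult_right_mono real_le_lsqrt) auto
  finally show "sqrt t \<le> 2 * real n powr (- 1 / 4)" .
  have "pi\<^sup>2 / (12 * t) = real n * t\<^sup>2 / t" unfolding nt by simp
  also have "\<dots> = t * real n" using t by (simp add: power2_eq_square)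
  finally have "t * real n + pi\<^sup>2 / (12 * t) = 2 * (t * real n)" by simp
  also have "\<dots> = pi * (real n / sqrt (3 * real n))" by (simp add: t_def)
  also have "real n / sqrt (3 * real n) = sqrt (real n / 3)"
  proof (rule real_sqrt_unique[symmetric])
    show "(real n / sqrt (3 * real n))\<^sup>2 = real n / 3" using assms by (simp add: power_divide power2_eq_square)
  qed simp
  finally show "t * real n + pi\<^sup>2 / (12 * t) = pi * sqrt (real n / 3)" .
qed

text \<open>The factor \<open>sqrt 3 * t\<^sup>2 / pi\<^sup>2\<close> is
  \<open>4 * sqrt 3 * t\<^sup>2\<close> from the Gaussian integrals over
  \<open>4 * pi\<^sup>2\<close> from the two Fourier normalizations. It equals
  \<open>sqrt 3 / (12 * n)\<close>; with the \<open>2 powr (- 1 / 2)\<close> hidden in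
  \<open>Zt\<close> this becomes the \<open>1 / (4 * sqrt 6 * n)\<close> of
  \<open>main_term\<close>.\<close>

lemma Zt_asymptotic:
  assumes n: "0 < n" "K \<le> n"
  defines "t \<equiv> pi / (2 * sqrt (3 * real n))"
  assumes t1: "t \<le> 1"
  shows "\<bar>ln (Zt {K<..n} t * exp (t * real n) * (sqrt 3 * t\<^sup>2 / pi\<^sup>2) / main_term K n)\<bar> \<le> (200 + real K ^ 2) * t"
proof -
  note sp = saddle_point[OF n(1), folded t_def]
  define Z where "Z = Zt {K<..n} t"
  have Z: "0 < Z" by (simp add: Z_def Zt_pos)
  have "\<bar>ln Z - (pi\<^sup>2 / (12 * t) - (real K + 1 / 2) * ln 2)\<bar> \<le> (200 + real K ^ 2) * t"
    unfolding Z_def ln_Zt[OF finite_greaterThanAtMost]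
    by (rule sum_ln_one_plus_exp[OF sp(1) t1 half_le_of_saddle[OF sp(2)] n(2)])
  moreover have "ln (Z * exp (t * real n) * (sqrt 3 * t\<^sup>2 / pi\<^sup>2) / main_term K n)
    = ln Z - (pi\<^sup>2 / (12 * t) - (real K + 1 / 2) * ln 2)"
  proof -
    have "sqrt 6 = sqrt 3 * sqrt 2" by (simp flip: real_sqrt_mult)
    moreover have "t\<^sup>2 = pi\<^sup>2 / (12 * real n)" using sp(2) n by (simp add: field_simps)
    ultimately have "(sqrt 3 * t\<^sup>2 / pi\<^sup>2) / main_term K n = 2 ^ K * sqrt 2 / exp (pi * sqrt (real n / 3))"
    proof -
      assume a: "sqrt 6 = sqrt 3 * sqrt 2" "t\<^sup>2 = pi\<^sup>2 / (12 * real n)"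
      have s3: "sqrt 3 * (sqrt 3 * x) = 3 * x" for x by (simp flip: mult.assoc)
      have "sqrt 3 * t\<^sup>2 / pi\<^sup>2 = sqrt 3 / (12 * real n)" unfolding a(2) by simp
      then show ?thesis using n unfolding a(1) main_term_def by (simp add: field_simps s3)
    qed
    then have eq: "Z * exp (t * real n) * (sqrt 3 * t\<^sup>2 / pi\<^sup>2) / main_term K n
      = Z * (exp (t * real n) * (2 ^ K * sqrt 2) / exp (pi * sqrt (real n / 3)))"
      by (simp only: times_divide_eq_right[symmetric] mult.assoc)
    have "ln (exp (t * real n) * (2 ^ K * sqrt 2) / exp (pi * sqrt (real n / 3)))
      = t * real n + (real K * ln 2 + ln 2 / 2) - pi * sqrt (real n / 3)"
      by (simp add: ln_mult ln_div ln_realpow ln_sqrt)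
    also have "\<dots> = - (pi\<^sup>2 / (12 * t) - (real K + 1 / 2) * ln 2)"
      unfolding sp(5)[symmetric] by (simp add: algebra_simps)
    finally show ?thesis unfolding eq using Z by (subst ln_mult) auto
  qed
  ultimately show ?thesis by (simp add: Z_def)
qed

lemma main_term_pos: "0 < n \<Longrightarrow> 0 < main_term K n"
  by (simp add: main_term_def)

text \<open>Common frame for both kernels: a family \<open>T\<close> enters only through its means
  \<open>\<tau>\<close> and the amplitude \<open>S0\<close> found at the origin.\<close>

lemma coefficient_asymptotic:
  fixes K :: nat and T :: "nat set \<Rightarrow> real \<Rightarrow> complex" and \<tau> :: "nat set \<Rightarrow> complex" and S0 :: complex and C t0 :: real
  assumes cont: "\<And>S. continuous_on {-pi..pi} (T S)"
    and \<tau>: "\<And>S. integral {-pi..pi} (T S) = of_real (2 * pi) * \<tau> S"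
    and C: "0 \<le> C" "0 < t0"
    and bd: "\<And>t N \<theta> \<alpha>. 0 < t \<Longrightarrow> t \<le> t0 \<Longrightarrow> t \<le> 1 \<Longrightarrow> real N * t\<^sup>2 = pi\<^sup>2 / 12 \<Longrightarrow> K \<le> N \<Longrightarrow> \<bar>\<theta>\<bar> \<le> pi \<Longrightarrow> \<bar>\<alpha>\<bar> \<le> pi \<Longrightarrow> \<alpha> \<noteq> 0 \<Longrightarrow>
      norm (cis (- (real N * \<theta>)) * (\<Sum>S\<in>Pow {K<..N}. of_real (exp (- (t * real (\<Sum>S)))) * cis (\<theta> * real (\<Sum>S)) * T S \<alpha>)
        - of_real (Zt {K<..N} t) * S0 * of_real (exp (- gauss_exp t \<theta> \<alpha>)))
      \<le> Zt {K<..N} t * (C * sqrt t * exp (- gauss_exp t \<theta> \<alpha> / 4) + C * t ^ 3)"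
  obtains C' where "0 \<le> C'"
    "\<forall>\<^sub>F n in sequentially. norm ((\<Sum>S | S \<subseteq> {K<..n} \<and> \<Sum>S = n. \<tau> S) - of_real (main_term K n) * S0)
       \<le> C' * main_term K n * real n powr (- 1 / 4)"
proof -
  define B where "B = 200 + real K ^ 2"
  define C' where "C' = 2 * (50 * (C + norm S0) * exp B + B * exp B * norm S0)"
  have "0 \<le> C'" using C by (simp add: C'_def B_def)
  moreover have "\<forall>\<^sub>F n in sequentially. norm ((\<Sum>S | S \<subseteq> {K<..n} \<and> \<Sum>S = n. \<tau> S) - of_real (main_term K n) * S0)
       \<le> C' * main_term K n * real n powr (- 1 / 4)"
  proof -
    have "((\<lambda>n. 2 * (1 / sqrt (real n))) \<longlongrightarrow> 2 * 0) sequentially"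
      by (intro tendsto_mult tendsto_const tendsto_divide_0[OF tendsto_const] filterlim_at_top_imp_at_infinity
          filterlim_compose[OF sqrt_at_top filterlim_real_sequentially])
    then have "((\<lambda>n. 2 / sqrt (real n)) \<longlongrightarrow> 0) sequentially" by simp
    then have "\<forall>\<^sub>F n in sequentially. 2 / sqrt (real n) < min t0 1"
      by (rule order_tendstoD) (use C in auto)
    with eventually_ge_at_top[of "max 1 K"] show ?thesis
    proof eventually_elim
      case (elim n)
      then have n: "0 < n" "K \<le> n" by auto
      define t where "t = pi / (2 * sqrt (3 * real n))"
      note sp = saddle_point[OF n(1), folded t_def]
      have "2 / sqrt (real n) < t0" "2 / sqrt (real n) < 1" using elim by (simp_all only: min_less_iff_conj)
      then have t: "t \<le> t0" "t \<le> 1" using sp(3) by linarith+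
      define Z where "Z = Zt {K<..n} t"
      have Z: "0 < Z" by (simp add: Z_def Zt_pos)
      define W where "W = main_term K n"
      have W: "0 < W" using main_term_pos[OF n(1)] by (simp add: W_def)
      define V where "V = Z * exp (t * real n) * (sqrt 3 * t\<^sup>2 / pi\<^sup>2)"
      have V: "0 < V" using Z sp(1) by (simp add: V_def)
      define X where "X = (\<Sum>S | S \<subseteq> {K<..n} \<and> \<Sum>S = n. \<tau> S)"
      have X_eq: "X = (\<Sum>S\<in>{S\<in>Pow {K<..n}. \<Sum>S = n}. \<tau> S)" unfolding X_def by (rule sum.cong) auto
      have "norm (of_real (4 * pi\<^sup>2 * exp (- (t * real n))) * X - of_real (Z * (4 * sqrt 3 * t\<^sup>2)) * S0)
        \<le> Z * (200 * (C + norm S0) * (t\<^sup>2 * sqrt t))"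
        unfolding X_eq Z_def
        by (rule localization[where T = T and \<tau> = \<tau> and s = "\<lambda>S. \<Sum>S", OF _ cont \<tau> sp(1) t(2) Zt_pos C(1)])
          (rule finite_Pow_iff[THEN iffD2] finite_greaterThanAtMost bd[OF sp(1) t sp(2) n(2)] | assumption)+
      moreover have "of_real (4 * pi\<^sup>2 * exp (- (t * real n))) * X - of_real (Z * (4 * sqrt 3 * t\<^sup>2)) * S0
        = of_real (4 * pi\<^sup>2 * exp (- (t * real n))) * (X - of_real V * S0)"
      proof -
        have "Z * (4 * sqrt 3 * t\<^sup>2) = 4 * pi\<^sup>2 * exp (- (t * real n)) * V"
          by (simp add: V_def exp_minus field_simps)
        then show ?thesis by (simp only: right_diff_distrib of_real_mult mult.assoc)
      qed
      moreover have "norm (of_real (4 * pi\<^sup>2 * exp (- (t * real n))) * Y) = 4 * pi\<^sup>2 * exp (- (t * real n)) * norm Y" for Y :: complex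
        unfolding norm_mult norm_of_real by simp
      ultimately have "4 * pi\<^sup>2 * exp (- (t * real n)) * norm (X - of_real V * S0) \<le> Z * (200 * (C + norm S0) * (t\<^sup>2 * sqrt t))"
        by (simp only:)
      \<comment> \<open>The factor \<open>sqrt 3\<close>, at least 1, is inserted in order to
        recognise \<open>V\<close> on the right; the 50 is 200 divided by the 4 in
        \<open>4 * pi\<^sup>2\<close>.\<close>
      also have "\<dots> \<le> Z * (200 * (C + norm S0) * (t\<^sup>2 * sqrt t)) * sqrt 3"
      proof -
        have "0 \<le> Z * (200 * (C + norm S0) * (t\<^sup>2 * sqrt t))" using Z C sp(1) by simp
        then show ?thesis using mult_left_mono[of 1 "sqrt 3"] by fastforce
      qed
      also have "\<dots> = 4 * pi\<^sup>2 * exp (- (t * real n)) * (50 * (C + norm S0) * V * sqrt t)"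
        by (simp add: V_def exp_minus field_simps)
      finally have XV: "norm (X - of_real V * S0) \<le> 50 * (C + norm S0) * V * sqrt t"
        by (simp add: mult_le_cancel_left_pos)
      \<comment> \<open>The logarithm of the ratio of \<open>V\<close> to \<open>main_term\<close>
        is of order \<open>t\<close>, below the order \<open>sqrt t\<close> of the localization
        error.\<close>
      define \<delta> where "\<delta> = ln (V / W)"
      have \<delta>: "\<bar>\<delta>\<bar> \<le> B * t"
        using Zt_asymptotic[OF n t(2)[unfolded t_def]] unfolding \<delta>_def V_def W_def Z_def B_def t_def .
      have VW: "V = W * exp \<delta>" using V W by (simp add: \<delta>_def)
      have B: "0 \<le> B" by (simp add: B_def)
      have \<delta>B: "\<bar>\<delta>\<bar> \<le> B" using \<delta> mult_left_mono[OF t(2) B] by linarith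
      have ts: "t \<le> sqrt t"
      proof -
        have "sqrt t * sqrt t \<le> sqrt t * 1" using t sp(1) by (intro mult_left_mono) auto
        then show ?thesis using sp(1) by simp
      qed
      have "V \<le> W * exp B" unfolding VW using \<delta>B W by (intro mult_left_mono) auto
      then have XV2: "norm (X - of_real V * S0) \<le> 50 * (C + norm S0) * (W * exp B) * sqrt t"
        using C sp(1) by (intro order_trans[OF XV] mult_right_mono mult_left_mono) auto
      have "norm (of_real (exp \<delta>) - 1 :: complex) \<le> norm (of_real \<delta> :: complex) * exp (norm (of_real \<delta> :: complex))"
        unfolding exp_of_real[symmetric] by (rule norm_exp_minus_one_le)
      also have "\<dots> \<le> (B * t) * exp B" using \<delta> \<delta>B B sp(1) by (intro mult_mono) auto
      also have "\<dots> \<le> (B * sqrt t) * exp B" using ts B by (intro mult_right_mono mult_left_mono) auto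
      finally have ed: "norm (of_real (exp \<delta>) - 1 :: complex) \<le> B * sqrt t * exp B" .
      have "norm (of_real V * S0 - of_real W * S0) = W * norm (of_real (exp \<delta>) - 1 :: complex) * norm S0"
      proof -
        have "of_real V * S0 - of_real W * S0 = of_real W * (of_real (exp \<delta>) - 1) * S0"
          by (simp add: VW algebra_simps)
        then show ?thesis using W by (simp only: norm_mult norm_of_real)
      qed
      also have "\<dots> \<le> W * (B * sqrt t * exp B) * norm S0"
        using ed W by (intro mult_right_mono mult_left_mono) auto
      finally have VW2: "norm (of_real V * S0 - of_real W * S0) \<le> W * (B * sqrt t * exp B) * norm S0" .
      have "norm (X - of_real W * S0) \<le> norm (X - of_real V * S0) + norm (of_real V * S0 - of_real W * S0)"
        using norm_triangle_ineq[of "X - of_real V * S0" "of_real V * S0 - of_real W * S0"] by simp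
      also have "\<dots> \<le> 50 * (C + norm S0) * (W * exp B) * sqrt t + W * (B * sqrt t * exp B) * norm S0"
        using XV2 VW2 by linarith
      also have "\<dots> = (C' / 2 * W) * sqrt t" by (simp add: C'_def algebra_simps)
      also have "\<dots> \<le> (C' / 2 * W) * (2 * real n powr (- 1 / 4))"
        using sp(4) \<open>0 \<le> C'\<close> W by (intro mult_left_mono) auto
      finally show ?case by (simp add: X_def W_def)
    qed
  qed
  ultimately show thesis by (rule that)
qed

section \<open>Partitions as sets of parts\<close>

lemma finite_subset_sums: fixes K n :: nat shows "finite {S. S \<subseteq> {K<..n} \<and> P S}"
  by (rule finite_subset[of _ "Pow {K<..n}"]) auto

text \<open>A partition into distinct parts is determined by its set of parts, and no part exceeds
  the sum, so the range up to \<open>n\<close> loses nothing.\<close>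

lemma bij_betw_distinct_partitions:
  "bij_betw mset_set {S. S \<subseteq> {K<..n} \<and> \<Sum>S = n} (distinct_partitions_gt K n)"
proof (rule bij_betwI[where g = set_mset])
  show "mset_set \<in> {S. S \<subseteq> {K<..n} \<and> \<Sum>S = n} \<rightarrow> distinct_partitions_gt K n"
  proof
    fix S assume "S \<in> {S. S \<subseteq> {K<..n} \<and> \<Sum>S = n}"
    then have S: "S \<subseteq> {K<..n}" "\<Sum>S = n" by auto
    then have fin: "finite S" using finite_subset by blast
    have "sum_mset (mset_set S) = n" using S sum_unfold_sum_mset[of "\<lambda>x. x" S] by simp
    then show "mset_set S \<in> distinct_partitions_gt K n"
      using S fin by (auto simp: distinct_partitions_gt_def count_mset_set')
  qed
  have id: "mset_set (set_mset P) = P" if "P \<in> distinct_partitions_gt K n" for P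
  proof (rule multiset_eqI)
    fix p
    have "count P p \<le> 1" using that by (auto simp: distinct_partitions_gt_def)
    then have "count P p = 0 \<or> count P p = 1" by linarith
    then show "count (mset_set (set_mset P)) p = count P p"
      by (auto simp: count_mset_set' count_eq_zero_iff)
  qed
  show "set_mset \<in> distinct_partitions_gt K n \<rightarrow> {S. S \<subseteq> {K<..n} \<and> \<Sum>S = n}"
  proof
    fix P assume P: "P \<in> distinct_partitions_gt K n"
    have s: "\<Sum>(set_mset P) = n"
      using P sum_unfold_sum_mset[of "\<lambda>x. x" "set_mset P"] id[OF P] by (simp add: distinct_partitions_gt_def)
    have "p \<le> n" if "p \<in># P" for p
      using member_le_sum[of p "set_mset P" "\<lambda>x. x"] that s by simp
    then show "set_mset P \<in> {S. S \<subseteq> {K<..n} \<and> \<Sum>S = n}" using P s by (auto simp: distinct_partitions_gt_def)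
  qed
  show "set_mset (mset_set S) = S" if "S \<in> {S. S \<subseteq> {K<..n} \<and> \<Sum>S = n}" for S
    using that finite_subset[of S "{K<..n}"] by simp
  show "mset_set (set_mset P) = P" if "P \<in> distinct_partitions_gt K n" for P by (rule id[OF that])
qed

lemma excess_eq:
  assumes "finite S" shows "excess S = int (odd_parts (mset_set S)) - int (even_parts (mset_set S))"
  using assms
proof (induction S rule: finite_induct)
  case (insert p S)
  then show ?case by (auto simp: excess_def odd_parts_def even_parts_def)
qed (simp add: excess_def odd_parts_def even_parts_def)

lemma card_partitions_eq:
  "card {P \<in> distinct_partitions_gt K n. Q (int (odd_parts P) - int (even_parts P))}
    = card {S. S \<subseteq> {K<..n} \<and> \<Sum>S = n \<and> Q (excess S)}"
proof -
  have sub: "{S. S \<subseteq> {K<..n} \<and> \<Sum>S = n \<and> Q (excess S)} \<subseteq> {S. S \<subseteq> {K<..n} \<and> \<Sum>S = n}" by auto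
  have ex: "excess S = int (odd_parts (mset_set S)) - int (even_parts (mset_set S))"
    if "S \<subseteq> {K<..n}" for S using excess_eq finite_subset[OF that] by simp
  have "mset_set ` {S. S \<subseteq> {K<..n} \<and> \<Sum>S = n \<and> Q (excess S)}
      = {P \<in> distinct_partitions_gt K n. Q (int (odd_parts P) - int (even_parts P))}"
    unfolding bij_betw_imp_surj_on[OF bij_betw_distinct_partitions, symmetric] using ex by auto
  then have "bij_betw mset_set {S. S \<subseteq> {K<..n} \<and> \<Sum>S = n \<and> Q (excess S)}
      {P \<in> distinct_partitions_gt K n. Q (int (odd_parts P) - int (even_parts P))}"
    using bij_betw_subset[OF bij_betw_distinct_partitions sub] by simp
  then show ?thesis using bij_betw_same_card by fastforce
qed

lemma d12_eq: "d12 K n = card {S. S \<subseteq> {K<..n} \<and> \<Sum>S = n \<and> 0 < excess S}"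
  unfolding d12_def using card_partitions_eq[of K n "\<lambda>d. 0 < d"] by simp

lemma d21_eq: "d21 K n = card {S. S \<subseteq> {K<..n} \<and> \<Sum>S = n \<and> excess S < 0}"
  unfolding d21_def using card_partitions_eq[of K n "\<lambda>d. d < 0"] by simp

text \<open>Partitions with equally many odd and even parts have sign 0 and drop out, which makes
  the difference a single sum with the means of \<open>sgn_kernel\<close> as coefficients.\<close>

lemma d12_minus_d21: "real (d12 K n) - real (d21 K n) = (\<Sum>S | S \<subseteq> {K<..n} \<and> \<Sum>S = n. of_int (sgn (excess S)))"
proof -
  define A where "A = {S. S \<subseteq> {K<..n} \<and> \<Sum>S = n}"
  have fin: "finite A" unfolding A_def by (rule finite_subset_sums)
  have card: "real (card {S \<in> A. Q S}) = (\<Sum>S\<in>A. if Q S then 1 else 0)" for Q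
    using sum.inter_filter[OF fin, of "\<lambda>_. 1 :: real" Q] by simp
  have "{S. S \<subseteq> {K<..n} \<and> \<Sum>S = n \<and> 0 < excess S} = {S \<in> A. 0 < excess S}"
    "{S. S \<subseteq> {K<..n} \<and> \<Sum>S = n \<and> excess S < 0} = {S \<in> A. excess S < 0}" by (auto simp: A_def)
  then have "real (d12 K n) - real (d21 K n)
    = (\<Sum>S\<in>A. if 0 < excess S then 1 else 0) - (\<Sum>S\<in>A. if excess S < 0 then 1 else 0)"
    unfolding d12_eq d21_eq by (simp only: card)
  also have "\<dots> = (\<Sum>S\<in>A. of_int (sgn (excess S)))"
    unfolding sum_subtractf[symmetric] by (intro sum.cong) (auto simp: sgn_if)
  finally show ?thesis unfolding A_def .
qed

section \<open>The difference and the individual excess classes\<close>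

lemma difference_asymptotic:
  fixes K :: nat
  obtains C where "0 \<le> C"
    "\<forall>\<^sub>F n in sequentially. \<bar>(real (d12 K n) - real (d21 K n)) - (-1) ^ K / 2 * main_term K n\<bar>
      \<le> C * main_term K n * real n powr (- 1 / 4)"
proof (rule sgn_kernel_arcs[of K])
  fix C t0 :: real assume C: "0 \<le> C" "0 < t0" and bd:
    "\<And>t N \<theta> \<alpha>. 0 < t \<Longrightarrow> t \<le> t0 \<Longrightarrow> t \<le> 1 \<Longrightarrow> real N * t\<^sup>2 = pi\<^sup>2 / 12 \<Longrightarrow> K \<le> N \<Longrightarrow> \<bar>\<theta>\<bar> \<le> pi \<Longrightarrow> \<bar>\<alpha>\<bar> \<le> pi \<Longrightarrow> \<alpha> \<noteq> 0 \<Longrightarrow>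
      norm (cis (- (real N * \<theta>)) * (\<Sum>S\<in>Pow {K<..N}. of_real (exp (- (t * real (\<Sum>S)))) * cis (\<theta> * real (\<Sum>S)) * sgn_kernel (excess S) \<alpha>)
        - of_real (Zt {K<..N} t) * ((-1) ^ K / 2) * of_real (exp (- gauss_exp t \<theta> \<alpha>)))
      \<le> Zt {K<..N} t * (C * sqrt t * exp (- gauss_exp t \<theta> \<alpha> / 4) + C * t ^ 3)"
  obtain C' where C': "0 \<le> C'" and ev:
    "\<forall>\<^sub>F n in sequentially. norm ((\<Sum>S | S \<subseteq> {K<..n} \<and> \<Sum>S = n. of_int (sgn (excess S))) - of_real (main_term K n) * ((-1) ^ K / 2) :: complex)
       \<le> C' * main_term K n * real n powr (- 1 / 4)"
    by (rule coefficient_asymptotic[where T = "\<lambda>S. sgn_kernel (excess S)" and \<tau> = "\<lambda>S. of_int (sgn (excess S))"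
          and ?S0.0 = "(-1) ^ K / 2" and K = K, OF _ _ C bd])
      (rule continuous_on_sgn_kernel integral_sgn_kernel | assumption)+
  have "(\<Sum>S | S \<subseteq> {K<..n} \<and> \<Sum>S = n. of_int (sgn (excess S))) - of_real (main_term K n) * ((-1) ^ K / 2)
    = (of_real ((real (d12 K n) - real (d21 K n)) - (-1) ^ K / 2 * main_term K n) :: complex)" for n
    unfolding d12_minus_d21 by simp
  then have "\<forall>\<^sub>F n in sequentially. \<bar>(real (d12 K n) - real (d21 K n)) - (-1) ^ K / 2 * main_term K n\<bar>
      \<le> C' * main_term K n * real n powr (- 1 / 4)" using ev by (simp only: norm_of_real)
  then show thesis by (rule that[OF C'])
qed

lemma fixed_excess_asymptotic:
  fixes K :: nat and d :: int
  obtains C where "0 \<le> C"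
    "\<forall>\<^sub>F n in sequentially. \<bar>real (card {S. S \<subseteq> {K<..n} \<and> \<Sum>S = n \<and> excess S = d}) - main_term K n\<bar>
      \<le> C * main_term K n * real n powr (- 1 / 4)"
proof (rule cis_kernel_arcs[of K d])
  fix C t0 :: real assume C: "0 \<le> C" "0 < t0" and bd:
    "\<And>t N \<theta> \<alpha>. 0 < t \<Longrightarrow> t \<le> t0 \<Longrightarrow> t \<le> 1 \<Longrightarrow> real N * t\<^sup>2 = pi\<^sup>2 / 12 \<Longrightarrow> K \<le> N \<Longrightarrow> \<bar>\<theta>\<bar> \<le> pi \<Longrightarrow> \<bar>\<alpha>\<bar> \<le> pi \<Longrightarrow> \<alpha> \<noteq> 0 \<Longrightarrow>
      norm (cis (- (real N * \<theta>)) * (\<Sum>S\<in>Pow {K<..N}. of_real (exp (- (t * real (\<Sum>S)))) * cis (\<theta> * real (\<Sum>S)) * cis (of_int (excess S - d) * \<alpha>))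
        - of_real (Zt {K<..N} t) * 1 * of_real (exp (- gauss_exp t \<theta> \<alpha>)))
      \<le> Zt {K<..N} t * (C * sqrt t * exp (- gauss_exp t \<theta> \<alpha> / 4) + C * t ^ 3)"
  have int: "integral {-pi..pi} (\<lambda>\<alpha>. cis (of_int (excess S - d) * \<alpha>)) = of_real (2 * pi) * (if excess S = d then 1 else 0)" for S
    unfolding integral_cis by simp
  have cont: "continuous_on {-pi..pi} (\<lambda>\<alpha>. cis (of_int (excess S - d) * \<alpha>))" for S by (intro continuous_intros)
  obtain C' where C': "0 \<le> C'" and ev:
    "\<forall>\<^sub>F n in sequentially. norm ((\<Sum>S | S \<subseteq> {K<..n} \<and> \<Sum>S = n. if excess S = d then 1 else 0) - of_real (main_term K n) * 1 :: complex)
       \<le> C' * main_term K n * real n powr (- 1 / 4)"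
    by (rule coefficient_asymptotic[where T = "\<lambda>S \<alpha>. cis (of_int (excess S - d) * \<alpha>)"
          and \<tau> = "\<lambda>S. if excess S = d then 1 else 0" and ?S0.0 = 1 and K = K, OF cont int C bd])
  have "(\<Sum>S | S \<subseteq> {K<..n} \<and> \<Sum>S = n. if excess S = d then 1 else 0) - of_real (main_term K n) * 1
    = (of_real (real (card {S. S \<subseteq> {K<..n} \<and> \<Sum>S = n \<and> excess S = d}) - main_term K n) :: complex)" for n
  proof -
    have "(\<Sum>S | S \<subseteq> {K<..n} \<and> \<Sum>S = n. if excess S = d then 1 else (0 :: complex))
      = (\<Sum>S\<in>{S \<in> {S. S \<subseteq> {K<..n} \<and> \<Sum>S = n}. excess S = d}. 1)"
      by (rule sum.inter_filter[OF finite_subset_sums, symmetric])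
    then show ?thesis by (simp add: conj_assoc)
  qed
  then have "\<forall>\<^sub>F n in sequentially. \<bar>real (card {S. S \<subseteq> {K<..n} \<and> \<Sum>S = n \<and> excess S = d}) - main_term K n\<bar>
      \<le> C' * main_term K n * real n powr (- 1 / 4)" using ev by (simp only: norm_of_real)
  then show thesis by (rule that[OF C'])
qed

lemma eventually_powr_less_half: "\<forall>\<^sub>F n in sequentially. C * real n powr (- 1 / 4) < 1 / 2"
proof -
  have "((\<lambda>n. C * real n powr (- 1 / 4)) \<longlongrightarrow> C * 0) sequentially"
    by (intro tendsto_mult tendsto_const tendsto_neg_powr filterlim_real_sequentially) auto
  then show ?thesis by (intro order_tendstoD) auto
qed

text \<open>Keeping only half of the asymptotic size of each class absorbs its error once
  \<open>n\<close> is large, and finitely many classes have a common threshold. So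
  \<open>d21 K n\<close> outgrows every multiple of \<open>main_term K n\<close>, without an
  asymptotic formula of its own.\<close>

lemma d21_ge_multiple_main_term:
  "\<forall>\<^sub>F n in sequentially. real J / 2 * main_term K n \<le> real (d21 K n)"
proof -
  define A where "A = (\<lambda>n d. {S. S \<subseteq> {K<..n} \<and> \<Sum>S = n \<and> excess S = d})"
  have "\<forall>\<^sub>F n in sequentially. main_term K n / 2 \<le> real (card (A n d))" for d
  proof -
    obtain C where "0 \<le> C" and ev: "\<forall>\<^sub>F n in sequentially. \<bar>real (card (A n d)) - main_term K n\<bar> \<le> C * main_term K n * real n powr (- 1 / 4)"
      unfolding A_def by (rule fixed_excess_asymptotic[of K d])
    show ?thesis
      using ev eventually_powr_less_half[of C] eventually_gt_at_top[of 0]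
    proof eventually_elim
      case (elim n)
      have "main_term K n * (C * real n powr (- 1 / 4)) \<le> main_term K n * (1 / 2)"
        using elim(2) main_term_pos[OF elim(3), of K] by (intro mult_left_mono) auto
      then show ?case using elim(1) by (simp add: mult_ac abs_le_iff)
    qed
  qed
  then have "\<forall>\<^sub>F n in sequentially. \<forall>j\<in>{1..J}. main_term K n / 2 \<le> real (card (A n (- int j)))"
    by (intro eventually_ball_finite) auto
  then show ?thesis
  proof eventually_elim
    case (elim n)
    have fin: "finite (A n d)" for d unfolding A_def by (rule finite_subset_sums)
    have "real J / 2 * main_term K n = (\<Sum>j\<in>{1..J}. main_term K n / 2)" by simp
    also have "\<dots> \<le> (\<Sum>j\<in>{1..J}. real (card (A n (- int j))))" using elim by (intro sum_mono) auto
    also have "\<dots> = real (card (\<Union>j\<in>{1..J}. A n (- int j)))"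
      using fin by (subst card_UN_disjoint) (auto simp: A_def)
    also have "\<dots> \<le> real (d21 K n)"
      unfolding d21_eq of_nat_le_iff by (intro card_mono finite_subset_sums) (auto simp: A_def)
    finally show ?case .
  qed
qed

theorem corollary1p3:
  fixes K :: nat
  shows "(\<exists>E :: nat \<Rightarrow> real. E \<in> O(\<lambda>n. real n powr (-1/4)) \<and>
            (\<forall>\<^sub>F n in sequentially.
               real (d12 K n) - real (d21 K n) =
                 (-1) ^ K * exp (pi * sqrt (real n / 3)) / (2 ^ (K + 3) * sqrt 6 * real n)
                   * (1 + E n)))
         \<and> (\<lambda>n. real (d12 K n) / real (d21 K n)) \<longlonglongrightarrow> 1"
proof
  obtain C where C: "0 \<le> C" and ev:
    "\<forall>\<^sub>F n in sequentially. \<bar>(real (d12 K n) - real (d21 K n)) - (-1) ^ K / 2 * main_term K n\<bar>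
      \<le> C * main_term K n * real n powr (- 1 / 4)"
    by (rule difference_asymptotic[of K])
  define m where "m = (\<lambda>n. (-1) ^ K * exp (pi * sqrt (real n / 3)) / (2 ^ (K + 3) * sqrt 6 * real n))"
  have m_eq: "m n = (-1) ^ K / 2 * main_term K n" for n
    by (simp add: m_def main_term_def power_add)
  \<comment> \<open>The error is read off as a quotient; \<open>m n\<close> is nonzero for positive
    \<open>n\<close>, and the sign \<open>(-1) ^ K\<close> disappears in its absolute value.\<close>
  define E where "E = (\<lambda>n. (real (d12 K n) - real (d21 K n)) / m n - 1)"
  have m_abs: "\<bar>m n\<bar> = main_term K n / 2" "m n \<noteq> 0" if "0 < n" for n
    using main_term_pos[OF that, of K] by (auto simp: m_eq abs_mult)
  have "\<forall>\<^sub>F n in sequentially. norm (E n) \<le> (2 * C) * norm (real n powr (-1/4))"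
    using ev eventually_gt_at_top[of 0]
  proof eventually_elim
    case (elim n)
    have "E n = ((real (d12 K n) - real (d21 K n)) - m n) / m n"
      using m_abs(2)[OF elim(2)] by (simp add: E_def diff_divide_distrib)
    then have "\<bar>E n\<bar> = \<bar>(real (d12 K n) - real (d21 K n)) - m n\<bar> / (main_term K n / 2)"
      by (simp only: abs_divide m_abs(1)[OF elim(2)])
    also have "\<dots> \<le> (C * main_term K n * real n powr (- 1 / 4)) / (main_term K n / 2)"
      unfolding m_eq using main_term_pos[OF elim(2), of K] by (intro divide_right_mono elim(1)) auto
    also have "\<dots> = 2 * C * real n powr (- 1 / 4)" using main_term_pos[OF elim(2), of K] by simp
    finally show ?case by simp
  qed
  then have "E \<in> O(\<lambda>n. real n powr (-1/4))" by (rule bigoI)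
  moreover have "\<forall>\<^sub>F n in sequentially. real (d12 K n) - real (d21 K n) = m n * (1 + E n)"
    using eventually_gt_at_top[of 0]
  proof eventually_elim
    case (elim n)
    then show ?case using m_abs(2)[of n] by (simp add: E_def)
  qed
  ultimately show "\<exists>E :: nat \<Rightarrow> real. E \<in> O(\<lambda>n. real n powr (-1/4)) \<and>
            (\<forall>\<^sub>F n in sequentially.
               real (d12 K n) - real (d21 K n) =
                 (-1) ^ K * exp (pi * sqrt (real n / 3)) / (2 ^ (K + 3) * sqrt 6 * real n)
                   * (1 + E n))"
    unfolding m_def by blast
  show "(\<lambda>n. real (d12 K n) / real (d21 K n)) \<longlonglongrightarrow> 1"
  proof (rule tendstoI)
    fix e :: real assume e: "0 < e"
    \<comment> \<open>The quotient will differ from 1 by at most \<open>2 / J\<close>, so this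
      choice brings it below \<open>e\<close>.\<close>
    obtain J :: nat where J: "4 / e < real J" using reals_Archimedean2 by blast
    then have J0: "0 < real J" using e by (meson divide_pos_pos less_trans zero_less_numeral)
    show "\<forall>\<^sub>F n in sequentially. dist (real (d12 K n) / real (d21 K n)) 1 < e"
      using ev eventually_powr_less_half[of C] d21_ge_multiple_main_term[of J K] eventually_gt_at_top[of 0]
    proof eventually_elim
      case (elim n)
      define W where "W = main_term K n"
      have W: "0 < W" using main_term_pos[OF elim(4)] by (simp add: W_def)
      have d: "0 < real (d21 K n)" using elim(3) W J0 unfolding W_def by (smt (verit) divide_pos_pos mult_pos_pos)
      have "W * (C * real n powr (- 1 / 4)) \<le> W * (1 / 2)" using elim(2) W by (intro mult_left_mono) auto
      moreover have "\<bar>(-1) ^ K / 2 * W\<bar> = W / 2" using W by (simp add: abs_mult)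
      \<comment> \<open>One half of \<open>W\<close> is the leading term, and the other half bounds
        the error because \<open>C * real n powr (- 1 / 4) < 1 / 2\<close>.\<close>
      ultimately have le: "\<bar>real (d12 K n) - real (d21 K n)\<bar> \<le> W"
        using elim(1) unfolding W_def[symmetric] by (simp add: mult_ac)
      have "dist (real (d12 K n) / real (d21 K n)) 1 = \<bar>real (d12 K n) - real (d21 K n)\<bar> / real (d21 K n)"
        using d by (simp add: dist_real_def divide_simps)
      also have "\<dots> \<le> W / (real J / 2 * W)"
        using le elim(3) W J0 unfolding W_def[symmetric] by (intro frac_le) auto
      also have "\<dots> = 2 / real J" using W by simp
      also have "\<dots> < e" using J J0 e by (simp add: field_simps)
      finally show ?case .
    qed
  qed
qed

end
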